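(* Let $c>1$ and $p,q,r\ge 0$ with $p+q+r=1$, $p+r>0$, $q+r>0$, and let $\rho^{(k)},\mu^{(k)}$ ($k\in\mathbb{Z}$) be the associated distributions. (i) If $p=0$ or if $r=0$, then $\rho^{(k)}$ and $\mu^{(k)}$ are in $ID$ for every $k\in\mathbb{Z}$. (ii) If $0<r<p$, then $\rho^{(k)}$ and $\mu^{(k)}$ are in $ID\cup ID^0$ for every $k\in\mathbb{Z}$, with quasi-Lévy measures being concentrated on $(0,\infty)$. (iii) If $0<p<r$, then $\rho^{(k)}$ and $\mu^{(k)}$ are in $ID^{0}$ for every $k\in\mathbb{Z}$. (iv) If $p=r>0$, then $\rho^{(k)}$ and $\mu^{(k)}$ are in $ID^{00}$ for every $k\in\mathbb{Z}$.
   Context: Setup. For $k\in\mathbb{Z}$ let $\{(N_t^{(k)},L_t^{(k)}),t\ge0\}$ be the bivariate compound Poisson process (pure jump, no drift) with $E[e^{i(z_1N_t^{(k)}+z_2L_t^{(k)})}]=\exp[t\int_{\mathbb{R}^2}(e^{i(z_1x_1+z_2x_2)}-1)\nu^{(k)}(dx)]$, where $\nu^{(k)}$ is concentrated on the points $(1,0)$, $(0,1)$, $(1,c^{-k})$ with masses $u,v,w\ge0$ respectively, and $p=u/(u+v+w)$, $q=v/(u+v+w)$, $r=w/(u+v+w)$. Let $T$ be the first jump time of $\{N_t^{(k)}\}$. Define $\rho^{(k)}$ as the distribution of $L_T^{(k)}$, and $\mu^{(k)}$ as the distribution of $\int_0^{\infty-}c^{-N^{(k)}_{s-}}\,dL_s^{(k)}$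 (the almost sure limit of $\int_0^t$ as $t\to\infty$, which exists). These depend on $u,v,w$ only through $p,q,r$. Quasi-infinite divisibility. A distribution $\sigma$ on $\mathbb{R}$ is quasi-infinitely divisible if its characteristic function is $\widehat\sigma(z)=\exp[i\gamma z-az^2+\int_{\mathbb{R}}(e^{izx}-1-izx1_{[-1,1]}(x))\,\nu_\sigma(dx)]$, where $\gamma,a\in\mathbb{R}$ and $\nu_\sigma$ is a signed measure (a difference $\nu_\sigma^+-\nu_\sigma^-$ of mutually singular measures, possibly both of infinite mass near $0$) with total variation measure $|\nu_\sigma|$ satisfying $\nu_\sigma(\{0\})=0$ and $\int(x^2\wedge1)\,|\nu_\sigma|(dx)<\infty$. Then $\gamma,a,\nu_\sigma$ are unique, and $\nu_\sigma$ is called the quasi-Lévy measure of $\sigma$. $ID$ is the class of infinitely divisible distributions on $\mathbb{R}$, $ID^0$ the class of quasi-infinitely divisible distributions that are not infinitely divisible, $ID^{00}$ the class of distributions on $\mathbb{R}$ that are not quasi-infinitely divisible. *)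

theory Defs
  imports "HOL-Probability.Probability"
begin

text \<open>Processes are indexed by \<^typ>\<open>real\<close>; only times \<open>t \<ge> 0\<close> are meaningful.\<close>

definition cadlag :: "(real \<Rightarrow> 'b::topological_space) \<Rightarrow> bool" where
  "cadlag f \<longleftrightarrow> (\<forall>t\<ge>0. (f \<longlongrightarrow> f t) (at_right t)) \<and> (\<forall>t>0. \<exists>l. (f \<longlongrightarrow> l) (at_left t))"

text \<open>Stochastic continuity is not listed separately: it follows from right-continuity of the
  paths together with stationarity of the increments.\<close>

definition levy_process :: "'a measure \<Rightarrow> (real \<Rightarrow> 'a \<Rightarrow> 'b::euclidean_space) \<Rightarrow> bool" where
  "levy_process M X \<longleftrightarrow>
     prob_space M \<and>
     (\<forall>t\<ge>0. X t \<in> borel_measurable M) \<and>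
     (AE \<omega> in M. X 0 \<omega> = 0) \<and>
     (\<forall>(n::nat) (t :: nat \<Rightarrow> real). 0 \<le> t 0 \<and> mono t \<longrightarrow>
        prob_space.indep_vars M (\<lambda>_. borel) (\<lambda>i \<omega>. X (t (Suc i)) \<omega> - X (t i) \<omega>) {..<n}) \<and>
     (\<forall>s\<ge>0. \<forall>h\<ge>0. distr M borel (\<lambda>\<omega>. X (s + h) \<omega> - X s \<omega>) = distr M borel (X h)) \<and>
     (AE \<omega> in M. cadlag (\<lambda>t. X t \<omega>))"

definition jump_measure :: "real \<Rightarrow> int \<Rightarrow> real \<Rightarrow> real \<Rightarrow> real \<Rightarrow> (real \<times> real) measure" where
  "jump_measure c k u v w =
     distr (point_measure {(1, 0), (0, 1), (1, c powi (- k))}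
              (\<lambda>x. ennreal (if x = (1, 0) then u else if x = (0, 1) then v else w)))
           borel (\<lambda>x. x)"

lemma integral_jump_measure:
  fixes g :: "real \<times> real \<Rightarrow> complex"
  assumes "c > 1" "u \<ge> 0" "v \<ge> 0" "w \<ge> 0" and [measurable]: "g \<in> borel_measurable borel"
  shows "(CLINT x|jump_measure c k u v w. g x) =
           u * g (1, 0) + v * g (0, 1) + w * g (1, c powi (- k))"
proof -
  have "c powi (- k) \<noteq> 0" using assms(1) by simp
  moreover have "(\<lambda>x. x) \<in> measurable (point_measure A f) borel"
    for A :: "(real \<times> real) set" and f
    by (simp add: measurable_def sets_point_measure space_point_measure)
  ultimately show ?thesis using assms(2-4) unfolding jump_measure_def
    by (subst integral_distr)
       (auto simp: lebesgue_integral_point_measure_finite scaleR_conv_of_real)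
qed

text \<open>The compound Poisson process: a Levy process whose characteristic function is given by the
  finite Levy measure above, without drift.\<close>

definition bivariate_cpp ::
  "real \<Rightarrow> int \<Rightarrow> real \<Rightarrow> real \<Rightarrow> real \<Rightarrow> 'a measure \<Rightarrow> (real \<Rightarrow> 'a \<Rightarrow> real) \<Rightarrow> (real \<Rightarrow> 'a \<Rightarrow> real) \<Rightarrow> bool"
where
  "bivariate_cpp c k u v w M N L \<longleftrightarrow>
     levy_process M (\<lambda>t \<omega>. (N t \<omega>, L t \<omega>)) \<and>
     (\<forall>t\<ge>0. \<forall>z1 z2.
        (CLINT \<omega>|M. iexp (z1 * N t \<omega> + z2 * L t \<omega>)) =
        exp (complex_of_real t *
          (CLINT x|jump_measure c k u v w. iexp (z1 * fst x + z2 * snd x) - 1)))"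

definition left_limit :: "(real \<Rightarrow> real) \<Rightarrow> real \<Rightarrow> real" where
  "left_limit f t = Lim (at_left t) f"

definition first_jump_time :: "(real \<Rightarrow> real) \<Rightarrow> real" where
  "first_jump_time f = Inf {t. t > 0 \<and> f t \<noteq> left_limit f t}"

text \<open>Pathwise Lebesgue-Stieltjes integral over \<open>(0, t]\<close>. The integrator is extended to negative
  times by its value at \<open>0\<close>. The Stieltjes measure is meaningful for nondecreasing
  right-continuous integrators; here almost every path of \<open>L\<close> is of this kind, since all jumps of
  \<open>L\<close> are positive.\<close>

definition exp_integral :: "real \<Rightarrow> (real \<Rightarrow> real) \<Rightarrow> (real \<Rightarrow> real) \<Rightarrow> real \<Rightarrow> real" where
  "exp_integral c n l t =
     (LINT s:{0<..t}|interval_measure (\<lambda>s. l (max 0 s)). c powr (- left_limit n s))"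

text \<open>The two random variables below are determined by the paths only up to a null set of bad
  paths (not cadlag, not monotone, divergent integral). Passing to the completion of \<open>M\<close> makes
  them measurable whatever values they take there.\<close>

definition rho_law :: "'a measure \<Rightarrow> (real \<Rightarrow> 'a \<Rightarrow> real) \<Rightarrow> (real \<Rightarrow> 'a \<Rightarrow> real) \<Rightarrow> real measure" where
  "rho_law M N L =
     distr (completion M) borel (\<lambda>\<omega>. L (first_jump_time (\<lambda>t. N t \<omega>)) \<omega>)"

definition mu_law :: "real \<Rightarrow> 'a measure \<Rightarrow> (real \<Rightarrow> 'a \<Rightarrow> real) \<Rightarrow> (real \<Rightarrow> 'a \<Rightarrow> real) \<Rightarrow> real measure" where
  "mu_law c M N L =
     distr (completion M) borel
       (\<lambda>\<omega>. Lim at_top (exp_integral c (\<lambda>t. N t \<omega>) (\<lambda>t. L t \<omega>)))"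

definition ID :: "real measure set" where
  "ID = {\<sigma>. real_distribution \<sigma> \<and>
          (\<forall>n\<ge>1. \<exists>\<tau>. real_distribution \<tau> \<and> \<sigma> = (convolution \<tau> ^^ n) (return borel 0))}"

text \<open>The signed measure \<open>\<nu>\<close> is represented by its Jordan decomposition \<open>(\<nu>p, \<nu>m)\<close>, because both
  parts may have infinite mass near \<open>0\<close>. The total variation measure is \<open>\<nu>p + \<nu>m\<close>, so its
  conditions are imposed on both parts.\<close>

definition mutually_singular :: "'a measure \<Rightarrow> 'a measure \<Rightarrow> bool" where
  "mutually_singular P Q \<longleftrightarrow>
     (\<exists>A\<in>sets P. emeasure P A = 0 \<and> emeasure Q (space Q - A) = 0)"

definition levy_integrable :: "real measure \<Rightarrow> bool" where
  "levy_integrable \<nu> \<longleftrightarrow>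
     sets \<nu> = sets borel \<and> emeasure \<nu> {0} = 0 \<and> (\<integral>\<^sup>+x. ennreal (min (x\<^sup>2) 1) \<partial>\<nu>) < \<infinity>"

definition levy_khintchine_kernel :: "real \<Rightarrow> real \<Rightarrow> complex" where
  "levy_khintchine_kernel z x = iexp (z * x) - 1 - \<i> * z * x * indicator {-1..1} x"

definition quasi_levy_triplet ::
  "real measure \<Rightarrow> real \<Rightarrow> real \<Rightarrow> real measure \<Rightarrow> real measure \<Rightarrow> bool"
where
  "quasi_levy_triplet \<sigma> \<gamma> a \<nu>p \<nu>m \<longleftrightarrow>
     levy_integrable \<nu>p \<and> levy_integrable \<nu>m \<and> mutually_singular \<nu>p \<nu>m \<and>
     (\<forall>z. char \<sigma> z = exp (\<i> * \<gamma> * z - a * z\<^sup>2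
            + ((CLINT x|\<nu>p. levy_khintchine_kernel z x) - (CLINT x|\<nu>m. levy_khintchine_kernel z x))))"

definition quasi_levy_measure :: "real measure \<Rightarrow> real measure \<Rightarrow> real measure \<Rightarrow> bool" where
  "quasi_levy_measure \<sigma> \<nu>p \<nu>m \<longleftrightarrow> (\<exists>\<gamma> a. quasi_levy_triplet \<sigma> \<gamma> a \<nu>p \<nu>m)"

definition QID :: "real measure set" where
  "QID = {\<sigma>. real_distribution \<sigma> \<and> (\<exists>\<nu>p \<nu>m. quasi_levy_measure \<sigma> \<nu>p \<nu>m)}"

definition ID0 :: "real measure set" where
  "ID0 = QID - ID"

definition ID00 :: "real measure set" where
  "ID00 = {\<sigma>. real_distribution \<sigma>} - QID"

text \<open>The quasi-Levy measure exists and is concentrated on \<open>(0, \<infinity>)\<close>; since a distribution has at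
  most one quasi-Levy measure, the existential quantifier speaks about that measure.\<close>

definition quasi_levy_measure_on_pos :: "real measure \<Rightarrow> bool" where
  "quasi_levy_measure_on_pos \<sigma> \<longleftrightarrow>
     (\<exists>\<nu>p \<nu>m. quasi_levy_measure \<sigma> \<nu>p \<nu>m \<and> emeasure \<nu>p {..0} = 0 \<and> emeasure \<nu>m {..0} = 0)"

end

theory Submission
  imports Defs
begin

text \<open>Let \<open>b = 0\<close> for \<open>\<rho>\<close> and \<open>b = 1 / c\<close> for \<open>\<mu>\<close>, and \<open>a = c\<^bsup>-k\<^esup>\<close>. Both laws arise from the process by
  integrating \<open>b\<^bsup>N(s-)\<^esup>\<close> (with \<open>0\<^sup>0 = 1\<close>) against \<open>L\<close>, and the characteristic function \<open>f\<close> of the integral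
  satisfies \<open>(1 - q e\<^bsup>iz\<^esup>) f(z) = (p + r e\<^bsup>iaz\<^esup>) f(bz)\<close>: the characteristic functions of the
  Riemann sums over a dyadic grid obey this equation up to an error that vanishes as the mesh
  tends to \<open>0\<close> and then the time horizon to infinity.

  If \<open>p = 0\<close> or \<open>r = 0\<close>, the roots of \<open>f\<close> are infinite products of negative binomial characteristic
  functions. If \<open>p \<noteq> r\<close>, expanding the logarithms of \<open>1 - q e\<^bsup>iz\<^esup>\<close> and \<open>p + r e\<^bsup>iaz\<^esup>\<close> gives the quasi-Levy
  measure. If \<open>0 < p < r\<close>, the Laplace transform of the law has a simple zero in the right
  half-plane, so it is not a square and the law is not infinitely divisible. If \<open>p = r > 0\<close>, then
  \<open>f(\<pi> / a) = 0\<close>, whereas exponentials do not vanish.\<close>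

section \<open>Convolution roots\<close>

text \<open>The functional equation is a renewal at the first jump of the pair: with probability q
  only L jumps, by 1, and a copy of the integral follows; with probability p only N jumps and the
  copy is scaled by b; with probability r both jump, L by a. The process is given by its increments,
  their laws and the regularity of its paths, not by jump times, so the equation is extracted from a
  grid instead of by conditioning on that jump. For 0 < p < r, infinite divisibility has to be
  refuted away from the real line, where p + r e^(iaz) has no zero. The law lives on the nonnegative
  half-line, so its Laplace transform exists for Re t >= 0, and there p + r e^(-at) vanishes at t0 =
  ln(r/p)/a + i pi/a, to the right of the imaginary axis because p < r. The remaining factor, the
  transform at b t0, cannot turn this into a double zero, since b t0 lies to the left of every zero
  of the transform. Arguing by zeros avoids any comparison of signed quasi-Levy measures.\<close>

lemma real_distribution_distr:
  assumes "prob_space M" "f \<in> borel_measurable M"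
  shows "real_distribution (distr M borel f)"
  using assms by (simp add: real_distribution_def prob_space.prob_space_distr real_distribution_axioms_def)

lemma real_distribution_convolution:
  assumes "real_distribution M" "real_distribution N"
  shows "real_distribution (M \<star> N)"
proof -
  interpret M: real_distribution M by fact
  interpret N: real_distribution N by fact
  interpret pair_prob_space M N ..
  show ?thesis
    unfolding convolution_def by (rule real_distribution_distr) (auto intro: prob_space_axioms)
qed

text \<open>Fubini applied to a multiplicative \<open>e\<close>. One statement serves characteristic
  functions and Laplace transforms; \<open>e\<close> may be unbounded on the negative half-line in
  the second use, hence integrability in place of a bound.\<close>

lemma integral_convolution_exponential:
  fixes e :: "real \<Rightarrow> complex"
  assumes "real_distribution M" "real_distribution N" and meas [measurable]: "e \<in> borel_measurable borel"
    and int: "integrable M e" "integrable N e" and mult: "\<And>x y. e (x + y) = e x * e y"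
  shows "(CLINT x|M \<star> N. e x) = (CLINT x|M. e x) * (CLINT x|N. e x)"
proof -
  interpret M: real_distribution M by fact
  interpret N: real_distribution N by fact
  interpret pair_prob_space M N ..
  have "integrable (M \<Otimes>\<^sub>M N) (\<lambda>x. e (fst x + snd x))"
    using int by (intro Fubini_integrable) (auto simp: mult norm_mult)
  then have "(CLINT x|M \<Otimes>\<^sub>M N. e (fst x + snd x)) = (CLINT x|M. CLINT y|N. e (x + y))"
    by (subst integral_fst'[symmetric]) (auto simp: case_prod_beta)
  then show ?thesis
    unfolding convolution_def by (subst integral_distr) (auto simp: case_prod_beta mult)
qed

lemma char_convolution:
  assumes "real_distribution M" "real_distribution N"
  shows "char (M \<star> N) z = char M z * char N z"
proof -
  interpret M: real_distribution M by fact
  interpret N: real_distribution N by fact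
  show ?thesis
    unfolding char_def
    using M.integrable_iexp[of "\<lambda>x. z * x"] N.integrable_iexp[of "\<lambda>x. z * x"]
    by (intro integral_convolution_exponential[OF assms]) (auto simp: ring_distribs exp_add)
qed

lemma real_distribution_return: "real_distribution (return borel x)"
  by (simp add: real_distribution_def real_distribution_axioms_def prob_space_return)

lemma char_return: "char (return borel x) z = iexp (z * x)"
  unfolding char_def by (subst integral_return) auto

lemma convolution_power:
  assumes "real_distribution \<tau>"
  shows "real_distribution ((convolution \<tau> ^^ n) (return borel 0))" (is ?A)
    and "char ((convolution \<tau> ^^ n) (return borel 0)) z = char \<tau> z ^ n" (is ?B)
proof -
  have "?A \<and> ?B"
    by (induction n) (auto simp: real_distribution_return char_return char_convolution assms
        real_distribution_convolution)
  then show ?A ?B by auto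
qed

text \<open>By Levy's uniqueness theorem, roots may be exhibited on the level of characteristic
  functions.\<close>

lemma ID_I:
  assumes "real_distribution \<sigma>"
    and "\<And>n. n \<ge> 1 \<Longrightarrow> \<exists>\<tau>. real_distribution \<tau> \<and> (\<forall>z. char \<tau> z ^ n = char \<sigma> z)"
  shows "\<sigma> \<in> ID"
  unfolding ID_def
proof (safe intro!: assms)
  fix n :: nat assume "n \<ge> 1"
  then obtain \<tau> where t: "real_distribution \<tau>" "\<And>z. char \<tau> z ^ n = char \<sigma> z"
    using assms(2) by blast
  have "\<sigma> = (convolution \<tau> ^^ n) (return borel 0)"
    using t by (intro Levy_uniqueness assms convolution_power) (auto simp: convolution_power)
  then show "\<exists>\<tau>. real_distribution \<tau> \<and> \<sigma> = (convolution \<tau> ^^ n) (return borel 0)"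
    using t by blast
qed

text \<open>The refutation of infinite divisibility works with two convolution factors.\<close>

lemma ID_square_root:
  assumes "\<sigma> \<in> ID"
  obtains \<tau> where "real_distribution \<tau>" "\<sigma> = (\<tau> \<star> \<tau>)"
proof -
  obtain \<tau> where t: "real_distribution \<tau>" "\<sigma> = (convolution \<tau> ^^ 2) (return borel 0)"
    using assms unfolding ID_def by (auto dest!: spec[of _ 2])
  have "\<sigma> = (\<tau> \<star> \<tau>)"
    unfolding t(2) by (intro Levy_uniqueness convolution_power real_distribution_convolution t ext)
      (simp add: convolution_power char_convolution t power2_eq_square)
  with t show ?thesis using that by blast
qed

section \<open>Negative binomial laws and scaled series of independent variables\<close>

text \<open>The generalized binomial series at exponent -s. The sign of the coefficient (-s choose
  n) cancels that of (-w)^n, which exhibits coefficients that are nonnegative for s >= 0.\<close>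

lemma sums_one_minus_powr:
  fixes w :: complex and s :: real
  assumes "norm w < 1"
  shows "(\<lambda>n. complex_of_real (pochhammer s n / fact n) * w ^ n) sums (1 - w) powr (- of_real s)"
proof -
  have eq: "((- complex_of_real s) gchoose n) * (- w) ^ n = complex_of_real (pochhammer s n / fact n) * w ^ n" for n
  proof -
    have "(- w) ^ n = (-1) ^ n * w ^ n" by (rule power_minus)
    moreover have "(-1::complex) ^ n * (-1) ^ n = 1"
      by (simp flip: power_mult_distrib)
    ultimately show ?thesis
      by (simp add: gbinomial_pochhammer field_simps pochhammer_of_real)
  qed
  show ?thesis
    using gen_binomial_complex[of "- w" "- of_real s"] assms unfolding eq by simp
qed

text \<open>Factorwise comparison with \<open>pochhammer 1 n\<close>, which is n!. Nonnegativity
  turns the binomial series into a probability mass function; the bound 1 lets a geometric series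
  dominate it.\<close>

lemma pochhammer_div_fact_bounds:
  fixes s :: real
  assumes "0 \<le> s" "s \<le> 1"
  shows "0 \<le> pochhammer s n / fact n" "pochhammer s n / fact n \<le> 1"
proof -
  show "0 \<le> pochhammer s n / fact n" using assms by (simp add: pochhammer_prod prod_nonneg)
  have "pochhammer s n \<le> pochhammer 1 n"
    unfolding pochhammer_prod using assms by (intro prod_mono) auto
  then show "pochhammer s n / fact n \<le> 1" by (simp flip: pochhammer_fact)
qed

text \<open>For s = 1/j this is the j-th convolution root of the geometric law with masses (1-q)
  q^n. The masses are the coefficients of the binomial series, normalized by (1-q)^s; the finite
  mean is what makes scaled series of such variables converge.\<close>

lemma neg_binomial_law:
  fixes q s :: real
  assumes q: "0 \<le> q" "q < 1" and s: "0 < s" "s \<le> 1"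
  obtains D where "real_distribution D" "AE x in D. x \<ge> 0" "integrable D (\<lambda>x. x)"
    "\<And>z. char D z = (of_real (1 - q)) powr of_real s * (1 - of_real q * iexp z) powr (- of_real s)"
proof -
  define c where "c n = pochhammer s n / fact n" for n
  have c: "0 \<le> c n" "c n \<le> 1" for n
    unfolding c_def using pochhammer_div_fact_bounds[of s n] s by auto
  define f where "f n = (1 - q) powr s * (c n * q ^ n)" for n
  have f0: "f n \<ge> 0" for n unfolding f_def using c q by simp
  have sums1: "(\<lambda>n. c n * q ^ n) sums ((1 - q) powr (- s))"
  proof -
    have "(\<lambda>n. complex_of_real (c n * q ^ n)) sums (of_real (1 - q)) powr (- of_real s)"
      using sums_one_minus_powr[of "of_real q" s] q by (simp add: c_def)
    also have "(complex_of_real (1 - q)) powr (- of_real s) = of_real ((1 - q) powr (- s))"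
      using powr_of_real[of "1 - q" "- s"] q by simp
    finally show ?thesis by (subst (asm) sums_of_real_iff)
  qed
  have "f sums ((1 - q) powr s * (1 - q) powr (- s))"
    unfolding f_def by (intro sums_mult sums1)
  then have fsums: "f sums 1" using q by (simp flip: powr_add)
  have nn: "(\<integral>\<^sup>+n. ennreal (f n) \<partial>count_space UNIV) = 1"
    using fsums f0 by (simp add: nn_integral_count_space_nat suminf_ennreal2 sums_iff)
  define P where "P = embed_pmf f"
  have pmf: "pmf P n = f n" for n
    unfolding P_def by (rule pmf_embed_pmf[OF f0 nn])
  have P_eq: "measure_pmf P = density (count_space UNIV) (\<lambda>n. ennreal (f n))"
    using measure_pmf_eq_density[of P] by (simp add: pmf cong: nn_integral_cong)
  define D where "D = distr (measure_pmf P) borel real"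
  show thesis
  proof
    show "real_distribution D"
      unfolding D_def by (intro real_distribution_distr measure_pmf.prob_space_axioms) auto
    show "AE x in D. x \<ge> 0" unfolding D_def by (subst AE_distr_iff) auto
    have "summable (\<lambda>n. real n * q ^ n)"
    proof -
      have "summable (\<lambda>n. diffs (\<lambda>n. 1) n * q ^ n)"
        by (rule termdiff_converges[of _ 1]) (use q in \<open>auto simp: summable_geometric\<close>)
      then have "summable (\<lambda>n. real (Suc n) * q ^ n)" by (simp add: diffs_def)
      then show ?thesis
        by (rule summable_comparison_test_ev[rotated]) (use q in \<open>auto intro!: always_eventually mult_right_mono\<close>)
    qed
    then have "summable (\<lambda>n. norm (f n * real n))"
    proof (rule summable_comparison_test_ev[rotated], intro always_eventually allI)
      fix n
      have "(1 - q) powr s \<le> 1" using q s by (simp add: powr_le1)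
      then have "f n \<le> q ^ n"
        unfolding f_def using c[of n] q mult_mono[of "(1 - q) powr s" 1 "c n" 1] 
          mult_right_mono[of "(1 - q) powr s * c n" 1 "q ^ n"] by (simp add: mult.assoc)
      then show "norm (norm (f n * real n)) \<le> real n * q ^ n"
        using f0[of n] by (simp add: abs_mult mult.commute mult_left_mono)
    qed
    then have "integrable (count_space UNIV) (\<lambda>n. f n * real n)"
      by (simp add: integrable_count_space_nat_iff)
    then show "integrable D (\<lambda>x. x)"
      unfolding D_def by (subst integrable_distr_eq)
        (auto simp: P_eq integrable_density f0)
  next
    fix z :: real
    define w where "w = of_real q * iexp z"
    have w: "norm w < 1" using q by (simp add: w_def norm_mult)
    have exp_eq: "exp (\<i> * (complex_of_real z * of_nat n)) = iexp z ^ n" for n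
      by (simp add: exp_of_nat_mult[symmetric] mult_ac)
    have "char D z = (CLINT n|measure_pmf P. iexp z ^ n)"
      unfolding char_def D_def by (subst integral_distr) (auto simp: exp_eq)
    also have "\<dots> = (CLINT n|count_space UNIV. f n *\<^sub>R iexp z ^ n)"
      unfolding P_eq by (subst integral_density) (auto simp: f0)
    also have "\<dots> = (\<Sum>n. f n *\<^sub>R iexp z ^ n)"
    proof (rule integral_count_space_nat)
      show "integrable (count_space UNIV) (\<lambda>n. f n *\<^sub>R iexp z ^ n)"
        using fsums f0 by (simp add: integrable_count_space_nat_iff norm_power sums_iff)
    qed
    also have "(\<lambda>n. f n *\<^sub>R iexp z ^ n) = (\<lambda>n. of_real ((1 - q) powr s) * (of_real (c n) * w ^ n))"
      by (simp add: f_def w_def scaleR_conv_of_real power_mult_distrib mult_ac)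
    also have "(\<Sum>n. of_real ((1 - q) powr s) * (of_real (c n) * w ^ n)) = of_real ((1 - q) powr s) * (1 - w) powr (- of_real s)"
      using sums_mult[OF sums_one_minus_powr[OF w, of s], of "of_real ((1 - q) powr s)"]
      by (simp add: sums_iff c_def)
    also have "complex_of_real ((1 - q) powr s) = (of_real (1 - q)) powr of_real s"
      using powr_of_real[of "1 - q" s] q by simp
    finally show "char D z = (of_real (1 - q)) powr of_real s * (1 - of_real q * iexp z) powr (- of_real s)"
      by (simp add: w_def)
  qed
qed

text \<open>The law \<open>\<tau>\<close> is that of the sum of b^i X_i with independent X_i
  distributed as \<open>D\<close>, realized by the coordinates of an infinite product space. For b =
  0 the convention 0^0 = 1 leaves the first term only.\<close>

lemma scaled_series_law:
  fixes b :: real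
  assumes D: "real_distribution D" and pos: "AE x in D. x \<ge> 0" and int: "integrable D (\<lambda>x. x)"
    and b: "0 \<le> b" "b < 1"
  obtains \<tau> where "real_distribution \<tau>"
    "\<And>z. (\<lambda>n. \<Prod>i<n. char D (b ^ i * z)) \<longlonglongrightarrow> char \<tau> z"
proof -
  interpret D: real_distribution D by fact
  define P where "P = (\<Pi>\<^sub>M i\<in>(UNIV::nat set). D)"
  interpret P: product_prob_space "\<lambda>_. D" "UNIV :: nat set"
    by unfold_locales
  interpret prob_space P unfolding P_def by (rule P.prob_space_axioms)
  have [measurable]: "(\<lambda>\<omega>. \<omega> i) \<in> borel_measurable P" for i
  proof -
    have "(\<lambda>\<omega>. \<omega> i) \<in> measurable P D"
      unfolding P_def by (rule measurable_component_singleton) simp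
    then show ?thesis by (subst (asm) measurable_cong_sets[OF refl D.events_eq_borel])
  qed
  have comp: "distr P borel (\<lambda>\<omega>. \<omega> i) = D" for i
    using P.PiM_component[of i] unfolding P_def[symmetric]
    by (metis D.events_eq_borel UNIV_I distr_cong)
  have "indep_vars (\<lambda>_. borel) (\<lambda>i \<omega>. \<omega> i) (UNIV :: nat set)"
  proof (subst indep_vars_iff_distr_eq_PiM')
    have "(\<lambda>x. \<lambda>i\<in>UNIV. x i) = (\<lambda>x :: nat \<Rightarrow> real. x)" by (simp add: restrict_def)
    moreover have "sets P = sets (Pi\<^sub>M (UNIV::nat set) (\<lambda>i. borel :: real measure))"
      unfolding P_def by (intro sets_PiM_cong) auto
    ultimately show "distr P (Pi\<^sub>M UNIV (\<lambda>i. borel)) (\<lambda>x. \<lambda>i\<in>UNIV. x i) =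
        Pi\<^sub>M UNIV (\<lambda>i. distr P borel (\<lambda>\<omega>. \<omega> i))"
      by (simp add: comp P_def[symmetric] distr_id2)
  qed auto
  then have "indep_vars (\<lambda>_. borel) (\<lambda>i. (\<lambda>x. b ^ i * x) \<circ> (\<lambda>\<omega>. \<omega> i)) (UNIV :: nat set)"
    by (rule indep_vars_compose) auto
  then have "indep_vars (\<lambda>_. borel) (\<lambda>i \<omega>. b ^ i * \<omega> i) (UNIV :: nat set)"
    unfolding comp_def .
  then have indep: "indep_vars (\<lambda>_. borel) (\<lambda>i \<omega>. b ^ i * \<omega> i) {..<n}" for n :: nat
    by (rule indep_vars_subset) simp
  have ch_i: "char (distr P borel (\<lambda>\<omega>. b ^ i * \<omega> i)) z = char D (b ^ i * z)" for i z
  proof -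
    have "char D (b ^ i * z) = char (distr P borel (\<lambda>\<omega>. \<omega> i)) (b ^ i * z)"
      by (simp only: comp)
    then show ?thesis by (simp add: char_def integral_distr mult_ac)
  qed
  define S where "S n \<omega> = (\<Sum>i<n. b ^ i * \<omega> i)" for n :: nat and \<omega> :: "nat \<Rightarrow> real"
  have [measurable]: "S n \<in> borel_measurable P" for n unfolding S_def by measurable
  have chS: "char (distr P borel (S n)) z = (\<Prod>i<n. char D (b ^ i * z))" for n z
    unfolding S_def by (subst char_distr_sum[OF indep]) (simp add: ch_i)
  define m where "m = (\<integral>\<^sup>+x. ennreal (norm x) \<partial>D)"
  have m: "m < \<infinity>" using int unfolding m_def by (simp add: integrable_iff_bounded)
  \<comment> \<open>Tonelli: the expected sum of absolute values is E|X| / (1-b), finite, so the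
    series converges absolutely almost surely.\<close>
  have "(\<integral>\<^sup>+\<omega>. (\<Sum>i. ennreal (norm (b ^ i * \<omega> i))) \<partial>P) = (\<Sum>i. \<integral>\<^sup>+\<omega>. ennreal (norm (b ^ i * \<omega> i)) \<partial>P)"
    by (rule nn_integral_suminf) auto
  also have "\<dots> = (\<Sum>i. ennreal (b ^ i) * m)"
  proof (rule suminf_cong)
    fix i
    have "m = (\<integral>\<^sup>+\<omega>. ennreal (norm (\<omega> i)) \<partial>P)"
      unfolding m_def by (subst comp[of i, symmetric], subst nn_integral_distr) auto
    then show "(\<integral>\<^sup>+\<omega>. ennreal (norm (b ^ i * \<omega> i)) \<partial>P) = ennreal (b ^ i) * m"
      using b by (simp add: abs_mult ennreal_mult nn_integral_cmult)
  qed
  also have "\<dots> = (\<Sum>i. ennreal (b ^ i)) * m" by simp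
  also have "(\<Sum>i. ennreal (b ^ i)) = ennreal (\<Sum>i. b ^ i)"
    using b by (intro suminf_ennreal2) (auto intro: summable_geometric)
  also have "ennreal (\<Sum>i. b ^ i) * m < \<infinity>" using m by (simp add: ennreal_mult_less_top)
  finally have "AE \<omega> in P. (\<Sum>i. ennreal (norm (b ^ i * \<omega> i))) \<noteq> \<infinity>"
    by (intro nn_integral_PInf_AE) auto
  then have conv: "AE \<omega> in P. (\<lambda>n. S n \<omega>) \<longlonglongrightarrow> (\<Sum>i. b ^ i * \<omega> i)"
  proof eventually_elim
    case (elim \<omega>)
    then have "summable (\<lambda>i. norm (b ^ i * \<omega> i))"
      by (intro summable_suminf_not_top) auto
    then show ?case
      unfolding S_def by (rule summable_LIMSEQ[OF summable_norm_cancel])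
  qed
  have [measurable]: "(\<lambda>\<omega>. \<Sum>i. b ^ i * \<omega> i) \<in> borel_measurable P" by measurable
  show thesis
  proof
    show "real_distribution (distr P borel (\<lambda>\<omega>. \<Sum>i. b ^ i * \<omega> i))"
      by (intro real_distribution_distr prob_space_axioms) auto
    fix z
    have "(\<lambda>n. CLINT \<omega>|P. iexp (z * S n \<omega>)) \<longlonglongrightarrow> (CLINT \<omega>|P. iexp (z * (\<Sum>i. b ^ i * \<omega> i)))"
    proof (rule integral_dominated_convergence[where w = "\<lambda>_. 1"])
      show "AE \<omega> in P. (\<lambda>n. iexp (z * S n \<omega>)) \<longlonglongrightarrow> iexp (z * (\<Sum>i. b ^ i * \<omega> i))"
        using conv by eventually_elim (auto intro!: tendsto_intros)
    qed auto
    then show "(\<lambda>n. \<Prod>i<n. char D (b ^ i * z)) \<longlonglongrightarrow> char (distr P borel (\<lambda>\<omega>. \<Sum>i. b ^ i * \<omega> i)) z"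
      unfolding chS[symmetric] by (simp add: char_def integral_distr)
  qed
qed

text \<open>The n-th root has the characteristic function obtained by taking n-th roots of the factors
  of the infinite product for \<open>\<sigma>\<close>.\<close>

lemma ID_of_scaling_equation:
  fixes a b q :: real
  assumes \<sigma>: "real_distribution \<sigma>" and b: "0 \<le> b" "b < 1" and q: "0 \<le> q" "q < 1" and a: "a \<ge> 0"
    and eq: "\<And>z. (1 - of_real q * iexp z) * char \<sigma> z = of_real (1 - q) * iexp (a * z) * char \<sigma> (b * z)"
  shows "\<sigma> \<in> ID"
proof (rule ID_I[OF \<sigma>])
  interpret \<sigma>: real_distribution \<sigma> by fact
  fix j :: nat assume j: "j \<ge> 1"
  define s where "s = 1 / real j"
  have s: "0 < s" "s \<le> 1" and sj: "of_nat j * complex_of_real s = 1" using j by (auto simp: s_def)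
  obtain D where D: "real_distribution D" "AE x in D. x \<ge> 0" "integrable D (\<lambda>x. x)"
    and chD: "\<And>z. char D z = (of_real (1 - q)) powr of_real s * (1 - of_real q * iexp z) powr (- of_real s)"
    using neg_binomial_law[OF q s] by metis
  \<comment> \<open>The shift distributes the drift factor e^(iaz) evenly over the j roots, as s =
    1/j.\<close>
  define D' where "D' = distr D borel (\<lambda>x. x + a * s)"
  interpret D: real_distribution D by fact
  have D': "real_distribution D'" "AE x in D'. x \<ge> 0" "integrable D' (\<lambda>x. x)"
  proof -
    show "real_distribution D'"
      unfolding D'_def by (intro real_distribution_distr D.prob_space_axioms) simp
    have "a * s \<ge> 0" using a s by simp
    then show "AE x in D'. x \<ge> 0"
      unfolding D'_def using D(2) by (subst AE_distr_iff) (auto elim!: eventually_mono)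
    show "integrable D' (\<lambda>x. x)"
    proof -
      have "integrable D (\<lambda>x. x + a * s)"
        by (rule Bochner_Integration.integrable_add[OF D(3) D.integrable_const])
      then show ?thesis unfolding D'_def by (simp add: integrable_distr_eq)
    qed
  qed
  have chD': "char D' z = iexp (a * s * z) * char D z" for z
  proof -
    have "char D' z = (CLINT x|D. iexp (a * s * z) * iexp (z * x))"
      unfolding D'_def char_def by (subst integral_distr) (auto simp: algebra_simps exp_add)
    then show ?thesis by (simp add: char_def)
  qed
  have nz: "1 - of_real q * iexp z \<noteq> 0" for z
  proof
    assume "1 - of_real q * iexp z = 0"
    then have "norm (of_real q * iexp z) = norm (1::complex)" by (metis eq_iff_diff_eq_0)
    then show False using q by (simp add: norm_mult)
  qed
  have root: "char D' z ^ j = of_real (1 - q) * iexp (a * z) / (1 - of_real q * iexp z)" for z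
  proof -
    \<comment> \<open>No branch problem arises: a principal power is exp (t Ln w), and its j-th
      power merely multiplies the exponent by j.\<close>
    have pw: "(w powr t) ^ j = w powr (of_nat j * t)" if "w \<noteq> 0" for w t :: complex
      using that by (simp add: powr_def exp_of_nat_mult[symmetric] mult_ac)
    have "char D' z ^ j = iexp (a * s * z) ^ j * ((of_real (1 - q)) powr of_real s) ^ j *
        ((1 - of_real q * iexp z) powr (- of_real s)) ^ j"
      by (simp add: chD' chD power_mult_distrib)
    also have "iexp (a * s * z) ^ j = iexp (a * z)"
      using j by (simp add: exp_of_nat_mult[symmetric] s_def)
    also have "((of_real (1 - q)) powr of_real s) ^ j = complex_of_real (1 - q)"
      using q by (subst pw) (auto simp: sj)
    also have "((1 - of_real q * iexp z) powr (- of_real s)) ^ j = inverse (1 - of_real q * iexp z)"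
      using nz[of z] by (subst pw) (auto simp: sj powr_minus)
    finally show ?thesis by (simp add: field_simps)
  qed
  obtain \<tau> where \<tau>: "real_distribution \<tau>"
    and lim: "\<And>z. (\<lambda>n. \<Prod>i<n. char D' (b ^ i * z)) \<longlonglongrightarrow> char \<tau> z"
    using scaled_series_law[OF D' b] by metis
  have "char \<tau> z ^ j = char \<sigma> z" for z
  proof -
    have step: "char \<sigma> z = char D' z ^ j * char \<sigma> (b * z)" for z
      using eq[of z] nz[of z] unfolding root by (simp add: field_simps)
    have prod: "char \<sigma> z = (\<Prod>i<n. char D' (b ^ i * z) ^ j) * char \<sigma> (b ^ n * z)" for n
    proof (induction n)
      case (Suc n)
      then show ?case using step[of "b ^ n * z"] by (simp add: mult.assoc)
    qed simp
    \<comment> \<open>The remainder of the iterated product is the characteristic function at b^n z,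
      which tends to 1 by continuity at 0.\<close>
    have "(\<lambda>n. b ^ n * z) \<longlonglongrightarrow> 0 * z"
      using b by (intro tendsto_intros LIMSEQ_realpow_zero) auto
    then have "(\<lambda>n. b ^ n * z) \<longlonglongrightarrow> 0" by simp
    then have "(\<lambda>n. char \<sigma> (b ^ n * z)) \<longlonglongrightarrow> char \<sigma> 0"
      using \<sigma>.isCont_char isCont_tendsto_compose by blast
    then have "(\<lambda>n. (\<Prod>i<n. char D' (b ^ i * z)) ^ j * char \<sigma> (b ^ n * z)) \<longlonglongrightarrow> char \<tau> z ^ j * 1"
      by (intro tendsto_intros lim) (simp add: \<sigma>.char_zero)
    then have "(\<lambda>n. char \<sigma> z) \<longlonglongrightarrow> char \<tau> z ^ j"
      by (simp add: prod_power_distrib prod[symmetric])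
    then show ?thesis by (simp add: LIMSEQ_const_iff)
  qed
  with \<tau> show "\<exists>\<tau>. real_distribution \<tau> \<and> (\<forall>z. char \<tau> z ^ j = char \<sigma> z)" by blast
qed

section \<open>Quasi-Levy measures with countably many atoms\<close>

abbreviation csummable :: "('i \<Rightarrow> 'b::{banach,second_countable_topology}) \<Rightarrow> 'i set \<Rightarrow> bool" where
  "csummable \<equiv> Infinite_Set_Sum.abs_summable_on"

lemma norm_iexp_diff_le: "norm (iexp x - iexp y) \<le> \<bar>x - y\<bar>"
proof -
  have "iexp x - iexp y = iexp y * (iexp (x - y) - 1)"
    by (simp add: algebra_simps flip: exp_add)
  then show ?thesis
    using iexp_approx1[of "x - y" 0] by (simp add: norm_mult)
qed

lemma norm_iexp_minus_one_le: "norm (iexp x - 1) \<le> \<bar>x\<bar>"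
  using norm_iexp_diff_le[of x 0] by simp

text \<open>All subsets are measurable for a counting measure, so the weighted counting measure is
  pushed forward to the Borel sets. Negative weights are cut off at 0 by
  \<open>ennreal\<close>.\<close>

definition atomic_measure :: "real set \<Rightarrow> (real \<Rightarrow> real) \<Rightarrow> real measure" where
  "atomic_measure X f = distr (density (count_space X) (\<lambda>y. ennreal (f y))) borel (\<lambda>y. y)"

lemma sets_atomic_measure [simp, measurable_cong]: "sets (atomic_measure X f) = sets borel"
  and space_atomic_measure [simp]: "space (atomic_measure X f) = UNIV"
  by (simp_all add: atomic_measure_def)

lemma nn_integral_atomic_measure:
  assumes [measurable]: "g \<in> borel_measurable borel"
  shows "(\<integral>\<^sup>+x. g x \<partial>atomic_measure X f) = (\<integral>\<^sup>+y. ennreal (f y) * g y \<partial>count_space X)"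
  unfolding atomic_measure_def by (subst nn_integral_distr) (auto simp: nn_integral_density)

lemma emeasure_atomic_measure_eq_0:
  assumes "A \<in> sets borel" and "\<And>y. y \<in> X \<Longrightarrow> y \<in> A \<Longrightarrow> f y \<le> 0"
  shows "emeasure (atomic_measure X f) A = 0"
proof -
  have "emeasure (atomic_measure X f) A = (\<integral>\<^sup>+x. indicator A x \<partial>atomic_measure X f)"
    using assms(1) by simp
  also have "\<dots> = (\<integral>\<^sup>+y. ennreal (f y) * indicator A y \<partial>count_space X)"
    using assms(1) by (intro nn_integral_atomic_measure) simp
  also have "\<dots> = (\<integral>\<^sup>+y. 0 \<partial>count_space X)"
    using assms(2) by (intro nn_integral_cong) (auto simp: indicator_def ennreal_neg)
  finally show ?thesis by simp
qed

lemma integral_atomic_measure: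
  fixes g :: "real \<Rightarrow> complex"
  assumes [measurable]: "g \<in> borel_measurable borel" and "\<And>y. f y \<ge> 0"
  shows "(CLINT x|atomic_measure X f. g x) = infsetsum (\<lambda>y. of_real (f y) * g y) X"
proof -
  have "(CLINT x|atomic_measure X f. g x) = (CLINT y|density (count_space X) (\<lambda>y. ennreal (f y)). g y)"
    unfolding atomic_measure_def by (subst integral_distr) auto
  also have "\<dots> = (CLINT y|count_space X. f y *\<^sub>R g y)"
    using assms(2) by (subst integral_density) auto
  finally show ?thesis by (simp add: infsetsum_def scaleR_conv_of_real)
qed

text \<open>Fubini for sums over the fibres of \<open>x\<close>. The fibre over 0 is dropped, as
  Levy measures have no mass there, and \<open>k 0 = 0\<close> makes this harmless.\<close>

lemma infsetsum_group_by_value: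
  fixes w x :: "'i::countable \<Rightarrow> real" and k :: "real \<Rightarrow> complex"
  defines "X \<equiv> range x - {0}" and "W \<equiv> \<lambda>y. infsetsum w {i. x i = y}"
  assumes summable: "csummable (\<lambda>i. of_real (w i) * k (x i)) UNIV" and k0: "k 0 = 0"
  shows "csummable (\<lambda>y. of_real (W y) * k y) X" (is ?A)
    and "infsetsum (\<lambda>y. of_real (W y) * k y) X = infsetsum (\<lambda>i. of_real (w i) * k (x i)) UNIV" (is ?B)
proof -
  define F where "F i = of_real (w i) * k (x i)" for i
  have X: "countable X" unfolding X_def by simp
  have C: "countable {i. x i = y}" for y by simp
  have bij: "bij_betw snd (SIGMA y:X. {i. x i = y}) {i. x i \<noteq> 0}"
    by (rule bij_betwI[of _ _ _ "\<lambda>i. (x i, i)"]) (auto simp: X_def)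
  have "csummable F {i. x i \<noteq> 0}"
    using summable abs_summable_on_subset unfolding F_def by blast
  then have sumS: "csummable (\<lambda>z. F (snd z)) (SIGMA y:X. {i. x i = y})"
    by (subst abs_summable_on_reindex_bij_betw[OF bij])
  then have fib: "\<And>y. y \<in> X \<Longrightarrow> csummable F {i. x i = y}"
    and dom: "csummable (\<lambda>y. infsetsum (\<lambda>i. norm (F i)) {i. x i = y}) X"
    using abs_summable_on_Sigma_iff[OF X C, of "\<lambda>z. F (snd z)"] by auto
  have WF: "of_real (W y) * k y = infsetsum F {i. x i = y}" if "y \<in> X" for y
  \<comment> \<open>Where the kernel vanishes, the weights over y need not be summable and
    \<open>W y\<close> may be a default value; the factor \<open>k y\<close> removes it from the
    sum.\<close>
  proof (cases "k y = 0")
    case True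
    then have "infsetsum F {i. x i = y} = 0"
      by (intro infsetsum_all_0) (auto simp: F_def)
    with True show ?thesis by simp
  next
    case False
    have "csummable (\<lambda>i. F i * inverse (k y)) {i. x i = y}"
      using fib[OF that] by (rule abs_summable_on_cmult_left)
    then have "csummable (\<lambda>i. complex_of_real (w i)) {i. x i = y}"
      by (rule abs_summable_on_cong[THEN iffD1, rotated -1]) (use False in \<open>auto simp: F_def\<close>)
    then have "of_real (W y) * k y = infsetsum (\<lambda>i. of_real (w i) * k y) {i. x i = y}"
      by (simp add: W_def infsetsum_cmult_left infsetsum_of_real)
    also have "\<dots> = infsetsum F {i. x i = y}" by (intro infsetsum_cong) (auto simp: F_def)
    finally show ?thesis .
  qed
  show ?A
    using dom by (rule abs_summable_on_comparison_test)
      (auto simp: WF intro!: order.trans[OF norm_infsetsum_bound])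
  have "infsetsum (\<lambda>y. of_real (W y) * k y) X = infsetsum (\<lambda>y. infsetsum (\<lambda>i. F i) {i. x i = y}) X"
    by (intro infsetsum_cong) (auto simp: WF)
  also have "\<dots> = infsetsum (\<lambda>z. F (snd z)) (SIGMA y:X. {i. x i = y})"
    by (subst infsetsum_Sigma[OF X C sumS]) simp
  also have "\<dots> = infsetsum F {i. x i \<noteq> 0}"
    by (rule infsetsum_reindex_bij_betw[OF bij])
  also have "\<dots> = infsetsum F UNIV"
    by (rule infsetsum_cong_neutral) (auto simp: F_def k0)
  finally show ?B unfolding F_def .
qed

text \<open>The linear bound is enough because all atomic measures below have an absolutely summable
  first moment.\<close>

lemma norm_levy_khintchine_kernel_le: "norm (levy_khintchine_kernel z x) \<le> 2 * \<bar>z\<bar> * \<bar>x\<bar>"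
proof -
  have "norm (levy_khintchine_kernel z x) \<le> norm (iexp (z * x) - 1) + norm (\<i> * z * x * indicator {-1..1} x)"
    unfolding levy_khintchine_kernel_def by (rule norm_triangle_ineq4)
  also have "norm (\<i> * z * x * indicator {-1..1} x) \<le> \<bar>z\<bar> * \<bar>x\<bar>"
    by (auto simp: norm_mult indicator_def)
  also have "norm (iexp (z * x) - 1) \<le> \<bar>z\<bar> * \<bar>x\<bar>"
    using norm_iexp_minus_one_le[of "z * x"] by (simp add: abs_mult)
  finally show ?thesis by (simp add: mult_ac)
qed

text \<open>Atoms of opposite sign may sit at the same point, so the Jordan decomposition is obtained by
  first collecting the total weight of every point.\<close>

lemma quasi_levy_measure_of_atoms:
  fixes w x :: "'i::countable \<Rightarrow> real" and \<gamma> :: real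
  assumes summable: "csummable (\<lambda>i. w i * x i) UNIV"
    and char: "\<And>z. char \<sigma> z = exp (\<i> * \<gamma> * z + infsetsum (\<lambda>i. of_real (w i) * (iexp (z * x i) - 1)) UNIV)"
  obtains \<nu>p \<nu>m where "quasi_levy_measure \<sigma> \<nu>p \<nu>m"
    "(\<And>i. x i \<ge> 0) \<Longrightarrow> emeasure \<nu>p {..0} = 0 \<and> emeasure \<nu>m {..0} = 0"
proof -
  define X where "X = range x - {0}"
  define W where "W y = infsetsum w {i. x i = y}" for y
  define fp where "fp y = max (W y) 0" for y
  define fm where "fm y = max (- W y) 0" for y
  have X: "countable X" unfolding X_def by simp
  \<comment> \<open>Every kernel used below is bounded by a multiple of |y|, so the single
    summability hypothesis on w i * x i covers all of them.\<close>
  have dominated: "csummable (\<lambda>i. of_real (w i) * k (x i)) UNIV"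
    if "\<And>y. norm (k y) \<le> C * \<bar>y\<bar>" for k :: "real \<Rightarrow> complex" and C
  proof (rule abs_summable_on_comparison_test)
    show "csummable (\<lambda>i. C * (w i * x i)) UNIV" using summable by (intro abs_summable_on_cmult_right)
    fix i
    have "0 \<le> C" using order.trans[OF norm_ge_zero that[of 1]] by simp
    moreover have "norm (of_real (w i) * k (x i)) \<le> \<bar>w i\<bar> * (C * \<bar>x i\<bar>)"
      unfolding norm_mult using that[of "x i"] by (intro mult_mono) auto
    ultimately show "norm (of_real (w i) * k (x i)) \<le> norm (C * (w i * x i))"
      by (simp add: abs_mult mult_ac)
  qed
  have k0: "k 0 = 0" if "\<And>y. norm (k y) \<le> C * \<bar>y\<bar>" for k :: "real \<Rightarrow> complex" and C
    using that[of 0] by simp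
  have group: "csummable (\<lambda>y. of_real (W y) * k y) X"
      "infsetsum (\<lambda>y. of_real (W y) * k y) X = infsetsum (\<lambda>i. of_real (w i) * k (x i)) UNIV"
    if "\<And>y. norm (k y) \<le> C * \<bar>y\<bar>" for k :: "real \<Rightarrow> complex" and C
    unfolding W_def X_def using infsetsum_group_by_value[OF dominated[OF that] k0[OF that]] by auto
  have first: "csummable (\<lambda>y. W y * y) X"
  proof -
    have "csummable (\<lambda>y. of_real (W y) * complex_of_real y) X"
      by (rule group(1)[of _ 1]) simp
    then show ?thesis by (simp flip: of_real_mult)
  qed
  have levy: "levy_integrable (atomic_measure X f)" if f: "\<And>y. \<bar>f y\<bar> \<le> \<bar>W y\<bar>" for f
    unfolding levy_integrable_def
  proof (intro conjI)
    show "emeasure (atomic_measure X f) {0} = 0"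
      by (rule emeasure_atomic_measure_eq_0) (auto simp: X_def)
    have "(\<integral>\<^sup>+x. ennreal (min (x\<^sup>2) 1) \<partial>atomic_measure X f) = (\<integral>\<^sup>+y. ennreal (f y) * ennreal (min (y\<^sup>2) 1) \<partial>count_space X)"
      by (rule nn_integral_atomic_measure) simp
    also have "\<dots> \<le> (\<integral>\<^sup>+y. ennreal (norm (W y * y)) \<partial>count_space X)"
    proof (rule nn_integral_mono)
      fix y :: real
      have "min (y\<^sup>2) 1 \<le> \<bar>y\<bar>"
      proof (cases "\<bar>y\<bar> \<le> 1")
        case True
        then have "\<bar>y\<bar> * \<bar>y\<bar> \<le> \<bar>y\<bar> * 1" by (rule mult_left_mono) simp
        then show ?thesis by (simp add: power2_eq_square min.coboundedI1)
      qed (simp add: min.coboundedI2)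
      then have "\<bar>f y\<bar> * min (y\<^sup>2) 1 \<le> \<bar>W y\<bar> * \<bar>y\<bar>"
        using f by (intro mult_mono) auto
      then have "ennreal (\<bar>f y\<bar> * min (y\<^sup>2) 1) \<le> ennreal (norm (W y * y))"
        by (intro ennreal_leI) (simp add: abs_mult)
      moreover have "ennreal (f y) * ennreal (min (y\<^sup>2) 1) \<le> ennreal (\<bar>f y\<bar> * min (y\<^sup>2) 1)"
        by (subst ennreal_mult) (auto intro!: mult_right_mono ennreal_leI)
      ultimately show "ennreal (f y) * ennreal (min (y\<^sup>2) 1) \<le> ennreal (norm (W y * y))"
        by (rule order.trans[rotated])
    qed
    also have "\<dots> < \<infinity>"
      using first unfolding Infinite_Set_Sum.abs_summable_on_def integrable_iff_bounded by simp
    finally show "(\<integral>\<^sup>+x. ennreal (min (x\<^sup>2) 1) \<partial>atomic_measure X f) < \<infinity>" .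
  qed simp
  define \<nu>p where "\<nu>p = atomic_measure X fp"
  define \<nu>m where "\<nu>m = atomic_measure X fm"
  have sing: "mutually_singular \<nu>p \<nu>m"
    unfolding mutually_singular_def
  proof (intro bexI conjI)
    \<comment> \<open>The sign of the collected weight separates the two parts, a Hahn
      decomposition.\<close>
    let ?A = "{y \<in> X. W y \<le> 0}"
    have "countable ?A" using X by (rule countable_subset[rotated]) auto
    then have A: "?A \<in> sets borel" by (rule sets.countable[rotated]) simp
    then show "?A \<in> sets \<nu>p" unfolding \<nu>p_def by simp
    show "emeasure \<nu>p ?A = 0"
      unfolding \<nu>p_def using A by (rule emeasure_atomic_measure_eq_0) (simp add: fp_def)
    show "emeasure \<nu>m (space \<nu>m - ?A) = 0"
      unfolding \<nu>m_def space_atomic_measure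
      by (rule emeasure_atomic_measure_eq_0[OF borel_comp[OF A, unfolded Compl_eq_Diff_UNIV]])
        (auto simp: fm_def)
  qed
  \<comment> \<open>The Levy-Khintchine kernel contains a compensator on [-1,1] that the hypothesis
    does not have. Its total contribution is the finite number \<open>\<kappa>\<close>, which is
    moved into the drift; the Gaussian coefficient is 0.\<close>
  define \<kappa> where "\<kappa> = infsetsum (\<lambda>i. w i * (x i * indicator {-1..1} (x i))) UNIV"
  define g a where "g = \<gamma> + \<kappa>" and "a = (0::real)"
  have trip: "char \<sigma> z = exp (\<i> * g * z - a * z\<^sup>2
            + ((CLINT x|\<nu>p. levy_khintchine_kernel z x) - (CLINT x|\<nu>m. levy_khintchine_kernel z x)))" for z
  proof -
    let ?k = "levy_khintchine_kernel z"
    have [measurable]: "?k \<in> borel_measurable borel" unfolding levy_khintchine_kernel_def by measurable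
    have k: "norm (?k y) \<le> (2 * \<bar>z\<bar>) * \<bar>y\<bar>" for y by (rule norm_levy_khintchine_kernel_le)
    have s: "csummable (\<lambda>y. of_real (f y) * ?k y) X" if "\<And>y. \<bar>f y\<bar> \<le> \<bar>W y\<bar>" for f
      by (rule abs_summable_on_comparison_test[OF group(1)[OF k]])
         (auto simp: norm_mult that intro!: mult_right_mono)
    have "(CLINT x|\<nu>p. ?k x) - (CLINT x|\<nu>m. ?k x) =
        infsetsum (\<lambda>y. of_real (fp y) * ?k y) X - infsetsum (\<lambda>y. of_real (fm y) * ?k y) X"
      unfolding \<nu>p_def \<nu>m_def by (subst (1 2) integral_atomic_measure) (auto simp: fp_def fm_def)
    also have "\<dots> = infsetsum (\<lambda>y. of_real (fp y) * ?k y - of_real (fm y) * ?k y) X"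
      by (rule infsetsum_diff[symmetric]) (rule s; simp add: fp_def fm_def)+
    also have "\<dots> = infsetsum (\<lambda>y. of_real (W y) * ?k y) X"
      by (intro infsetsum_cong) (auto simp: fp_def fm_def max_def)
    also have "\<dots> = infsetsum (\<lambda>i. of_real (w i) * ?k (x i)) UNIV"
      by (rule group(2)[OF k])
    also have "\<dots> = infsetsum (\<lambda>i. of_real (w i) * (iexp (z * x i) - 1)
        - (\<i> * z) * (of_real (w i) * of_real (x i * indicator {-1..1} (x i)))) UNIV"
      by (intro infsetsum_cong) (auto simp: levy_khintchine_kernel_def algebra_simps indicator_def)
    also have "\<dots> = infsetsum (\<lambda>i. of_real (w i) * (iexp (z * x i) - 1)) UNIV
        - infsetsum (\<lambda>i. (\<i> * z) * (of_real (w i) * of_real (x i * indicator {-1..1} (x i)))) UNIV"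
    proof (rule infsetsum_diff)
      show "csummable (\<lambda>i. of_real (w i) * (iexp (z * x i) - 1)) UNIV"
        by (rule dominated[of _ "\<bar>z\<bar>"]) (metis abs_mult norm_iexp_minus_one_le)
      show "csummable (\<lambda>i. (\<i> * z) * (of_real (w i) * of_real (x i * indicator {-1..1} (x i)))) UNIV"
        by (intro abs_summable_on_cmult_right dominated[of _ 1]) (auto simp: indicator_def)
    qed
    also have "infsetsum (\<lambda>i. (\<i> * z) * (of_real (w i) * of_real (x i * indicator {-1..1} (x i)))) UNIV = (\<i> * z) * of_real \<kappa>"
    proof (subst infsetsum_cmult_right)
      show "csummable (\<lambda>i. complex_of_real (w i) * of_real (x i * indicator {-1..1} (x i))) UNIV"
        by (intro dominated[of _ 1]) (auto simp: indicator_def)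
      show "(\<i> * z) * infsetsum (\<lambda>i. complex_of_real (w i) * of_real (x i * indicator {-1..1} (x i))) UNIV = (\<i> * z) * of_real \<kappa>"
        unfolding \<kappa>_def by (subst infsetsum_of_real[symmetric]) simp
    qed
    finally show ?thesis unfolding char g_def a_def by (simp add: algebra_simps)
  qed
  show thesis
  proof
    show "quasi_levy_measure \<sigma> \<nu>p \<nu>m"
      unfolding quasi_levy_measure_def quasi_levy_triplet_def
    proof (rule exI[of _ g], rule exI[of _ a], intro conjI allI)
      show "levy_integrable \<nu>p" "levy_integrable \<nu>m"
        unfolding \<nu>p_def \<nu>m_def by (rule levy; simp add: fp_def fm_def)+
    qed (rule sing, rule trip)
    show "emeasure \<nu>p {..0} = 0 \<and> emeasure \<nu>m {..0} = 0" if "\<And>i. x i \<ge> 0"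
    proof -
      have "y > 0" if "y \<in> X" for y
        using that \<open>\<And>i. x i \<ge> 0\<close> by (auto simp: X_def less_le)
      then show ?thesis
        unfolding \<nu>p_def \<nu>m_def by (force intro!: emeasure_atomic_measure_eq_0)
    qed
  qed
qed

text \<open>Iteration of the equation replaces every atom at x i by atoms of the same weight at b^n
  x i for all n, and the drift g by g / (1-b). The first moment is multiplied by 1 / (1-b) and stays
  finite. For b = 0 the copies with n >= 1 lie at 0 and contribute nothing.\<close>

lemma quasi_levy_measure_of_scaling_equation:
  fixes w x :: "'i::countable \<Rightarrow> real" and b g :: real
  assumes \<sigma>: "real_distribution \<sigma>" and b: "0 \<le> b" "b < 1"
    and summable: "csummable (\<lambda>i. w i * x i) UNIV"
    and eq: "\<And>z. char \<sigma> z =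
      exp (\<i> * g * z + infsetsum (\<lambda>i. of_real (w i) * (iexp (z * x i) - 1)) UNIV) * char \<sigma> (b * z)"
  obtains \<nu>p \<nu>m where "quasi_levy_measure \<sigma> \<nu>p \<nu>m"
    "(\<And>i. x i \<ge> 0) \<Longrightarrow> emeasure \<nu>p {..0} = 0 \<and> emeasure \<nu>m {..0} = 0"
proof -
  interpret \<sigma>: real_distribution \<sigma> by fact
  define w' where "w' = (\<lambda>(n::nat, i::'i). w i)"
  define x' where "x' = (\<lambda>(n, i). b ^ n * x i)"
  define h where "h z i = of_real (w i) * (iexp (z * x i) - 1)" for z i
  define \<Psi> where "\<Psi> z = infsetsum (h z) UNIV" for z
  have h: "norm (h z i) \<le> norm (\<bar>z\<bar> * (w i * x i))" for z i
  proof -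
    have "norm (h z i) \<le> \<bar>w i\<bar> * \<bar>z * x i\<bar>"
      unfolding h_def norm_mult by (intro mult_mono norm_iexp_minus_one_le) auto
    then show ?thesis by (simp add: abs_mult mult_ac)
  qed
  have geo: "csummable (\<lambda>n. b ^ n) UNIV"
    unfolding abs_summable_on_nat_iff' using b by (simp add: summable_geometric power_abs)
  have summable': "csummable (\<lambda>i. w' i * x' i) UNIV"
  proof -
    have "csummable (\<lambda>i. w' i * x' i) (UNIV \<times> UNIV)"
    proof (subst abs_summable_on_Sigma_iff, safe)
      fix n :: nat
      have "csummable (\<lambda>i. b ^ n * (w i * x i)) UNIV"
        using summable by (rule abs_summable_on_cmult_right)
      then show "csummable (\<lambda>i. w' (n, i) * x' (n, i)) UNIV"
        by (simp add: w'_def x'_def mult_ac)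
    next
      have "infsetsum (\<lambda>i. norm (w' (n, i) * x' (n, i))) UNIV = b ^ n * infsetsum (\<lambda>i. norm (w i * x i)) UNIV" for n
      proof -
        have "infsetsum (\<lambda>i. norm (w' (n, i) * x' (n, i))) UNIV = infsetsum (\<lambda>i. b ^ n * norm (w i * x i)) UNIV"
          using b by (intro infsetsum_cong) (auto simp: w'_def x'_def abs_mult)
        also have "\<dots> = b ^ n * infsetsum (\<lambda>i. norm (w i * x i)) UNIV"
          using summable by (intro infsetsum_cmult_right abs_summable_on_normI)
        finally show ?thesis .
      qed
      then show "csummable (\<lambda>n. infsetsum (\<lambda>i. norm (w' (n, i) * x' (n, i))) UNIV) UNIV"
        using abs_summable_on_cmult_left[OF geo, of "infsetsum (\<lambda>i. norm (w i * x i)) UNIV"] by simp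
    qed auto
    then show ?thesis by simp
  qed
  have sums: "(\<lambda>n. \<Psi> (b ^ n * z)) sums infsetsum (\<lambda>i. of_real (w' i) * (iexp (z * x' i) - 1)) UNIV" for z
  proof -
    let ?F = "\<lambda>i. of_real (w' i) * (iexp (z * x' i) - 1)"
    have F: "?F (n, i) = h (b ^ n * z) i" for n i
      by (simp add: w'_def x'_def h_def mult_ac)
    have "csummable ?F (UNIV \<times> UNIV)"
      unfolding UNIV_Times_UNIV
    proof (rule abs_summable_on_comparison_test)
      show "csummable (\<lambda>i. \<bar>z\<bar> * (w' i * x' i)) UNIV"
        using summable' by (rule abs_summable_on_cmult_right)
      fix i :: "nat \<times> 'i"
      have "norm (?F i) \<le> \<bar>w' i\<bar> * \<bar>z * x' i\<bar>"
        unfolding norm_mult by (intro mult_mono norm_iexp_minus_one_le) auto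
      then show "norm (?F i) \<le> norm (\<bar>z\<bar> * (w' i * x' i))" by (simp add: abs_mult mult_ac)
    qed
    then have s: "csummable (\<lambda>n. infsetsum (\<lambda>i. ?F (n, i)) UNIV) UNIV"
      and e: "infsetsum ?F (UNIV \<times> UNIV) = infsetsum (\<lambda>n. infsetsum (\<lambda>i. ?F (n, i)) UNIV) UNIV"
      using abs_summable_on_Sigma_project1'[of "\<lambda>n i. ?F (n, i)" UNIV "\<lambda>_. UNIV"] infsetsum_Times[of UNIV UNIV ?F]
      by simp_all
    show ?thesis
      using sums_infsetsum_nat'[OF s] e unfolding F \<Psi>_def by simp
  qed
  have "char \<sigma> z = exp (\<i> * complex_of_real (g / (1 - b)) * z
      + infsetsum (\<lambda>i. of_real (w' i) * (iexp (z * x' i) - 1)) UNIV)" for z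
  proof -
    have step: "char \<sigma> z = exp (\<i> * g * z + \<Psi> z) * char \<sigma> (b * z)" for z
      using eq[of z] unfolding \<Psi>_def h_def .
    \<comment> \<open>The exponents are added before any limit is taken, so no logarithm of the
      characteristic function has to be chosen.\<close>
    have iter: "char \<sigma> z = exp (\<Sum>n<m. \<i> * g * z * of_real (b ^ n) + \<Psi> (b ^ n * z)) * char \<sigma> (b ^ m * z)" for m
    proof (induction m)
      case (Suc m)
      then show ?case using step[of "b ^ m * z"] by (simp add: exp_add mult_ac)
    qed simp
    have "(\<lambda>n. complex_of_real (b ^ n)) sums of_real (1 / (1 - b))"
      using b by (subst sums_of_real_iff) (auto intro!: geometric_sums)
    then have "(\<lambda>n. \<i> * g * z * of_real (b ^ n) + \<Psi> (b ^ n * z)) sums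
        (\<i> * g * z * of_real (1 / (1 - b)) + infsetsum (\<lambda>i. of_real (w' i) * (iexp (z * x' i) - 1)) UNIV)"
      by (intro sums_add sums sums_mult)
    then have l: "(\<lambda>m. \<Sum>n<m. \<i> * g * z * of_real (b ^ n) + \<Psi> (b ^ n * z)) \<longlonglongrightarrow>
        (\<i> * g * z * of_real (1 / (1 - b)) + infsetsum (\<lambda>i. of_real (w' i) * (iexp (z * x' i) - 1)) UNIV)"
      by (simp only: sums_def)
    have "(\<lambda>n. b ^ n * z) \<longlonglongrightarrow> 0 * z"
      using b by (intro tendsto_intros LIMSEQ_realpow_zero) auto
    then have "(\<lambda>n. b ^ n * z) \<longlonglongrightarrow> 0" by simp
    then have "(\<lambda>n. char \<sigma> (b ^ n * z)) \<longlonglongrightarrow> char \<sigma> 0"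
      using \<sigma>.isCont_char isCont_tendsto_compose by blast
    then have "(\<lambda>n. char \<sigma> (b ^ n * z)) \<longlonglongrightarrow> 1" by (simp add: \<sigma>.char_zero)
    from tendsto_mult[OF tendsto_exp[OF l] this]
    have "(\<lambda>m. char \<sigma> z) \<longlonglongrightarrow> exp (\<i> * g * z * of_real (1 / (1 - b)) + infsetsum (\<lambda>i. of_real (w' i) * (iexp (z * x' i) - 1)) UNIV) * 1"
      unfolding iter[symmetric] .
    then show ?thesis by (simp add: LIMSEQ_const_iff)
  qed
  from quasi_levy_measure_of_atoms[OF summable' this]
  obtain \<nu>p \<nu>m where n: "quasi_levy_measure \<sigma> \<nu>p \<nu>m"
    "(\<And>i. x' i \<ge> 0) \<Longrightarrow> emeasure \<nu>p {..0} = 0 \<and> emeasure \<nu>m {..0} = 0"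
    by metis
  show thesis
  proof (rule that[OF n(1)])
    assume "\<And>i. x i \<ge> 0"
    then show "emeasure \<nu>p {..0} = 0 \<and> emeasure \<nu>m {..0} = 0"
      using b by (intro n(2)) (auto simp: x'_def)
  qed
qed

section \<open>Quasi-Levy measures from logarithmic series\<close>

text \<open>For 0 <= s < 1 this is the Levy-Khintchine form of a geometric law scaled by x, with
  Levy mass s^m / m at x m. Negative s is allowed and gives weights of alternating sign. Subtracting
  the series at u = 1 from that at u = e^(ixz) produces the increments e^(izxm) - 1.\<close>

lemma infsetsum_log_series:
  fixes s x z :: real
  assumes "\<bar>s\<bar> < 1"
  shows "csummable (\<lambda>m::nat. s ^ m / m * (x * m)) UNIV" (is ?A)
    and "csummable (\<lambda>m::nat. of_real (s ^ m / m) * (iexp (z * (x * m)) - 1)) UNIV" (is ?B)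
    and "exp (infsetsum (\<lambda>m::nat. of_real (s ^ m / m) * (iexp (z * (x * m)) - 1)) UNIV) =
      of_real (1 - s) / (1 - of_real s * iexp (x * z))" (is ?C)
proof -
  have geo: "csummable (\<lambda>m. s ^ m) UNIV"
    unfolding abs_summable_on_nat_iff' using assms by (simp add: summable_geometric power_abs)
  show A: ?A
    by (rule abs_summable_on_comparison_test[OF abs_summable_on_cmult_right[OF geo, of x]])
      (auto simp: abs_mult)
  show B: ?B
  proof (rule abs_summable_on_comparison_test[OF abs_summable_on_cmult_right[OF A, of "\<bar>z\<bar>"]])
    fix m :: nat
    have "norm (of_real (s ^ m / m) * (iexp (z * (x * m)) - 1)) \<le> \<bar>s ^ m / m\<bar> * \<bar>z * (x * m)\<bar>"
      unfolding norm_mult by (intro mult_mono norm_iexp_minus_one_le) (auto simp: norm_divide norm_power power_abs)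
    also have "\<dots> = norm (\<bar>z\<bar> * (s ^ m / m * (x * m)))"
      by (simp add: abs_mult mult_ac)
    finally show "norm (of_real (s ^ m / m) * (iexp (z * (x * m)) - 1)) \<le> norm (\<bar>z\<bar> * (s ^ m / m * (x * m)))" .
  qed
  \<comment> \<open>The sums start at m = 0; that term is 0, since division by zero yields
    0.\<close>
  have Ln: "(\<lambda>m. of_real (s ^ m / m) * u ^ m) sums (- Ln (1 - of_real s * u))"
    if "norm u = 1" for u :: complex
  proof -
    have "norm (- (of_real s * u)) < 1" using that assms by (simp add: norm_mult)
    from sums_minus[OF Ln_series[OF this]]
    have "(\<lambda>m. - ((-1) ^ Suc m / of_nat m * (- (of_real s * u)) ^ m)) sums (- Ln (1 - of_real s * u))"
      by simp
    moreover have "- ((-1) ^ Suc m / of_nat m * (- (of_real s * u)) ^ m) = of_real (s ^ m / m) * u ^ m" for m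
    proof -
      have "(- (complex_of_real s * u)) ^ m = (-1) ^ m * (of_real s * u) ^ m"
        by (rule power_minus)
      moreover have "(-1::complex) ^ m * (-1) ^ m = 1" by (simp flip: power_mult_distrib)
      ultimately show ?thesis by (simp add: power_mult_distrib field_simps)
    qed
    ultimately show ?thesis by (simp only:)
  qed
  let ?u = "iexp (x * z)"
  have pw: "?u ^ m = iexp (z * (x * m))" for m :: nat
    by (simp add: exp_of_nat_mult[symmetric] mult_ac)
  have nz: "1 - of_real s * u \<noteq> 0" if "norm u = 1" for u :: complex
  proof
    assume "1 - of_real s * u = 0"
    then have "norm (of_real s * u) = norm (1::complex)" by (metis eq_iff_diff_eq_0)
    then show False using that assms by (simp add: norm_mult)
  qed
  have "(\<lambda>m. of_real (s ^ m / m) * ?u ^ m - of_real (s ^ m / m) * 1 ^ m) sums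
      (- Ln (1 - of_real s * ?u) - - Ln (1 - of_real s * 1))"
    by (intro sums_diff Ln) auto
  then have "(\<lambda>m. of_real (s ^ m / m) * (iexp (z * (x * m)) - 1)) sums
      (- Ln (1 - of_real s * ?u) - - Ln (1 - of_real s * 1))"
    unfolding pw by (simp add: algebra_simps)
  then have "infsetsum (\<lambda>m. of_real (s ^ m / m) * (iexp (z * (x * m)) - 1)) UNIV =
      Ln (1 - of_real s) - Ln (1 - of_real s * ?u)"
    using sums_infsetsum_nat'[OF B] sums_unique2 by force
  then show ?C
    using nz[of ?u] nz[of 1] by (simp add: exp_diff)
qed

text \<open>The Boolean index joins two families of atoms: \<open>True\<close> carries those of the
  denominator 1 - q e^(iz), \<open>False\<close> the negated ones of the numerator, read as 1 - (-s)
  e^(iaz). The sign of \<open>a\<close> is left open, because the case p < r uses it with a negative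
  value.\<close>

lemma quasi_levy_measure_of_two_log_series:
  fixes a b g q s :: real
  assumes \<sigma>: "real_distribution \<sigma>" and b: "0 \<le> b" "b < 1" and q: "\<bar>q\<bar> < 1" and s: "\<bar>s\<bar> < 1"
    and eq: "\<And>z. char \<sigma> z = iexp (g * z) *
      (of_real (1 - q) / (1 - of_real q * iexp z) * ((1 + of_real s * iexp (a * z)) / of_real (1 + s))) * char \<sigma> (b * z)"
  obtains \<nu>p \<nu>m where "quasi_levy_measure \<sigma> \<nu>p \<nu>m"
    "a \<ge> 0 \<Longrightarrow> emeasure \<nu>p {..0} = 0 \<and> emeasure \<nu>m {..0} = 0"
proof -
  define w where "w = (\<lambda>(c, m::nat). if c then q ^ m / m else - ((- s) ^ m / m))"
  define x where "x = (\<lambda>(c, m::nat). if c then 1 * real m else a * real m)"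
  have s': "\<bar>- s\<bar> < 1" using s by simp
  have split: "csummable f (UNIV :: (bool \<times> nat) set) \<longleftrightarrow> csummable (\<lambda>m. f (True, m)) UNIV \<and> csummable (\<lambda>m. f (False, m)) UNIV"
    for f :: "bool \<times> nat \<Rightarrow> 'b::{banach,second_countable_topology}"
    using abs_summable_on_Sigma_iff[of "UNIV :: bool set" "\<lambda>_. UNIV :: nat set" f, unfolded UNIV_Times_UNIV]
    by (auto simp: all_bool_eq)
  have summable: "csummable (\<lambda>i. w i * x i) UNIV"
    unfolding split using infsetsum_log_series(1)[OF q, of 1] abs_summable_on_uminus[OF infsetsum_log_series(1)[OF s', of a]]
    by (simp add: w_def x_def)
  have eq': "char \<sigma> z = exp (\<i> * g * z + infsetsum (\<lambda>i. of_real (w i) * (iexp (z * x i) - 1)) UNIV) * char \<sigma> (b * z)" for z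
  proof -
    let ?F = "\<lambda>i. of_real (w i) * (iexp (z * x i) - 1)"
    let ?f = "\<lambda>(q::real) (x::real) (m::nat). complex_of_real (q ^ m / real m) * (iexp (z * (x * m)) - 1)"
    have F: "?F (True, m) = ?f q 1 m" "?F (False, m) = - ?f (- s) a m" for m
      unfolding w_def x_def prod.case if_True if_False by (simp_all del: of_real_mult of_real_divide of_real_power)
    have "csummable ?F UNIV"
      unfolding split F
      by (intro conjI abs_summable_on_uminus infsetsum_log_series(2) q s')
    then have "infsetsum ?F UNIV = infsetsum (\<lambda>m. ?F (True, m)) UNIV + infsetsum (\<lambda>m. ?F (False, m)) UNIV"
      using infsetsum_Times[of "UNIV :: bool set" "UNIV :: nat set" ?F, unfolded UNIV_Times_UNIV] by (simp add: UNIV_bool add.commute)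
    then have "infsetsum ?F UNIV = infsetsum (?f q 1) UNIV - infsetsum (?f (- s) a) UNIV"
      unfolding F infsetsum_uminus by simp
    then have "exp (infsetsum ?F UNIV) = (of_real (1 - q) / (1 - of_real q * iexp (1 * z))) / (of_real (1 - - s) / (1 - of_real (- s) * iexp (a * z)))"
      by (simp only: exp_diff infsetsum_log_series(3)[OF q] infsetsum_log_series(3)[OF s'])
    then show ?thesis unfolding eq[of z] by (simp add: exp_add mult_ac)
  qed
  from quasi_levy_measure_of_scaling_equation[OF \<sigma> b summable eq']
  obtain \<nu>p \<nu>m where n: "quasi_levy_measure \<sigma> \<nu>p \<nu>m"
    "(\<And>i. x i \<ge> 0) \<Longrightarrow> emeasure \<nu>p {..0} = 0 \<and> emeasure \<nu>m {..0} = 0"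
    by metis
  show thesis
  proof (rule that[OF n(1)])
    assume "a \<ge> 0"
    then show "emeasure \<nu>p {..0} = 0 \<and> emeasure \<nu>m {..0} = 0"
      by (intro n(2)) (auto simp: x_def)
  qed
qed

section \<open>The law determined by a scaling equation\<close>

text \<open>As \<open>p + q + r = 1\<close>, the equation for the characteristic function says that \<open>\<sigma>\<close> is a mixture of
  three affine images of itself; this form extends from characteristic functions to Laplace
  transforms.\<close>

lemma scaling_equation_integral:
  fixes a b p q r :: real and g :: "real \<Rightarrow> complex"
  assumes \<sigma>: "real_distribution \<sigma>" and pqr: "p \<ge> 0" "q \<ge> 0" "r \<ge> 0" "p + q + r = 1"
    and eq: "\<And>z. (1 - of_real q * iexp z) * char \<sigma> z = (of_real p + of_real r * iexp (a * z)) * char \<sigma> (b * z)"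
    and g [measurable]: "g \<in> borel_measurable borel" and bound: "\<And>x. norm (g x) \<le> B"
  shows "(CLINT x|\<sigma>. g x) = q * (CLINT x|\<sigma>. g (x + 1)) + p * (CLINT x|\<sigma>. g (b * x)) + r * (CLINT x|\<sigma>. g (b * x + a))"
proof -
  interpret \<sigma>: real_distribution \<sigma> by fact
  define P where "P = pmf_of_list [(0::nat, q), (1, p), (2, r)]"
  have wf: "pmf_of_list_wf [(0::nat, q), (1, p), (2, r)]"
    using pqr by (intro pmf_of_list_wfI) auto
  \<comment> \<open>If J has law \<open>P\<close> and X has law \<open>\<sigma>\<close>,
    independently, then \<open>m\<close> is the law of T J X, the mixture of the three affine
    images.\<close>
  define T where "T j x = (if j = (0::nat) then x + 1 else if j = 1 then b * x else b * x + a)" for j x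
  interpret PP: pair_prob_space "measure_pmf P" \<sigma> by unfold_locales
  have T [measurable]: "(\<lambda>z. T (fst z) (snd z)) \<in> borel_measurable (measure_pmf P \<Otimes>\<^sub>M \<sigma>)"
    unfolding T_def by measurable
  define m where "m = distr (measure_pmf P \<Otimes>\<^sub>M \<sigma>) borel (\<lambda>z. T (fst z) (snd z))"
  have m: "real_distribution m"
    unfolding m_def by (intro real_distribution_distr PP.prob_space_axioms T)
  have int: "(CLINT x|m. h x) = q * (CLINT x|\<sigma>. h (x + 1)) + p * (CLINT x|\<sigma>. h (b * x)) + r * (CLINT x|\<sigma>. h (b * x + a))"
    if [measurable]: "h \<in> borel_measurable borel" and bd: "\<And>x. norm (h x) \<le> C" for h :: "real \<Rightarrow> complex" and C
  proof -
    have "(CLINT x|m. h x) = (CLINT z|measure_pmf P \<Otimes>\<^sub>M \<sigma>. h (T (fst z) (snd z)))"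
      unfolding m_def by (rule integral_distr) auto
    also have "\<dots> = (CLINT j|measure_pmf P. (CLINT x|\<sigma>. h (T j x)))"
    proof (subst PP.integral_fst'[symmetric])
      show "integrable (measure_pmf P \<Otimes>\<^sub>M \<sigma>) (\<lambda>z. h (T (fst z) (snd z)))"
        by (rule PP.P.integrable_const_bound[where B = C]) (auto simp: bd)
    qed simp
    also have "\<dots> = (\<Sum>j\<in>{0,1,2}. pmf P j *\<^sub>R (CLINT x|\<sigma>. h (T j x)))"
      by (rule integral_measure_pmf) (use set_pmf_of_list[OF wf] in \<open>auto simp: P_def\<close>)
    finally have "(CLINT x|m. h x) = (\<Sum>j\<in>{0,1,2}. pmf P j *\<^sub>R (CLINT x|\<sigma>. h (T j x)))" .
    moreover have "pmf P 0 = q" "pmf P 1 = p" "pmf P 2 = r"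
      unfolding P_def pmf_pmf_of_list[OF wf] by simp_all
    ultimately show ?thesis by (simp add: T_def scaleR_conv_of_real)
  qed
  have "char m z = char \<sigma> z" for z
  proof -
    have "char m z = q * (iexp z * char \<sigma> z) + p * char \<sigma> (b * z) + r * (iexp (a * z) * char \<sigma> (b * z))"
      unfolding char_def by (subst int[of _ 1]) (simp_all add: algebra_simps exp_add)
    then show ?thesis using eq[of z] by (simp add: algebra_simps)
  qed
  \<comment> \<open>Here the identity passes from exponentials iexp (z x) to arbitrary bounded
    measurable functions.\<close>
  then have "m = \<sigma>" by (intro Levy_uniqueness m \<sigma> ext)
  with int[OF g bound] show ?thesis by simp
qed

section \<open>Laplace transforms and the simple zero\<close>

text \<open>The argument is complex: t = -iz on the imaginary axis recovers the characteristic
  function, while the zero of interest has positive real part.\<close>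

definition laplace :: "real measure \<Rightarrow> complex \<Rightarrow> complex" where
  "laplace \<sigma> t = (CLINT x|\<sigma>. exp (- (t * of_real x)))"

lemma norm_exp_minus_le_1: "Re t \<ge> 0 \<Longrightarrow> x \<ge> 0 \<Longrightarrow> norm (exp (- (t * of_real x))) \<le> 1"
  by (simp add: norm_exp_eq_Re)

lemma laplace_scaling_equation:
  fixes a b p q r :: real
  assumes \<sigma>: "real_distribution \<sigma>" and pos: "AE x in \<sigma>. x \<ge> 0"
    and pqr: "p \<ge> 0" "q \<ge> 0" "r \<ge> 0" "p + q + r = 1" and b: "b \<ge> 0" and a: "a \<ge> 0"
    and eq: "\<And>z. (1 - of_real q * iexp z) * char \<sigma> z = (of_real p + of_real r * iexp (a * z)) * char \<sigma> (b * z)"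
    and t: "Re t \<ge> 0"
  shows "(1 - of_real q * exp (- t)) * laplace \<sigma> t = (of_real p + of_real r * exp (- (of_real a * t))) * laplace \<sigma> (of_real b * t)"
proof -
  interpret \<sigma>: real_distribution \<sigma> by fact
  \<comment> \<open>Truncation at 0 makes the exponential bounded on the whole line, as the mixture
    identity requires, without changing it almost everywhere.\<close>
  define g where "g x = exp (- (t * of_real (max 0 x)))" for x :: real
  have [measurable]: "g \<in> borel_measurable borel" unfolding g_def by measurable
  have bound: "norm (g x) \<le> 1" for x unfolding g_def by (intro norm_exp_minus_le_1 t) simp
  have "(CLINT x|\<sigma>. g x) = q * (CLINT x|\<sigma>. g (x + 1)) + p * (CLINT x|\<sigma>. g (b * x)) + r * (CLINT x|\<sigma>. g (b * x + a))"
    by (rule scaling_equation_integral[OF \<sigma> pqr eq _ bound]) simp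
  also have "(CLINT x|\<sigma>. g x) = laplace \<sigma> t"
    unfolding laplace_def using pos by (intro integral_cong_AE) (auto elim!: eventually_mono simp: g_def)
  also have "(CLINT x|\<sigma>. g (x + 1)) = (CLINT x|\<sigma>. exp (- t) * exp (- (t * of_real x)))"
    using pos by (intro integral_cong_AE) (auto elim!: eventually_mono simp: g_def algebra_simps exp_diff exp_minus exp_add divide_inverse)
  also have "\<dots> = exp (- t) * laplace \<sigma> t" unfolding laplace_def by simp
  also have "(CLINT x|\<sigma>. g (b * x)) = laplace \<sigma> (of_real b * t)"
    unfolding laplace_def using pos b by (intro integral_cong_AE) (auto elim!: eventually_mono simp: g_def mult_ac)
  also have "(CLINT x|\<sigma>. g (b * x + a)) = (CLINT x|\<sigma>. exp (- (of_real a * t)) * exp (- ((of_real b * t) * of_real x)))"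
    using pos b a by (intro integral_cong_AE) (auto elim!: eventually_mono simp: g_def algebra_simps exp_diff exp_minus exp_add divide_inverse)
  also have "\<dots> = exp (- (of_real a * t)) * laplace \<sigma> (of_real b * t)" unfolding laplace_def by simp
  finally show ?thesis by (simp add: algebra_simps)
qed

lemma tendsto_laplace:
  assumes \<sigma>: "real_distribution \<sigma>" and pos: "AE x in \<sigma>. x \<ge> 0"
    and t: "\<And>n. Re (t n) \<ge> 0" "t \<longlonglongrightarrow> l"
  shows "(\<lambda>n. laplace \<sigma> (t n)) \<longlonglongrightarrow> laplace \<sigma> l"
proof -
  interpret \<sigma>: real_distribution \<sigma> by fact
  show ?thesis
    unfolding laplace_def
  proof (rule integral_dominated_convergence[where w = "\<lambda>_. 1"])
    show "AE x in \<sigma>. (\<lambda>n. exp (- (t n * of_real x))) \<longlonglongrightarrow> exp (- (l * of_real x))"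
      using t(2) by (intro AE_I2 tendsto_intros)
    show "AE x in \<sigma>. norm (exp (- (t n * of_real x))) \<le> 1" for n
      using pos by eventually_elim (intro norm_exp_minus_le_1 t)
  qed auto
qed

lemma laplace_0: "real_distribution \<sigma> \<Longrightarrow> laplace \<sigma> 0 = 1"
  using prob_space.prob_space[of \<sigma>] by (simp add: laplace_def real_distribution_def)

lemma laplace_convolution:
  assumes \<tau>: "real_distribution \<tau>" and pos: "AE x in \<tau>. x \<ge> 0" and t: "Re t \<ge> 0"
  shows "laplace (\<tau> \<star> \<tau>) t = (laplace \<tau> t)\<^sup>2"
proof -
  interpret \<tau>: real_distribution \<tau> by fact
  have "integrable \<tau> (\<lambda>x. exp (- (t * of_real x)))"
    by (rule \<tau>.integrable_const_bound[where B = 1])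
      (use pos t in \<open>auto elim!: eventually_mono intro!: mult_nonneg_nonneg\<close>)
  then show ?thesis
    unfolding laplace_def power2_eq_square
    by (intro integral_convolution_exponential \<tau>) (auto simp: algebra_simps exp_diff exp_minus exp_add divide_inverse)
qed

text \<open>Two independent negative values have a negative sum, so the square of the mass of the
  negative half-line is at most the mass of that half-line under the convolution.\<close>

lemma AE_nonneg_of_convolution:
  assumes \<tau>: "real_distribution \<tau>" and pos: "AE x in (\<tau> \<star> \<tau>). x \<ge> 0"
  shows "AE x in \<tau>. x \<ge> 0"
proof -
  interpret \<tau>: real_distribution \<tau> by fact
  define k where "k = emeasure \<tau> {..<0}"
  have "k * k = (\<integral>\<^sup>+x. k * indicator {..<0} x \<partial>\<tau>)"
    unfolding k_def by (simp add: nn_integral_cmult)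
  also have "\<dots> \<le> (\<integral>\<^sup>+x. emeasure \<tau> {y. y + x \<in> {..<0}} \<partial>\<tau>)"
    unfolding k_def by (intro nn_integral_mono) (auto simp: indicator_def intro!: emeasure_mono)
  also have "\<dots> = emeasure (\<tau> \<star> \<tau>) {..<0}"
    by (subst convolution_emeasure) (auto intro: \<tau>.finite_measure_axioms)
  also have "\<dots> = 0"
  proof -
    have "{x \<in> space (\<tau> \<star> \<tau>). \<not> x \<ge> 0} = {..<0}" by (auto simp: not_le)
    moreover have "{..<0} \<in> sets (\<tau> \<star> \<tau>)" by simp
    ultimately show ?thesis using pos AE_iff_measurable[of "{..<0}" "\<tau> \<star> \<tau>" "\<lambda>x. x \<ge> 0"] by metis
  qed
  finally have "k = 0" by simp
  moreover have "{x \<in> space \<tau>. \<not> x \<ge> 0} = {..<0}" by (auto simp: not_le)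
  ultimately show ?thesis
    unfolding k_def using AE_iff_measurable[of "{..<0}" \<tau> "\<lambda>x. x \<ge> 0"] by simp
qed

text \<open>A substitute for differentiability: at a zero of the transform of \<open>\<tau>\<close>
  it gives O(h), hence O(h^2) for the square. The constant 1 / Re t comes from y e^(-y) <= 1 with y
  = Re t * x.\<close>

lemma norm_laplace_diff_le:
  assumes \<tau>: "real_distribution \<tau>" and pos: "AE x in \<tau>. x \<ge> 0" and t: "Re t > 0" and h: "h \<ge> 0"
  shows "norm (laplace \<tau> (t + of_real h) - laplace \<tau> t) \<le> h / Re t"
proof -
  interpret \<tau>: real_distribution \<tau> by fact
  have int: "integrable \<tau> (\<lambda>x. exp (- (s * of_real x)))" if "Re s \<ge> 0" for s
    by (rule \<tau>.integrable_const_bound[where B = 1])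
      (use pos that in \<open>auto elim!: eventually_mono intro!: mult_nonneg_nonneg\<close>)
  have le: "norm (exp (- ((t + of_real h) * of_real x)) - exp (- (t * of_real x))) \<le> h / Re t"
    if "x \<ge> 0" for x :: real
  proof -
    have "exp (- ((t + of_real h) * of_real x)) - exp (- (t * of_real x)) =
        exp (- (t * of_real x)) * of_real (exp (- (h * x)) - 1)"
      by (simp add: algebra_simps exp_diff exp_minus exp_add divide_inverse flip: exp_of_real)
    then have "norm (exp (- ((t + of_real h) * of_real x)) - exp (- (t * of_real x))) =
        exp (- (Re t * x)) * \<bar>exp (- (h * x)) - 1\<bar>"
      by (simp only: norm_mult norm_of_real norm_exp_eq_Re) simp
    also have "\<bar>exp (- (h * x)) - 1\<bar> \<le> h * x"
      using exp_ge_add_one_self[of "- (h * x)"] mult_nonneg_nonneg[OF h that] by (auto simp: abs_if)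
    also have "exp (- (Re t * x)) * (h * x) \<le> h / Re t"
    proof -
      have "Re t * x \<le> exp (Re t * x)" using exp_ge_add_one_self[of "Re t * x"] by linarith
      then have "exp (- (Re t * x)) * (Re t * x) \<le> 1"
        by (simp add: exp_minus field_simps)
      then have "h * (exp (- (Re t * x)) * (Re t * x)) \<le> h * 1"
        using h by (rule mult_left_mono)
      then show ?thesis using t by (simp add: field_simps)
    qed
    finally show ?thesis by simp
  qed
  have "laplace \<tau> (t + of_real h) - laplace \<tau> t = (CLINT x|\<tau>. exp (- ((t + of_real h) * of_real x)) - exp (- (t * of_real x)))"
    unfolding laplace_def using t h by (intro Bochner_Integration.integral_diff[symmetric] int) auto
  also have "norm \<dots> \<le> (LINT x|\<tau>. h / Re t)"
    by (rule order.trans[OF integral_norm_bound integral_mono_AE])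
      (use pos t h le in \<open>auto intro!: Bochner_Integration.integrable_diff integrable_norm int elim!: eventually_mono\<close>)
  finally show ?thesis using \<tau>.prob_space by simp
qed

text \<open>The factor \<open>p + r e\<^bsup>-at\<^esup>\<close> has a simple zero in the right half-plane, which survives in the Laplace
  transform of \<open>\<sigma>\<close>; the transform of \<open>\<tau> \<star> \<tau>\<close> is a square and has no simple zeros.\<close>

lemma not_ID_of_scaling_equation:
  fixes a b p q r :: real
  assumes \<sigma>: "real_distribution \<sigma>" and pos: "AE x in \<sigma>. x \<ge> 0"
    and pqr: "q \<ge> 0" "p + q + r = 1" "0 < p" "p < r" and b: "0 \<le> b" "b < 1" and a: "a > 0"
    and eq: "\<And>z. (1 - of_real q * iexp z) * char \<sigma> z = (of_real p + of_real r * iexp (a * z)) * char \<sigma> (b * z)"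
  shows "\<sigma> \<notin> ID"
proof
  assume "\<sigma> \<in> ID"
  then obtain \<tau> where \<tau>: "real_distribution \<tau>" and \<sigma>\<tau>: "\<sigma> = (\<tau> \<star> \<tau>)"
    by (rule ID_square_root)
  have \<tau>pos: "AE x in \<tau>. x \<ge> 0" using AE_nonneg_of_convolution[OF \<tau>] pos unfolding \<sigma>\<tau> .
  have F: "(1 - of_real q * exp (- t)) * laplace \<sigma> t = (of_real p + of_real r * exp (- (of_real a * t))) * laplace \<sigma> (of_real b * t)"
    if "Re t \<ge> 0" for t
    by (rule laplace_scaling_equation[OF \<sigma> pos _ _ _ _ _ _ eq that]) (use pqr a b in auto)
  have sq: "laplace \<sigma> t = (laplace \<tau> t)\<^sup>2" if "Re t \<ge> 0" for t
    unfolding \<sigma>\<tau> by (rule laplace_convolution[OF \<tau> \<tau>pos that])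
  \<comment> \<open>All zeros of p + r e^(-at) have a * Re t = ln (r/p). A zero of the transform to
    the left of this line would pass on from s to b s, b^2 s and so on, and by continuity to 0,
    where the transform is 1.\<close>
  have nonzero: "laplace \<sigma> s \<noteq> 0" if s: "Re s \<ge> 0" "a * Re s < ln (r / p)" for s
  proof
    assume zero: "laplace \<sigma> s = 0"
    have "laplace \<sigma> (of_real (b ^ n) * s) = 0" for n
    proof (induction n)
      case (Suc n)
      let ?s = "of_real (b ^ n) * s"
      have le: "b ^ n \<le> 1" using b by (simp add: power_le_one)
      have Re: "Re ?s = b ^ n * Re s" by simp
      have "Re ?s \<ge> 0" unfolding Re using b s by simp
      from F[OF this] Suc have "(of_real p + of_real r * exp (- (of_real a * ?s))) * laplace \<sigma> (of_real b * ?s) = 0"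
        by simp
      moreover have "of_real p + of_real r * exp (- (of_real a * ?s)) \<noteq> 0"
      proof
        assume "of_real p + of_real r * exp (- (of_real a * ?s)) = 0"
        then have "norm (of_real r * exp (- (of_real a * ?s))) = norm (complex_of_real p)"
          by (metis add_eq_0_iff norm_minus_cancel)
        then have "r * exp (- (a * Re ?s)) = p"
          using pqr by (simp add: norm_mult norm_exp_eq_Re)
        then have "exp (a * Re ?s) = r / p" using pqr by (simp add: exp_minus field_simps)
        then have "a * Re ?s = ln (r / p)" by (metis ln_exp)
        moreover have "a * Re ?s \<le> a * Re s"
          unfolding Re using a s mult_right_mono[OF le s(1)] by (intro mult_left_mono) auto
        ultimately show False using s by simp
      qed
      ultimately show ?case by (simp add: mult_ac)
    qed (use zero in simp)
    moreover have "(\<lambda>n. laplace \<sigma> (of_real (b ^ n) * s)) \<longlonglongrightarrow> laplace \<sigma> (of_real 0 * s)"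
    proof (rule tendsto_laplace[OF \<sigma> pos])
      show "Re (of_real (b ^ n) * s) \<ge> 0" for n using b s by simp
      show "(\<lambda>n. of_real (b ^ n) * s) \<longlonglongrightarrow> of_real 0 * s"
        using b by (intro tendsto_intros LIMSEQ_realpow_zero) auto
    qed
    ultimately show False using laplace_0[OF \<sigma>] by (simp add: LIMSEQ_const_iff)
  qed
  define \<theta> where "\<theta> = ln (r / p) / a"
  have \<theta>: "\<theta> > 0" unfolding \<theta>_def using pqr a by simp
  \<comment> \<open>The modulus p / r comes from the real part and the sign -1 from the imaginary
    part, so p + r e^(-a t0) = 0.\<close>
  define t0 where "t0 = Complex \<theta> (pi / a)"
  have "exp (- (of_real a * t0)) = - of_real (p / r)"
  proof -
    have "- (of_real a * t0) = of_real (ln (p / r)) - \<i> * pi"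
      using a pqr by (simp add: t0_def \<theta>_def complex_eq_iff ln_div)
    then have "exp (- (of_real a * t0)) = exp (of_real (ln (p / r))) * exp (- (\<i> * pi))"
      by (simp add: exp_diff exp_minus divide_inverse)
    also have "exp (- (\<i> * pi)) = -1" by (simp add: exp_minus)
    also have "exp (complex_of_real (ln (p / r))) = of_real (p / r)"
      using pqr by (subst exp_of_real) simp
    finally show ?thesis by simp
  qed
  \<comment> \<open>Along t0 + h the factor is real and vanishes only to first order at h =
    0.\<close>
  then have fac: "of_real p + of_real r * exp (- (of_real a * (t0 + of_real h))) = of_real (p * (1 - exp (- (a * h))))" for h
    using pqr by (simp add: algebra_simps exp_diff exp_minus exp_add divide_inverse flip: exp_of_real)
  have "laplace \<sigma> t0 = 0"
  proof -
    have "1 - of_real q * exp (- t0) \<noteq> 0"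
    proof
      assume "1 - of_real q * exp (- t0) = 0"
      then have "norm (of_real q * exp (- t0)) = norm (1::complex)" by (metis eq_iff_diff_eq_0)
      then have "q * exp (- \<theta>) = 1" using pqr by (simp add: norm_mult norm_exp_eq_Re t0_def)
      moreover have "q * exp (- \<theta>) \<le> q * 1" using \<theta> pqr by (intro mult_left_mono) auto
      ultimately show False using pqr by simp
    qed
    then show ?thesis using F[of t0] fac[of 0] \<theta> by (simp add: t0_def)
  qed
  then have \<tau>0: "laplace \<tau> t0 = 0" using sq[of t0] \<theta> by (simp add: t0_def)
  \<comment> \<open>The left side of the functional equation is at most 2 (h/\<theta>)^2, with 2
    bounding |1 - q e^(-t)|. Division by the factor of order p a h leaves O(h) for the transform
    near b t0.\<close>
  have bound: "norm (laplace \<sigma> (of_real b * (t0 + of_real h))) \<le> 2 * h * (1 + a * h) / (\<theta>\<^sup>2 * p * a)" if h: "h > 0" for h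
  proof -
    let ?t = "t0 + of_real h"
    have Re: "Re ?t \<ge> 0" using \<theta> h by (simp add: t0_def)
    have "norm (laplace \<tau> ?t) \<le> h / \<theta>"
      using norm_laplace_diff_le[OF \<tau> \<tau>pos, of t0 h] \<theta> h \<tau>0 by (simp add: t0_def)
    then have "norm (laplace \<sigma> ?t) \<le> (h / \<theta>)\<^sup>2"
      unfolding sq[OF Re] norm_power by (intro power_mono) auto
    moreover have "norm (1 - of_real q * exp (- ?t)) \<le> 2"
    proof -
      have "norm (1 - of_real q * exp (- ?t)) \<le> 1 + q * exp (- Re ?t)"
        using norm_triangle_ineq4[of 1 "of_real q * exp (- ?t)"] pqr by (simp add: norm_mult norm_exp_eq_Re)
      also have "q * exp (- Re ?t) \<le> 1 * 1" using pqr Re by (intro mult_mono) auto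
      finally show ?thesis by simp
    qed
    ultimately have "norm ((1 - of_real q * exp (- ?t)) * laplace \<sigma> ?t) \<le> 2 * (h / \<theta>)\<^sup>2"
      unfolding norm_mult by (intro mult_mono) auto
    then have le: "p * (1 - exp (- (a * h))) * norm (laplace \<sigma> (of_real b * ?t)) \<le> 2 * (h / \<theta>)\<^sup>2"
      unfolding F[OF Re] fac norm_mult norm_of_real using pqr a h by (simp add: abs_mult)
    \<comment> \<open>This leads to the explicit lower bound 1 - e^(-x) >= x / (1 + x) at x = a
      h.\<close>
    have "1 + a * h \<le> exp (a * h)" by (rule exp_ge_add_one_self)
    moreover have "1 + a * h > 0" using a h by (simp add: add_pos_pos)
    ultimately have "exp (- (a * h)) \<le> 1 / (1 + a * h)"
      by (simp add: exp_minus divide_inverse le_imp_inverse_le)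
    then have "a * h / (1 + a * h) \<le> 1 - exp (- (a * h))"
      using \<open>1 + a * h > 0\<close> by (simp add: field_simps)
    then have "p * (a * h / (1 + a * h)) * norm (laplace \<sigma> (of_real b * ?t)) \<le> 2 * (h / \<theta>)\<^sup>2"
      using pqr by (intro order.trans[OF _ le] mult_right_mono mult_left_mono) auto
    then have "h * (p * a * \<theta>\<^sup>2 * norm (laplace \<sigma> (of_real b * ?t))) \<le> h * (2 * h * (1 + a * h))"
      using \<open>1 + a * h > 0\<close> \<theta> by (simp add: divide_simps power2_eq_square) (simp add: algebra_simps)
    then have "p * a * \<theta>\<^sup>2 * norm (laplace \<sigma> (of_real b * ?t)) \<le> 2 * h * (1 + a * h)"
      by (rule mult_left_le_imp_le[OF _ h])
    then show ?thesis
      using pqr a \<theta> by (subst pos_le_divide_eq) (auto simp: mult_ac)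
  qed
  have h0: "(\<lambda>n. 1 / real (Suc n)) \<longlonglongrightarrow> 0" using LIMSEQ_inverse_real_of_nat by (simp add: inverse_eq_divide)
  have "(\<lambda>n. laplace \<sigma> (of_real b * (t0 + of_real (1 / real (Suc n))))) \<longlonglongrightarrow> 0"
  proof (rule Lim_null_comparison)
    show "\<forall>\<^sub>F n in sequentially. norm (laplace \<sigma> (of_real b * (t0 + of_real (1 / real (Suc n))))) \<le>
        2 * (1 / real (Suc n)) * (1 + a * (1 / real (Suc n))) / (\<theta>\<^sup>2 * p * a)"
      by (intro always_eventually allI bound) simp
    have "(\<lambda>n. 2 * (1 / real (Suc n)) * (1 + a * (1 / real (Suc n))) / (\<theta>\<^sup>2 * p * a)) \<longlonglongrightarrow> 2 * 0 * (1 + a * 0) / (\<theta>\<^sup>2 * p * a)"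
      using \<theta> pqr a by (intro tendsto_intros h0) auto
    then show "(\<lambda>n. 2 * (1 / real (Suc n)) * (1 + a * (1 / real (Suc n))) / (\<theta>\<^sup>2 * p * a)) \<longlonglongrightarrow> 0" by simp
  qed
  moreover have "(\<lambda>n. laplace \<sigma> (of_real b * (t0 + of_real (1 / real (Suc n))))) \<longlonglongrightarrow> laplace \<sigma> (of_real b * (t0 + of_real 0))"
  proof (rule tendsto_laplace[OF \<sigma> pos])
    show "Re (of_real b * (t0 + of_real (1 / real (Suc n)))) \<ge> 0" for n
      using b \<theta> by (simp add: t0_def)
    show "(\<lambda>n. of_real b * (t0 + of_real (1 / real (Suc n)))) \<longlonglongrightarrow> of_real b * (t0 + of_real 0)"
      by (intro tendsto_intros h0)
  qed
  ultimately have "laplace \<sigma> (of_real b * t0) = 0" using LIMSEQ_unique by fastforce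
  \<comment> \<open>Contraction by b < 1 moves t0 into the region without zeros.\<close>
  moreover have "laplace \<sigma> (of_real b * t0) \<noteq> 0"
  proof (rule nonzero)
    show "Re (of_real b * t0) \<ge> 0" using b \<theta> by (simp add: t0_def)
    have "b * ln (r / p) < 1 * ln (r / p)" using b pqr by (intro mult_strict_right_mono) auto
    then show "a * Re (of_real b * t0) < ln (r / p)" using a by (simp add: t0_def \<theta>_def)
  qed
  ultimately show False by simp
qed

section \<open>The four cases for a solution of the scaling equation\<close>

lemma classification_of_scaling_equation:
  fixes a b p q r :: real
  assumes \<sigma>: "real_distribution \<sigma>" and pos: "AE x in \<sigma>. x \<ge> 0"
    and pqr: "p \<ge> 0" "q \<ge> 0" "r \<ge> 0" "p + q + r = 1" "p + r > 0" and b: "0 \<le> b" "b < 1" and a: "a > 0"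
    and eq: "\<And>z. (1 - of_real q * iexp z) * char \<sigma> z = (of_real p + of_real r * iexp (a * z)) * char \<sigma> (b * z)"
  shows "p = 0 \<or> r = 0 \<Longrightarrow> \<sigma> \<in> ID"
    and "0 < r \<Longrightarrow> r < p \<Longrightarrow> \<sigma> \<in> ID \<union> ID0 \<and> quasi_levy_measure_on_pos \<sigma>"
    and "0 < p \<Longrightarrow> p < r \<Longrightarrow> \<sigma> \<in> ID0"
    and "p = r \<Longrightarrow> 0 < r \<Longrightarrow> \<sigma> \<in> ID00"
proof -
  have q: "q < 1" using pqr by simp
  have nz: "1 - of_real q * iexp z \<noteq> 0" for z
  proof
    assume "1 - of_real q * iexp z = 0"
    then have "norm (of_real q * iexp z) = norm (1::complex)" by (metis eq_iff_diff_eq_0)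
    then show False using q pqr by (simp add: norm_mult)
  qed
  have pr0: "complex_of_real p + of_real r \<noteq> 0"
    using pqr by (metis less_irrefl of_real_add of_real_eq_0_iff)
  have solved: "char \<sigma> z = (of_real p + of_real r * iexp (a * z)) / (1 - of_real q * iexp z) * char \<sigma> (b * z)" for z
    using eq[of z] nz[of z] by (simp add: nonzero_eq_divide_eq mult.commute)
  {
    assume "p = 0 \<or> r = 0"
    then show "\<sigma> \<in> ID"
    proof
      assume p: "p = 0"
      then have r: "r = 1 - q" using pqr by simp
      show ?thesis
        by (rule ID_of_scaling_equation[OF \<sigma> b \<open>q \<ge> 0\<close> q, of a]) (use a eq in \<open>simp_all add: p r\<close>)
    next
      assume r: "r = 0"
      then have p: "p = 1 - q" using pqr by simp
      show ?thesis
        by (rule ID_of_scaling_equation[OF \<sigma> b \<open>q \<ge> 0\<close> q, of 0]) (use eq in \<open>simp_all add: p r\<close>)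
    qed
  }
  {
    assume "0 < r" "r < p"
    \<comment> \<open>Factoring out p leaves the ratio r/p < 1 and no drift. Both quotients are
      normalized to 1 at z = 0 by 1 - q = p + r.\<close>
    then have eq': "char \<sigma> z = iexp (0 * z) * (of_real (1 - q) / (1 - of_real q * iexp z) *
        ((1 + of_real (r / p) * iexp (a * z)) / of_real (1 + r / p))) * char \<sigma> (b * z)" for z
    proof -
      have "1 + of_real (r / p) * A = (of_real p + of_real r * A) / of_real p" for A :: complex
        using \<open>0 < r\<close> \<open>r < p\<close> by (simp add: field_simps)
      moreover have "1 + r / p = (p + r) / p" "1 - q = p + r"
        using \<open>0 < r\<close> \<open>r < p\<close> pqr by (auto simp: field_simps)
      ultimately show ?thesis
        using solved[of z] \<open>0 < r\<close> \<open>r < p\<close> pr0 by simp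
    qed
    have "\<bar>q\<bar> < 1" "\<bar>r / p\<bar> < 1" using q pqr \<open>0 < r\<close> \<open>r < p\<close> by auto
    from quasi_levy_measure_of_two_log_series[OF \<sigma> b this eq'] a
    obtain \<nu>p \<nu>m where n: "quasi_levy_measure \<sigma> \<nu>p \<nu>m" "emeasure \<nu>p {..0} = 0 \<and> emeasure \<nu>m {..0} = 0"
      by (metis less_imp_le)
    then show "\<sigma> \<in> ID \<union> ID0 \<and> quasi_levy_measure_on_pos \<sigma>"
      unfolding quasi_levy_measure_on_pos_def ID0_def QID_def using \<sigma> by blast
  }
  {
    assume "0 < p" "p < r"
    \<comment> \<open>Factoring out r e^(iaz) instead leaves the ratio p/r < 1, at the price of a
      drift a and of atoms at negative multiples of a.\<close>
    then have eq': "char \<sigma> z = iexp (a * z) * (of_real (1 - q) / (1 - of_real q * iexp z) *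
        ((1 + of_real (p / r) * iexp (- a * z)) / of_real (1 + p / r))) * char \<sigma> (b * z)" for z
    proof -
      have "1 + of_real (p / r) * iexp (- a * z) = (of_real p + of_real r * iexp (a * z)) / (of_real r * iexp (a * z))"
        using \<open>0 < p\<close> \<open>p < r\<close> by (simp add: field_simps exp_minus)
      moreover have "1 + p / r = (p + r) / r" "1 - q = p + r"
        using \<open>0 < p\<close> \<open>p < r\<close> pqr by (auto simp: field_simps)
      ultimately show ?thesis
        using solved[of z] \<open>0 < p\<close> \<open>p < r\<close> pr0 by simp
    qed
    have "\<bar>q\<bar> < 1" "\<bar>p / r\<bar> < 1" using q pqr \<open>0 < p\<close> \<open>p < r\<close> by auto
    from quasi_levy_measure_of_two_log_series[OF \<sigma> b this eq']
    obtain \<nu>p \<nu>m where n: "quasi_levy_measure \<sigma> \<nu>p \<nu>m" by metis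
    moreover have "\<sigma> \<notin> ID"
      using \<open>0 < p\<close> \<open>p < r\<close> pqr by (intro not_ID_of_scaling_equation[OF \<sigma> pos _ _ _ _ b a eq]) auto
    ultimately show "\<sigma> \<in> ID0"
      unfolding ID0_def QID_def using \<sigma> by blast
  }
  {
    assume "p = r" "0 < r"
    have "char \<sigma> (pi / a) = 0"
      using eq[of "pi / a"] nz[of "pi / a"] a \<open>p = r\<close> by simp
    then show "\<sigma> \<in> ID00"
      unfolding ID00_def QID_def quasi_levy_measure_def quasi_levy_triplet_def
      using \<sigma> by (auto intro!: exI[of _ "pi / a"] simp: exp_not_eq_zero[symmetric])
  }
qed

section \<open>Stieltjes integrals along step paths\<close>

text \<open>These are the almost sure path properties on which all pathwise arguments rest; the
  integer increments make \<open>n\<close> a nondecreasing integer-valued function.\<close>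

definition good_path :: "(real \<Rightarrow> real) \<Rightarrow> (real \<Rightarrow> real) \<Rightarrow> bool" where
  "good_path n l \<longleftrightarrow> n 0 = 0 \<and> l 0 = 0 \<and>
     (\<forall>t\<ge>0. (n \<longlongrightarrow> n t) (at_right t) \<and> (l \<longlongrightarrow> l t) (at_right t)) \<and>
     (\<forall>t>0. \<exists>x. (n \<longlongrightarrow> x) (at_left t)) \<and>
     (\<forall>s t. 0 \<le> s \<longrightarrow> s \<le> t \<longrightarrow> n t - n s \<in> \<nat> \<and> l s \<le> l t)"

text \<open>The weight c powr (- x) gives \<open>exp_integral\<close>; the hat function max 0 (1 -
  |x|) gives the value of \<open>l\<close> at the first jump of \<open>n\<close>.\<close>

definition stieltjes_integral :: "(real \<Rightarrow> real) \<Rightarrow> (real \<Rightarrow> real) \<Rightarrow> (real \<Rightarrow> real) \<Rightarrow> real \<Rightarrow> real" where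
  "stieltjes_integral \<psi> n l t =
     (LINT s:{0<..t}|interval_measure (\<lambda>s. l (max 0 s)). \<psi> (left_limit n s))"

definition grid_sum :: "(real \<Rightarrow> real) \<Rightarrow> (real \<Rightarrow> real) \<Rightarrow> (real \<Rightarrow> real) \<Rightarrow> real \<Rightarrow> nat \<Rightarrow> real" where
  "grid_sum \<psi> n l h K = (\<Sum>k<K. \<psi> (n (real k * h)) * (l (real (Suc k) * h) - l (real k * h)))"

text \<open>At integers the weight is a power of b, so it is multiplicative in the number of jumps.
  Continuity on the reals carries it through left limits.\<close>

locale weighted_path =
  fixes n l \<psi> :: "real \<Rightarrow> real" and b :: real
  assumes good: "good_path n l" and cont: "continuous_on UNIV \<psi>" and nonneg: "\<And>x. 0 \<le> \<psi> x"
    and weight: "\<And>k. \<psi> (real k) = b ^ k" and b: "0 \<le> b" "b < 1"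
begin

lemma n0: "n 0 = 0" and l0: "l 0 = 0" and incr_Nats: "0 \<le> s \<Longrightarrow> s \<le> t \<Longrightarrow> n t - n s \<in> \<nat>"
  and l_mono: "0 \<le> s \<Longrightarrow> s \<le> t \<Longrightarrow> l s \<le> l t"
  and n_right: "t \<ge> 0 \<Longrightarrow> (n \<longlongrightarrow> n t) (at_right t)" and l_right: "t \<ge> 0 \<Longrightarrow> (l \<longlongrightarrow> l t) (at_right t)"
  using good unfolding good_path_def by auto

lemma n_Nats: "t \<ge> 0 \<Longrightarrow> n t \<in> \<nat>"
  using incr_Nats[of 0 t] n0 by simp

lemma n_mono: "0 \<le> s \<Longrightarrow> s \<le> t \<Longrightarrow> n s \<le> n t"
  using incr_Nats[of s t] by (auto simp: Nats_def)

lemma tendsto_left_limit: "s > 0 \<Longrightarrow> (n \<longlongrightarrow> left_limit n s) (at_left s)"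
proof -
  assume "s > 0"
  then obtain x where x: "(n \<longlongrightarrow> x) (at_left s)" using good unfolding good_path_def by blast
  then have "left_limit n s = x" unfolding left_limit_def by (intro tendsto_Lim) simp_all
  with x show ?thesis by simp
qed

lemma weight_le_1: "t \<ge> 0 \<Longrightarrow> \<psi> (n t) \<le> 1"
  using n_Nats[of t] weight b by (auto simp: Nats_def power_le_one)

lemma weight_antimono: "0 \<le> s \<Longrightarrow> s \<le> t \<Longrightarrow> \<psi> (n t) \<le> \<psi> (n s)"
proof -
  assume st: "0 \<le> s" "s \<le> t"
  obtain i j where "n s = real i" "n t = real j"
    using n_Nats[of s] n_Nats[of t] st by (auto simp: Nats_def)
  moreover have "n s \<le> n t" using n_mono st by simp
  ultimately show ?thesis using b weight by (simp add: power_decreasing)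
qed

abbreviation F :: "real \<Rightarrow> real" where "F \<equiv> \<lambda>s. l (max 0 s)"

lemma F_mono: "x \<le> y \<Longrightarrow> F x \<le> F y"
  using l_mono[of "max 0 x" "max 0 y"] by auto

lemma F_right: "continuous (at_right x) F"
proof (cases "x \<ge> 0")
  case True
  have "(F \<longlongrightarrow> l x) (at_right x)"
    using l_right[OF True] by (rule tendsto_cong[THEN iffD1, rotated])
      (use True in \<open>auto simp: eventually_at_right[of x "x + 1"] intro!: exI[of _ "x + 1"]\<close>)
  with True show ?thesis by (simp add: continuous_within)
next
  case False
  have "(F \<longlongrightarrow> l 0) (at_right x)"
    by (rule tendsto_eventually) (use False in \<open>auto simp: eventually_at_right[of x 0] intro!: exI[of _ 0]\<close>)
  with False show ?thesis by (simp add: continuous_within)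
qed

lemma emeasure_Ioc: "x \<le> y \<Longrightarrow> emeasure (interval_measure F) {x<..y} = ennreal (F y - F x)"
  by (rule emeasure_interval_measure_Ioc[OF _ F_mono F_right])

lemma measure_Ioc: "x \<le> y \<Longrightarrow> measure (interval_measure F) {x<..y} = F y - F x"
  by (rule measure_interval_measure_Ioc[OF _ F_mono F_right])

lemma integrable_Ioc: "integrable (interval_measure F) (\<lambda>s. indicator {x<..y} s :: real)"
  by (cases "x \<le> y") (auto simp: emeasure_Ioc)

definition step_fun :: "nat \<Rightarrow> nat \<Rightarrow> real \<Rightarrow> real" where
  "step_fun T m s = (\<Sum>k<T * 2 ^ m. \<psi> (n (real k * (1 / 2 ^ m))) *
     indicator {real k * (1 / 2 ^ m)<..real (Suc k) * (1 / 2 ^ m)} s)"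

text \<open>Cells are open on the left and closed on the right, so s lies in cell ceiling (s 2^m) -
  1. Its left end is strictly below s, which is why refinement leads to the left limit of the path
  and not to its value at s.\<close>

lemma step_fun_eq:
  assumes s: "0 < s" "s \<le> real T"
  defines "k0 m \<equiv> nat (\<lceil>s * 2 ^ m\<rceil> - 1)"
  shows "step_fun T m s = \<psi> (n (real (k0 m) * (1 / 2 ^ m)))" (is ?A)
    and "real (k0 m) * (1 / 2 ^ m) < s" (is ?B) and "s - 1 / 2 ^ m \<le> real (k0 m) * (1 / 2 ^ m)" (is ?C)
proof -
  let ?x = "s * 2 ^ m"
  have pos: "?x > 0" using s by simp
  then have "\<lceil>?x\<rceil> \<ge> 1" by (simp only: one_le_ceiling)
  then have k0: "real (k0 m) = of_int \<lceil>?x\<rceil> - 1" unfolding k0_def by simp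
  have k: "real (k0 m) < ?x" "?x \<le> real (k0 m) + 1" unfolding k0 by linarith+
  show ?B using k(1) by (simp add: pos_divide_less_eq)
  have "s \<le> (real (k0 m) + 1) / 2 ^ m" using k(2) by (subst pos_le_divide_eq) auto
  then show ?C by (simp add: add_divide_distrib)
  have iff: "indicator {real k * (1 / 2 ^ m)<..real (Suc k) * (1 / 2 ^ m)} s = (if k = k0 m then 1 else (0::real))" for k
  proof -
    have "s \<in> {real k * (1 / 2 ^ m)<..real (Suc k) * (1 / 2 ^ m)} \<longleftrightarrow> real k < ?x \<and> ?x \<le> real k + 1"
      by (simp add: pos_divide_less_eq pos_le_divide_eq add.commute)
    also have "\<dots> \<longleftrightarrow> k = k0 m" using k by auto
    finally show ?thesis by (simp add: indicator_def)
  qed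
  have "?x \<le> real T * 2 ^ m" using s by simp
  with k(1) have "real (k0 m) < real T * 2 ^ m" by (rule less_le_trans)
  then have "real (k0 m) < real (T * 2 ^ m)" by simp
  then have "k0 m < T * 2 ^ m" by (simp only: of_nat_less_iff)
  then show ?A
    unfolding step_fun_def iff by (simp add: if_distrib[of "\<lambda>x. _ * x"] cong: if_cong)
qed

lemma step_fun_eq_0: "s \<notin> {0<..real T} \<Longrightarrow> step_fun T m s = 0"
  unfolding step_fun_def
proof (intro sum.neutral ballI)
  fix k assume s: "s \<notin> {0<..real T}" and k: "k \<in> {..<T * 2 ^ m}"
  have "real (Suc k) \<le> real (T * 2 ^ m)" using k by (simp only: of_nat_le_iff) simp
  then have "real (Suc k) * (1 / 2 ^ m) \<le> real T" by (simp add: field_simps)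
  moreover have "0 \<le> real k * (1 / 2 ^ m)" by simp
  ultimately have "0 < s \<and> s \<le> real T" if "s \<in> {real k * (1 / 2 ^ m)<..real (Suc k) * (1 / 2 ^ m)}"
    using that unfolding greaterThanAtMost_iff by linarith
  then have "s \<notin> {real k * (1 / 2 ^ m)<..real (Suc k) * (1 / 2 ^ m)}"
    using s unfolding greaterThanAtMost_iff by blast
  then show "\<psi> (n (real k * (1 / 2 ^ m))) * indicator {real k * (1 / 2 ^ m)<..real (Suc k) * (1 / 2 ^ m)} s = 0"
    by simp
qed

lemma tendsto_step_fun: "(\<lambda>m. step_fun T m s) \<longlonglongrightarrow> indicator {0<..real T} s * \<psi> (left_limit n s)"
proof (cases "s \<in> {0<..real T}")
  case True
  then have s: "0 < s" "s \<le> real T" by auto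
  let ?k = "\<lambda>m. real (nat (\<lceil>s * 2 ^ m\<rceil> - 1)) * (1 / 2 ^ m)"
  have "?k \<longlonglongrightarrow> s"
  proof (rule tendsto_sandwich)
    have "(\<lambda>m. (1 / 2) ^ m :: real) \<longlonglongrightarrow> 0" by (rule LIMSEQ_realpow_zero) auto
    then have "(\<lambda>m. s - (1 / 2) ^ m) \<longlonglongrightarrow> s - 0" by (intro tendsto_diff tendsto_const)
    then show "(\<lambda>m. s - 1 / 2 ^ m) \<longlonglongrightarrow> s" by (simp add: power_one_over)
    show "\<forall>\<^sub>F m in sequentially. ?k m \<le> s"
      using step_fun_eq(2)[OF s] by (auto intro!: always_eventually less_imp_le)
    show "\<forall>\<^sub>F m in sequentially. s - 1 / 2 ^ m \<le> ?k m"
      using step_fun_eq(3)[OF s] by (intro always_eventually allI)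
  qed simp
  then have "filterlim ?k (at_left s) sequentially"
    by (rule tendsto_imp_filterlim_at_left) (use step_fun_eq(2)[OF s] in \<open>auto intro!: always_eventually\<close>)
  then have "(\<lambda>m. n (?k m)) \<longlonglongrightarrow> left_limit n s"
    by (rule filterlim_compose[OF tendsto_left_limit[OF s(1)]])
  then have "(\<lambda>m. \<psi> (n (?k m))) \<longlonglongrightarrow> \<psi> (left_limit n s)"
    using cont by (intro continuous_on_tendsto_compose[OF cont]) auto
  then show ?thesis using True by (simp add: step_fun_eq(1)[OF s])
qed (simp add: step_fun_eq_0)

lemma step_fun_bounds: "0 \<le> step_fun T m s" "step_fun T m s \<le> indicator {0<..real T} s"
proof -
  show "0 \<le> step_fun T m s" unfolding step_fun_def by (intro sum_nonneg mult_nonneg_nonneg nonneg) auto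
  show "step_fun T m s \<le> indicator {0<..real T} s"
  proof (cases "s \<in> {0<..real T}")
    case True
    then have s: "0 < s" "s \<le> real T" by auto
    show ?thesis unfolding step_fun_eq(1)[OF s] using True by (simp add: weight_le_1)
  qed (simp add: step_fun_eq_0)
qed

lemma step_fun_measurable [measurable]: "step_fun T m \<in> borel_measurable borel"
  unfolding step_fun_def by measurable

lemma integral_step_fun:
  "(LINT s|interval_measure F. step_fun T m s) = grid_sum \<psi> n l (1 / 2 ^ m) (T * 2 ^ m)"
proof -
  have "(LINT s|interval_measure F. step_fun T m s) =
      (\<Sum>k<T * 2 ^ m. \<psi> (n (real k * (1 / 2 ^ m))) * measure (interval_measure F) {real k * (1 / 2 ^ m)<..real (Suc k) * (1 / 2 ^ m)})"
    unfolding step_fun_def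
    by (subst Bochner_Integration.integral_sum) (auto intro!: integrable_mult_right integrable_Ioc)
  also have "\<dots> = grid_sum \<psi> n l (1 / 2 ^ m) (T * 2 ^ m)"
    unfolding grid_sum_def
  proof (intro sum.cong refl)
    fix k
    have "real k * (1 / 2 ^ m) \<le> real (Suc k) * (1 / 2 ^ m)" by (intro mult_right_mono) auto
    then show "\<psi> (n (real k * (1 / 2 ^ m))) * measure (interval_measure F) {real k * (1 / 2 ^ m)<..real (Suc k) * (1 / 2 ^ m)} =
        \<psi> (n (real k * (1 / 2 ^ m))) * (l (real (Suc k) * (1 / 2 ^ m)) - l (real k * (1 / 2 ^ m)))"
      by (simp only: measure_Ioc) (simp add: max_def)
  qed
  finally show ?thesis .
qed

definition integrand :: "nat \<Rightarrow> real \<Rightarrow> real" where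
  "integrand T s = indicator {0<..real T} s * \<psi> (left_limit n s)"

text \<open>Measurability of the left-limit integrand is inherited from the approximating step
  functions.\<close>

lemma integrand_measurable [measurable]: "integrand T \<in> borel_measurable borel"
  by (rule borel_measurable_LIMSEQ_metric[of "step_fun T"]) (auto simp: integrand_def tendsto_step_fun)

lemma integrand_bounds: "0 \<le> integrand T s" "integrand T s \<le> indicator {0<..real T} s"
  unfolding integrand_def
  by (rule LIMSEQ_le_const[OF tendsto_step_fun], simp add: step_fun_bounds)
    (rule LIMSEQ_le_const2[OF tendsto_step_fun], intro exI allI impI step_fun_bounds)

lemma stieltjes_integral_eq:
  assumes "t \<le> real T"
  shows "stieltjes_integral \<psi> n l t = (LINT s|interval_measure F. indicator {0<..t} s * integrand T s)"
  unfolding stieltjes_integral_def set_lebesgue_integral_def integrand_def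
  using assms by (intro Bochner_Integration.integral_cong) (auto simp: indicator_def)

lemma integrable_integrand:
  "integrable (interval_measure F) (\<lambda>s. indicator {0<..t} s * integrand T s)"
proof (rule Bochner_Integration.integrable_bound[OF integrable_Ioc[of 0 "real T"]])
  have "norm (indicator {0<..t} s * integrand T s) \<le> norm (indicator {0<..real T} s :: real)" for s
    using integrand_bounds[of T s] by (cases "s \<in> {0<..t}") auto
  then show "AE s in interval_measure F. norm (indicator {0<..t} s * integrand T s) \<le> norm (indicator {0<..real T} s :: real)"
    by (rule AE_I2)
  have "(\<lambda>s. indicator {0<..t} s * integrand T s) \<in> borel_measurable borel" by measurable
  then show "(\<lambda>s. indicator {0<..t} s * integrand T s) \<in> borel_measurable (interval_measure F)"
    by (subst measurable_cong_sets[OF sets_interval_measure refl])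
qed

text \<open>Dominated convergence under the Stieltjes measure, with the indicator of (0,T] as
  integrable bound.\<close>

lemma tendsto_grid_sum:
  "(\<lambda>m. grid_sum \<psi> n l (1 / 2 ^ m) (T * 2 ^ m)) \<longlonglongrightarrow> stieltjes_integral \<psi> n l (real T)"
proof -
  have "(\<lambda>m. LINT s|interval_measure F. step_fun T m s) \<longlonglongrightarrow> (LINT s|interval_measure F. integrand T s)"
  proof (rule integral_dominated_convergence[OF _ _ integrable_Ioc])
    show "AE s in interval_measure F. (\<lambda>m. step_fun T m s) \<longlonglongrightarrow> integrand T s"
      unfolding integrand_def by (intro AE_I2 tendsto_step_fun)
    show "AE s in interval_measure F. norm (step_fun T m s) \<le> indicator {0<..real T} s" for m
      using step_fun_bounds by (intro AE_I2) auto
  qed auto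
  moreover have "(LINT s|interval_measure F. integrand T s) = stieltjes_integral \<psi> n l (real T)"
    unfolding stieltjes_integral_eq[OF order.refl]
    by (intro Bochner_Integration.integral_cong) (auto simp: integrand_def indicator_def)
  ultimately show ?thesis by (simp add: integral_step_fun)
qed

lemma stieltjes_integral_mono: "mono (stieltjes_integral \<psi> n l)"
proof (rule monoI)
  fix s t :: real assume st: "s \<le> t"
  obtain T :: nat where "t \<le> real T" using real_arch_simple by blast
  then have T: "s \<le> real T" "t \<le> real T" using st by auto
  have "indicator {0<..s} x * integrand T x \<le> indicator {0<..t} x * integrand T x" for x
    using st integrand_bounds(1)[of T x] by (intro mult_right_mono) (auto simp: indicator_def)
  then show "stieltjes_integral \<psi> n l s \<le> stieltjes_integral \<psi> n l t"
    unfolding T[THEN stieltjes_integral_eq] by (intro integral_mono integrable_integrand)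
qed

lemma stieltjes_integral_nonneg: "0 \<le> stieltjes_integral \<psi> n l t"
  unfolding stieltjes_integral_def set_lebesgue_integral_def
  by (rule Bochner_Integration.integral_nonneg) (intro scaleR_nonneg_nonneg nonneg indicator_pos_le)

text \<open>The weight decreases along the path, so every later summand carries at most the weight
  at the start J, and the increments of \<open>l\<close> telescope.\<close>

lemma grid_sum_diff_bounds:
  assumes "h \<ge> 0" "J \<le> K"
  shows "0 \<le> grid_sum \<psi> n l h K - grid_sum \<psi> n l h J"
    and "grid_sum \<psi> n l h K - grid_sum \<psi> n l h J \<le> \<psi> (n (real J * h)) * (l (real K * h) - l (real J * h))"
proof -
  have "0 \<le> grid_sum \<psi> n l h K - grid_sum \<psi> n l h J \<and>
    grid_sum \<psi> n l h K - grid_sum \<psi> n l h J \<le> \<psi> (n (real J * h)) * (l (real K * h) - l (real J * h))"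
    using assms(2)
  proof (induction K rule: dec_induct)
    case base
    show ?case by simp
  next
    case (step K)
    have le: "0 \<le> real J * h" "real J * h \<le> real K * h" "0 \<le> real K * h" "real K * h \<le> real (Suc K) * h"
      using assms step by (auto intro!: mult_right_mono)
    have d: "0 \<le> l (real (Suc K) * h) - l (real K * h)" using l_mono[OF le(3,4)] by simp
    have eq: "grid_sum \<psi> n l h (Suc K) = grid_sum \<psi> n l h K + \<psi> (n (real K * h)) * (l (real (Suc K) * h) - l (real K * h))"
      unfolding grid_sum_def by simp
    have 1: "0 \<le> grid_sum \<psi> n l h (Suc K) - grid_sum \<psi> n l h J"
      using step.IH mult_nonneg_nonneg[OF nonneg d, of "n (real K * h)"] unfolding eq by linarith
    have "\<psi> (n (real K * h)) * (l (real (Suc K) * h) - l (real K * h)) \<le> \<psi> (n (real J * h)) * (l (real (Suc K) * h) - l (real K * h))"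
      using weight_antimono[OF le(1,2)] d by (rule mult_right_mono)
    with step.IH have "grid_sum \<psi> n l h (Suc K) - grid_sum \<psi> n l h J \<le>
        \<psi> (n (real J * h)) * (l (real K * h) - l (real J * h)) + \<psi> (n (real J * h)) * (l (real (Suc K) * h) - l (real K * h))"
      unfolding eq by linarith
    also have "\<dots> = \<psi> (n (real J * h)) * (l (real (Suc K) * h) - l (real J * h))"
      by (simp only: distrib_left[symmetric]) simp
    finally show ?case using 1 by simp
  qed
  then show "0 \<le> grid_sum \<psi> n l h K - grid_sum \<psi> n l h J"
    "grid_sum \<psi> n l h K - grid_sum \<psi> n l h J \<le> \<psi> (n (real J * h)) * (l (real K * h) - l (real J * h))"
    by auto
qed

lemma stieltjes_integral_incr_le:
  "stieltjes_integral \<psi> n l (real (Suc T)) - stieltjes_integral \<psi> n l (real T) \<le> \<psi> (n T) * (l (Suc T) - l T)"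
proof (rule LIMSEQ_le_const2[OF tendsto_diff[OF tendsto_grid_sum tendsto_grid_sum]], intro exI allI impI)
  fix m :: nat
  have "grid_sum \<psi> n l (1 / 2 ^ m) (Suc T * 2 ^ m) - grid_sum \<psi> n l (1 / 2 ^ m) (T * 2 ^ m) \<le>
      \<psi> (n (real (T * 2 ^ m) * (1 / 2 ^ m))) * (l (real (Suc T * 2 ^ m) * (1 / 2 ^ m)) - l (real (T * 2 ^ m) * (1 / 2 ^ m)))"
    by (rule grid_sum_diff_bounds(2)) auto
  moreover have "real (i * 2 ^ m) * (1 / 2 ^ m) = real i" for i by simp
  ultimately show "grid_sum \<psi> n l (1 / 2 ^ m) (Suc T * 2 ^ m) - grid_sum \<psi> n l (1 / 2 ^ m) (T * 2 ^ m) \<le> \<psi> (n T) * (l (Suc T) - l T)"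
    by metis
qed

text \<open>The integral is monotone in t and bounded at integer times by the sum of the weighted
  unit increments; monotonicity turns the limit along integers into the limit along reals.\<close>

lemma stieltjes_integral_converges:
  assumes "summable (\<lambda>t::nat. \<psi> (n t) * (l (Suc t) - l t))"
  shows "(\<lambda>t::nat. stieltjes_integral \<psi> n l (real t)) \<longlonglongrightarrow> Lim at_top (stieltjes_integral \<psi> n l)"
    and "0 \<le> Lim at_top (stieltjes_integral \<psi> n l)"
proof -
  let ?X = "stieltjes_integral \<psi> n l"
  let ?d = "\<lambda>t::nat. \<psi> (n t) * (l (Suc t) - l t)"
  have d: "0 \<le> ?d t" for t using l_mono[of "real t" "real (Suc t)"] nonneg[of "n t"] by auto
  have le: "?X (real t) \<le> ?X 0 + (\<Sum>i<t. ?d i)" for t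
  proof (induction t)
    case (Suc t)
    then show ?case using stieltjes_integral_incr_le[of t] by simp
  qed simp
  have "(\<Sum>i<t. ?d i) \<le> suminf ?d" for t using sum_le_suminf[OF assms] d by auto
  then have bound: "?X (real t) \<le> ?X 0 + suminf ?d" for t using le[of t] by (meson add_left_mono order.trans)
  have inc: "incseq (\<lambda>t. ?X (real t))" using stieltjes_integral_mono by (auto simp: incseq_def mono_def)
  obtain y where y: "(\<lambda>t. ?X (real t)) \<longlonglongrightarrow> y" by (rule incseq_convergent[OF inc]) (use bound in auto)
  then have "(?X \<longlongrightarrow> y) at_top"
    by (rule tendsto_at_topI_sequentially_real[OF stieltjes_integral_mono])
  then have L: "Lim at_top ?X = y" by (intro tendsto_Lim) auto
  show "(\<lambda>t::nat. ?X (real t)) \<longlonglongrightarrow> Lim at_top ?X" using y L by simp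
  show "0 \<le> Lim at_top ?X" unfolding L
    by (rule LIMSEQ_le_const[OF y]) (use stieltjes_integral_nonneg in auto)
qed

end

text \<open>With the weight \<open>1\<^bsub>{0}\<^esub>\<close>, continuously extended from the integers to the reals, the integral stops
  collecting jumps of \<open>l\<close> at the first jump of \<open>n\<close>.\<close>

lemma stieltjes_integral_first_jump:
  assumes good: "good_path n l" and jump: "n s0 \<ge> 1" "s0 \<ge> 0"
  defines "\<psi> \<equiv> \<lambda>x::real. max 0 (1 - \<bar>x\<bar>)"
  shows "Lim at_top (stieltjes_integral \<psi> n l) = l (first_jump_time n)"
proof -
  interpret weighted_path n l \<psi> 0
  proof
    show "continuous_on UNIV \<psi>" unfolding \<psi>_def by (intro continuous_intros)
    show "\<psi> (real k) = 0 ^ k" for k by (cases k) (auto simp: \<psi>_def)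
  qed (auto simp: good \<psi>_def)
  \<comment> \<open>The infimum of the times with n >= 1 is later identified with the first jump
    time; right-continuity shows that it is attained.\<close>
  define A where "A = {t. 0 \<le> t \<and> n t \<ge> 1}"
  define T where "T = Inf A"
  have A: "A \<noteq> {}" "bdd_below A" using jump by (auto simp: A_def)
  have T0: "T \<ge> 0" unfolding T_def using A by (intro cInf_greatest) (auto simp: A_def)
  have cases: "n t = 0 \<or> n t \<ge> 1" if "t \<ge> 0" for t
    using n_Nats[OF that] by (auto simp: Nats_def)
  have before: "n t = 0" if "0 \<le> t" "t < T" for t
    using cases[OF that(1)] that cInf_lower[OF _ A(2), of t] unfolding T_def by (force simp: A_def)
  have after': "n t \<ge> 1" if "t > T" for t
  proof -
    obtain s where "s \<in> A" "s < t" using cInf_lessD[OF A(1)] \<open>t > T\<close> unfolding T_def by blast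
    then show ?thesis using n_mono[of s t] by (auto simp: A_def)
  qed
  have atT: "n T \<ge> 1"
  proof (rule tendsto_lowerbound[OF n_right[OF T0]])
    show "\<forall>\<^sub>F t in at_right T. 1 \<le> n t"
      using after' by (auto simp: eventually_at_right[of T "T + 1"] intro!: exI[of _ "T + 1"])
  qed simp
  then have Tpos: "T > 0" using T0 n0 by (cases "T = 0") auto
  \<comment> \<open>The endpoint s = T is included: the weight still sees 0 at T itself, so a
    simultaneous jump of \<open>l\<close> at T is counted.\<close>
  have left_before: "left_limit n s = 0" if "0 < s" "s \<le> T" for s
  proof -
    have "(n \<longlongrightarrow> 0) (at_left s)"
      by (rule tendsto_eventually)
        (use that before in \<open>auto simp: eventually_at_left[of 0 s] intro!: exI[of _ 0]\<close>)
    then show ?thesis unfolding left_limit_def by (intro tendsto_Lim) auto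
  qed
  have left_after: "left_limit n s \<ge> 1" if "s > T" for s
  proof (rule tendsto_lowerbound[OF tendsto_left_limit])
    show "\<forall>\<^sub>F t in at_left s. 1 \<le> n t"
      using that after' by (auto simp: eventually_at_left[of T s] intro!: exI[of _ T])
  qed (use that Tpos in auto)
  have "first_jump_time n = T"
    unfolding first_jump_time_def
  proof (rule cInf_eq_minimum)
    show "T \<in> {t. t > 0 \<and> n t \<noteq> left_limit n t}" using Tpos atT left_before[of T] by auto
    fix t assume "t \<in> {t. t > 0 \<and> n t \<noteq> left_limit n t}"
    then show "T \<le> t" using before[of t] left_before[of t] by (cases "t < T") auto
  qed
  moreover have "stieltjes_integral \<psi> n l t = l T" if "t \<ge> T" for t
  proof -
    have "stieltjes_integral \<psi> n l t = (LINT s|interval_measure F. indicator {0<..T} s)"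
      unfolding stieltjes_integral_def set_lebesgue_integral_def
    proof (intro Bochner_Integration.integral_cong refl)
      fix s
      show "indicator {0<..t} s *\<^sub>R \<psi> (left_limit n s) = indicator {0<..T} s"
        using that left_before[of s] left_after[of s] by (cases "s \<le> T") (auto simp: \<psi>_def indicator_def)
    qed
    also have "\<dots> = l T" using measure_Ioc[of 0 T] Tpos l0 by simp
    finally show ?thesis .
  qed
  then have "(stieltjes_integral \<psi> n l \<longlongrightarrow> l T) at_top"
    by (intro tendsto_eventually) (auto simp: eventually_at_top_linorder)
  then have "Lim at_top (stieltjes_integral \<psi> n l) = l T" by (intro tendsto_Lim) auto
  ultimately show ?thesis by simp
qed

section \<open>The compound Poisson process\<close>

text \<open>The library defines Poisson distributions only for positive rates.\<close>

definition poisson_law :: "real \<Rightarrow> real measure" where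
  "poisson_law r = distr (measure_pmf (if r = 0 then return_pmf 0 else poisson_pmf r)) borel real"

context
  fixes r :: real
  assumes r: "r \<ge> 0"
begin

private definition "P = (if r = 0 then return_pmf 0 else poisson_pmf r)"

text \<open>The convention 0^0 = 1 makes the Poisson formula valid for rate 0 as well.\<close>

private lemma pmf_P: "pmf P k = r ^ k / fact k * exp (- r)"
  using r by (cases k) (auto simp: P_def pmf_poisson)

private lemma poisson_law_P: "poisson_law r = distr (measure_pmf P) borel real"
  by (simp add: poisson_law_def P_def)

lemma real_distribution_poisson_law: "real_distribution (poisson_law r)"
  unfolding poisson_law_P by (intro real_distribution_distr measure_pmf.prob_space_axioms) simp

lemma AE_poisson_law_Nats: "AE x in poisson_law r. x \<in> \<nat>"
  unfolding poisson_law_P by (subst AE_distr_iff) (auto simp: borel_closed)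

text \<open>The probability generating function on the closed unit disc: points of the unit circle
  yield the characteristic function, the point b the mean weight.\<close>

private lemma integral_P_power:
  fixes x :: complex
  assumes "norm x \<le> 1"
  shows "(CLINT k|measure_pmf P. x ^ k) = exp (of_real r * (x - 1))"
proof -
  have s: "(\<lambda>k. pmf P k *\<^sub>R x ^ k) sums (of_real (exp (- r)) * exp (of_real r * x))"
  proof -
    have "(\<lambda>k. of_real (exp (- r)) * ((of_real r * x) ^ k /\<^sub>R fact k)) sums (of_real (exp (- r)) * exp (of_real r * x))"
      by (intro sums_mult exp_converges)
    then show ?thesis
      by (simp add: pmf_P scaleR_conv_of_real power_mult_distrib divide_inverse mult_ac)
  qed
  have "(CLINT k|measure_pmf P. x ^ k) = (CLINT k|count_space UNIV. pmf P k *\<^sub>R x ^ k)"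
    unfolding measure_pmf_eq_density by (subst integral_density) auto
  also have "\<dots> = (\<Sum>k. pmf P k *\<^sub>R x ^ k)"
  proof (rule integral_count_space_nat)
    have "integrable (count_space UNIV) (pmf P)" by (rule integrable_pmf)
    then show "integrable (count_space UNIV) (\<lambda>k. pmf P k *\<^sub>R x ^ k)"
      by (rule Bochner_Integration.integrable_bound)
        (auto simp: norm_power intro!: AE_I2 mult_left_le power_le_one assms)
  qed
  also have "\<dots> = of_real (exp (- r)) * exp (of_real r * x)" using s by (simp add: sums_iff)
  also have "\<dots> = exp (of_real r * (x - 1))"
    by (simp add: exp_of_real[symmetric] right_diff_distrib exp_diff exp_minus divide_inverse mult.commute)
  finally show ?thesis .
qed

lemma char_poisson_law: "char (poisson_law r) z = exp (of_real r * (iexp z - 1))"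
proof -
  have "iexp (z * real k) = iexp z ^ k" for k
    by (simp add: exp_of_nat_mult[symmetric] mult_ac)
  then have "char (poisson_law r) z = (CLINT k|measure_pmf P. iexp z ^ k)"
    unfolding char_def poisson_law_P by (subst integral_distr) auto
  then show ?thesis by (simp add: integral_P_power)
qed

lemma integral_poisson_law_weight:
  fixes \<psi> :: "real \<Rightarrow> real" and b :: real
  assumes [measurable]: "\<psi> \<in> borel_measurable borel" and weight: "\<And>k. \<psi> (real k) = b ^ k" and b: "0 \<le> b" "b \<le> 1"
  shows "(LINT x|poisson_law r. \<psi> x) = exp (- (r * (1 - b)))"
proof -
  have "complex_of_real (LINT x|poisson_law r. \<psi> x) = of_real (LINT k|measure_pmf P. b ^ k)"
    unfolding poisson_law_P by (subst integral_distr) (auto simp: weight)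
  also have "\<dots> = (CLINT k|measure_pmf P. of_real b ^ k)"
    by (subst integral_complex_of_real[symmetric]) simp
  also have "\<dots> = exp (of_real r * (of_real b - 1))" using b by (intro integral_P_power) simp
  also have "\<dots> = of_real (exp (- (r * (1 - b))))"
    by (simp add: algebra_simps flip: exp_of_real)
  finally show ?thesis by (simp only: of_real_eq_iff)
qed

text \<open>The quadratic bound makes two or more jumps of N in one grid cell negligible after
  summation over the cells of a unit interval. It follows from e^(-r) >= 1 - r.\<close>

lemma measure_poisson_law_ge_2: "measure (poisson_law r) {2..} \<le> r\<^sup>2"
proof -
  have "measure (poisson_law r) {2..} = measure (measure_pmf P) (- {0, 1})"
  proof -
    have "real -` {2..} = - {0, 1}"
      by (auto simp: not_less_eq_eq numeral_2_eq_2)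
    then show ?thesis unfolding poisson_law_P by (subst measure_distr) auto
  qed
  also have "\<dots> = 1 - (pmf P 0 + pmf P 1)"
  proof -
    have "measure (measure_pmf P) (- {0, 1}) = 1 - measure (measure_pmf P) {0, 1}"
      using measure_pmf.prob_compl[of "{0, 1}" P] by (simp add: Compl_eq_Diff_UNIV)
    also have "measure (measure_pmf P) {0, 1} = pmf P 0 + pmf P 1"
      by (subst measure_measure_pmf_finite) auto
    finally show ?thesis .
  qed
  also have "\<dots> = 1 - (1 + r) * exp (- r)" by (simp add: pmf_P algebra_simps)
  also have "\<dots> \<le> 1 - (1 + r) * (1 - r)"
    using r exp_ge_add_one_self[of "- r"] by (intro diff_left_mono mult_left_mono) auto
  also have "\<dots> = r\<^sup>2" by (simp add: algebra_simps power2_eq_square)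
  finally show ?thesis .
qed

lemma nn_integral_poisson_law: "(\<integral>\<^sup>+x. ennreal \<bar>x\<bar> \<partial>poisson_law r) < \<infinity>"
proof -
  have "(\<integral>\<^sup>+x. ennreal \<bar>x\<bar> \<partial>poisson_law r) = (\<integral>\<^sup>+k. ennreal (pmf P k * real k) \<partial>count_space UNIV)"
    unfolding poisson_law_P by (subst nn_integral_distr) (auto simp: nn_integral_measure_pmf ennreal_mult)
  also have "\<dots> = (\<Sum>k. ennreal (pmf P k * real k))" by (rule nn_integral_count_space_nat)
  also have "\<dots> = ennreal (\<Sum>k. pmf P k * real k)"
  proof (rule suminf_ennreal2)
    have "summable (\<lambda>k. pmf P (Suc k) * real (Suc k))"
    proof -
      have "summable (\<lambda>k. exp (- r) * r * (r ^ k /\<^sub>R fact k))"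
        by (intro summable_mult summable_exp_generic)
      then show ?thesis by (simp add: pmf_P divide_inverse mult_ac)
    qed
    then show "summable (\<lambda>k. pmf P k * real k)"
      using summable_Suc_iff[of "\<lambda>k. pmf P k * real k"] by simp
  qed simp
  finally show ?thesis by simp
qed

end

text \<open>With rates h v and h w this is the law of L at time h: unit jumps at rate v plus
  independent jumps of size a at rate w.\<close>

definition jump_law :: "real \<Rightarrow> real \<Rightarrow> real \<Rightarrow> real measure" where
  "jump_law r s a = (poisson_law r \<star> distr (poisson_law s) borel ((*) a))"

context
  fixes r s a :: real
  assumes r: "r \<ge> 0" and s: "s \<ge> 0" and a: "a \<ge> 0"
begin

interpretation R: real_distribution "poisson_law r" by (rule real_distribution_poisson_law[OF r])
interpretation S: real_distribution "poisson_law s" by (rule real_distribution_poisson_law[OF s])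

private lemma scaled: "real_distribution (distr (poisson_law s) borel ((*) a))"
  by (intro real_distribution_distr S.prob_space_axioms) simp

interpretation A: real_distribution "distr (poisson_law s) borel ((*) a)" by (rule scaled)

lemma real_distribution_jump_law: "real_distribution (jump_law r s a)"
  unfolding jump_law_def by (intro real_distribution_convolution R.real_distribution_axioms scaled)

lemma char_jump_law: "char (jump_law r s a) z = exp (of_real r * (iexp z - 1) + of_real s * (iexp (a * z) - 1))"
proof -
  have "char (distr (poisson_law s) borel ((*) a)) z = char (poisson_law s) (a * z)"
    unfolding char_def by (subst integral_distr) (auto simp: mult_ac)
  then show ?thesis
    unfolding jump_law_def
    by (subst char_convolution[OF R.real_distribution_axioms scaled])
      (simp add: char_poisson_law[OF r] char_poisson_law[OF s] exp_add)
qed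

private lemma nn_integral_jump_law:
  assumes [measurable]: "f \<in> borel_measurable borel"
  shows "(\<integral>\<^sup>+x. f x \<partial>jump_law r s a) = (\<integral>\<^sup>+x. \<integral>\<^sup>+y. f (x + a * y) \<partial>poisson_law s \<partial>poisson_law r)"
proof -
  have "(\<integral>\<^sup>+x. f x \<partial>jump_law r s a) = (\<integral>\<^sup>+x. \<integral>\<^sup>+y. f (x + y) \<partial>distr (poisson_law s) borel ((*) a) \<partial>poisson_law r)"
    unfolding jump_law_def
    by (rule nn_integral_convolution) (auto intro: R.finite_measure_axioms A.finite_measure_axioms)
  also have "\<dots> = (\<integral>\<^sup>+x. \<integral>\<^sup>+y. f (x + a * y) \<partial>poisson_law s \<partial>poisson_law r)"
    by (intro nn_integral_cong) (subst nn_integral_distr; simp)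
  finally show ?thesis .
qed

lemma AE_jump_law_nonneg: "AE x in jump_law r s a. x \<ge> 0"
proof -
  have "(\<integral>\<^sup>+x. indicator {..<0} x \<partial>jump_law r s a) = (\<integral>\<^sup>+x. 0 \<partial>poisson_law r)"
  proof (subst nn_integral_jump_law, simp, rule nn_integral_cong_AE)
    show "AE x in poisson_law r. (\<integral>\<^sup>+y. indicator {..<0} (x + a * y) \<partial>poisson_law s) = 0"
      using AE_poisson_law_Nats[OF r]
    proof eventually_elim
      case (elim x)
      have "(\<integral>\<^sup>+y. indicator {..<0} (x + a * y) \<partial>poisson_law s) = (\<integral>\<^sup>+y. 0 \<partial>poisson_law s)"
      proof (rule nn_integral_cong_AE)
        show "AE y in poisson_law s. indicator {..<0} (x + a * y) = (0 :: ennreal)"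
          using AE_poisson_law_Nats[OF s]
        proof eventually_elim
          case (elim y)
          then have "x + a * y \<ge> 0" using \<open>x \<in> \<nat>\<close> a by (auto simp: Nats_def)
          then show ?case by simp
        qed
      qed
      then show ?case by simp
    qed
  qed
  then have "emeasure (jump_law r s a) {..<0} = 0"
    by (simp add: jump_law_def)
  moreover have "{x \<in> space (jump_law r s a). \<not> x \<ge> 0} = {..<0}"
    by (auto simp: jump_law_def not_le)
  ultimately show ?thesis
    using AE_iff_measurable[of "{..<0}" "jump_law r s a" "\<lambda>x. x \<ge> 0"] by (simp add: jump_law_def)
qed

lemma integrable_jump_law: "integrable (jump_law r s a) (\<lambda>x. x)"
proof (rule integrableI_bounded)
  have "(\<integral>\<^sup>+x. ennreal (norm x) \<partial>jump_law r s a) = (\<integral>\<^sup>+x. \<integral>\<^sup>+y. ennreal \<bar>x + a * y\<bar> \<partial>poisson_law s \<partial>poisson_law r)"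
    by (subst nn_integral_jump_law) auto
  also have "\<dots> \<le> (\<integral>\<^sup>+x. \<integral>\<^sup>+y. ennreal \<bar>x\<bar> + ennreal a * ennreal \<bar>y\<bar> \<partial>poisson_law s \<partial>poisson_law r)"
  proof (intro nn_integral_mono)
    fix x y
    have "\<bar>x + a * y\<bar> \<le> \<bar>x\<bar> + a * \<bar>y\<bar>" using a abs_triangle_ineq[of x "a * y"] by (simp add: abs_mult)
    then have "ennreal \<bar>x + a * y\<bar> \<le> ennreal (\<bar>x\<bar> + a * \<bar>y\<bar>)" by (rule ennreal_leI)
    also have "\<dots> = ennreal \<bar>x\<bar> + ennreal a * ennreal \<bar>y\<bar>" using a by (simp add: ennreal_plus ennreal_mult)
    finally show "ennreal \<bar>x + a * y\<bar> \<le> ennreal \<bar>x\<bar> + ennreal a * ennreal \<bar>y\<bar>" .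
  qed
  also have "\<dots> = (\<integral>\<^sup>+x. ennreal \<bar>x\<bar> + ennreal a * (\<integral>\<^sup>+y. ennreal \<bar>y\<bar> \<partial>poisson_law s) \<partial>poisson_law r)"
    using S.emeasure_space_1 by (intro nn_integral_cong) (subst nn_integral_add; simp add: nn_integral_cmult)
  also have "\<dots> = (\<integral>\<^sup>+x. ennreal \<bar>x\<bar> \<partial>poisson_law r) + ennreal a * (\<integral>\<^sup>+y. ennreal \<bar>y\<bar> \<partial>poisson_law s)"
    using R.emeasure_space_1 by (subst nn_integral_add) simp_all
  also have "\<dots> < \<infinity>"
    using nn_integral_poisson_law[OF r] nn_integral_poisson_law[OF s] by (simp add: ennreal_mult_less_top)
  finally show "(\<integral>\<^sup>+x. ennreal (norm x) \<partial>jump_law r s a) < \<infinity>" .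
qed (simp add: jump_law_def)

end

text \<open>The exponent is the integral against \<open>jump_measure\<close> evaluated at its three
  atoms. The positive rate u + w of N is the source of the exponential decay of the weights.\<close>

locale cpp = prob_space M for M :: "'a measure" +
  fixes N L :: "real \<Rightarrow> 'a \<Rightarrow> real" and u v w a :: real
  assumes levy: "levy_process M (\<lambda>t \<omega>. (N t \<omega>, L t \<omega>))"
    and char_cpp: "\<And>t z1 z2. t \<ge> 0 \<Longrightarrow> (CLINT \<omega>|M. iexp (z1 * N t \<omega> + z2 * L t \<omega>)) =
      exp (of_real t * (u * (iexp z1 - 1) + v * (iexp z2 - 1) + w * (iexp (z1 + a * z2) - 1)))"
    and uvw: "u \<ge> 0" "v \<ge> 0" "w \<ge> 0" and rate: "u + w > 0" and a: "a > 0"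
begin

lemma NL_measurable:
  assumes "t \<ge> 0"
  shows "N t \<in> borel_measurable M" "L t \<in> borel_measurable M"
proof -
  have *: "(\<lambda>\<omega>. (N t \<omega>, L t \<omega>)) \<in> measurable M (borel \<Otimes>\<^sub>M borel)"
    using levy assms unfolding levy_process_def borel_prod by blast
  show "N t \<in> borel_measurable M" using measurable_compose[OF * measurable_fst] by simp
  show "L t \<in> borel_measurable M" using measurable_compose[OF * measurable_snd] by simp
qed

lemma distr_increment:
  assumes "s \<ge> 0" "h \<ge> 0"
  shows "distr M borel (\<lambda>\<omega>. (N (s + h) \<omega> - N s \<omega>, L (s + h) \<omega> - L s \<omega>)) = distr M borel (\<lambda>\<omega>. (N h \<omega>, L h \<omega>))"
  using levy assms unfolding levy_process_def by simp

lemma distr_N: assumes "h \<ge> 0" shows "distr M borel (N h) = poisson_law (h * (u + w))"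
proof (rule Levy_uniqueness)
  have [measurable]: "N h \<in> borel_measurable M" using NL_measurable assms by simp
  show "real_distribution (distr M borel (N h))"
    by (intro real_distribution_distr prob_space_axioms) simp
  show "real_distribution (poisson_law (h * (u + w)))"
    using assms rate by (intro real_distribution_poisson_law) simp
  show "char (distr M borel (N h)) = char (poisson_law (h * (u + w)))"
  proof
    fix z
    have "char (distr M borel (N h)) z = (CLINT \<omega>|M. iexp (z * N h \<omega> + 0 * L h \<omega>))"
      unfolding char_def by (subst integral_distr) auto
    also have "\<dots> = char (poisson_law (h * (u + w))) z"
    proof -
      have "h * (u + w) \<ge> 0" using assms rate by simp
      then show ?thesis
        using assms by (subst char_cpp, simp, subst char_poisson_law) (simp_all add: algebra_simps)
    qed
    finally show "char (distr M borel (N h)) z = char (poisson_law (h * (u + w))) z" .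
  qed
qed

lemma distr_L: assumes "h \<ge> 0" shows "distr M borel (L h) = jump_law (h * v) (h * w) a"
proof (rule Levy_uniqueness)
  have [measurable]: "L h \<in> borel_measurable M" using NL_measurable assms by simp
  show "real_distribution (distr M borel (L h))"
    by (intro real_distribution_distr prob_space_axioms) simp
  show "real_distribution (jump_law (h * v) (h * w) a)"
    using assms uvw a by (intro real_distribution_jump_law) auto
  show "char (distr M borel (L h)) = char (jump_law (h * v) (h * w) a)"
  proof
    fix z
    have "char (distr M borel (L h)) z = (CLINT \<omega>|M. iexp (0 * N h \<omega> + z * L h \<omega>))"
      unfolding char_def by (subst integral_distr) auto
    also have "\<dots> = char (jump_law (h * v) (h * w) a) z"
      using assms uvw a by (subst char_cpp) (auto simp: char_jump_law algebra_simps)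
    finally show "char (distr M borel (L h)) z = char (jump_law (h * v) (h * w) a) z" .
  qed
qed

lemma distr_N_increment: assumes "s \<ge> 0" "h \<ge> 0" shows "distr M borel (\<lambda>\<omega>. N (s + h) \<omega> - N s \<omega>) = distr M borel (N h)"
  and distr_L_increment: "distr M borel (\<lambda>\<omega>. L (s + h) \<omega> - L s \<omega>) = distr M borel (L h)"
proof -
  have [measurable]: "N (s + h) \<in> borel_measurable M" "N s \<in> borel_measurable M" "L (s + h) \<in> borel_measurable M"
    "L s \<in> borel_measurable M" "N h \<in> borel_measurable M" "L h \<in> borel_measurable M"
    using NL_measurable assms by auto
  have fs [measurable]: "fst \<in> borel_measurable (borel :: (real \<times> real) measure)" "snd \<in> borel_measurable (borel :: (real \<times> real) measure)"
    by (auto simp flip: borel_prod)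
  have m: "(\<lambda>\<omega>. (N (s + h) \<omega> - N s \<omega>, L (s + h) \<omega> - L s \<omega>)) \<in> borel_measurable M" "(\<lambda>\<omega>. (N h \<omega>, L h \<omega>)) \<in> borel_measurable M"
    by (auto intro!: borel_measurable_Pair)
  have "distr (distr M borel (\<lambda>\<omega>. (N (s + h) \<omega> - N s \<omega>, L (s + h) \<omega> - L s \<omega>))) borel f =
      distr (distr M borel (\<lambda>\<omega>. (N h \<omega>, L h \<omega>))) borel f" for f :: "real \<times> real \<Rightarrow> real"
    unfolding distr_increment[OF assms] ..
  from this[of fst] this[of snd]
  show "distr M borel (\<lambda>\<omega>. N (s + h) \<omega> - N s \<omega>) = distr M borel (N h)"
    "distr M borel (\<lambda>\<omega>. L (s + h) \<omega> - L s \<omega>) = distr M borel (L h)"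
    by (simp_all add: distr_distr m comp_def)
qed

lemma AE_increment:
  assumes "s \<ge> 0" "h \<ge> 0"
  shows "AE \<omega> in M. N (s + h) \<omega> - N s \<omega> \<in> \<nat> \<and> L s \<omega> \<le> L (s + h) \<omega>"
proof -
  have [measurable]: "N (s + h) \<in> borel_measurable M" "N s \<in> borel_measurable M" "L (s + h) \<in> borel_measurable M"
    "L s \<in> borel_measurable M" using NL_measurable assms by auto
  have "AE x in distr M borel (\<lambda>\<omega>. N (s + h) \<omega> - N s \<omega>). x \<in> \<nat>"
    unfolding distr_N_increment[OF assms] distr_N[OF assms(2)] using assms rate by (intro AE_poisson_law_Nats) auto
  then have "AE \<omega> in M. N (s + h) \<omega> - N s \<omega> \<in> \<nat>"
    by (subst (asm) AE_distr_iff) (auto simp: borel_closed)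
  moreover have "AE x in distr M borel (\<lambda>\<omega>. L (s + h) \<omega> - L s \<omega>). x \<ge> 0"
    unfolding distr_L_increment[OF assms] distr_L[OF assms(2)] using assms uvw a by (intro AE_jump_law_nonneg) auto
  then have "AE \<omega> in M. L (s + h) \<omega> - L s \<omega> \<ge> 0"
    by (subst (asm) AE_distr_iff) auto
  ultimately show ?thesis by eventually_elim auto
qed

text \<open>Null sets can be collected only over countably many pairs of times. The properties are
  therefore secured at rational times and extended by right-continuity, using that the naturals and
  the relation <= are closed.\<close>

lemma AE_good_path: "AE \<omega> in M. good_path (\<lambda>t. N t \<omega>) (\<lambda>t. L t \<omega>)"
proof -
  have "AE \<omega> in M. 0 \<le> real_of_rat p \<longrightarrow> real_of_rat p \<le> real_of_rat q \<longrightarrow>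
      N (real_of_rat q) \<omega> - N (real_of_rat p) \<omega> \<in> \<nat> \<and> L (real_of_rat p) \<omega> \<le> L (real_of_rat q) \<omega>" for p q
    using AE_increment[of "real_of_rat p" "real_of_rat q - real_of_rat p"]
    by (cases "0 \<le> real_of_rat p \<and> real_of_rat p \<le> real_of_rat q") auto
  then have "AE \<omega> in M. \<forall>p q. 0 \<le> real_of_rat p \<longrightarrow> real_of_rat p \<le> real_of_rat q \<longrightarrow>
      N (real_of_rat q) \<omega> - N (real_of_rat p) \<omega> \<in> \<nat> \<and> L (real_of_rat p) \<omega> \<le> L (real_of_rat q) \<omega>"
    by (simp add: AE_all_countable)
  moreover have "AE \<omega> in M. (N 0 \<omega>, L 0 \<omega>) = 0" "AE \<omega> in M. cadlag (\<lambda>t. (N t \<omega>, L t \<omega>))"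
    using levy unfolding levy_process_def by auto
  ultimately show ?thesis
  proof eventually_elim
    case (elim \<omega>)
    define n l where "n t = N t \<omega>" and "l t = L t \<omega>" for t
    have rat: "n (real_of_rat q) - n (real_of_rat p) \<in> \<nat>" "l (real_of_rat p) \<le> l (real_of_rat q)"
      if "0 \<le> real_of_rat p" "real_of_rat p \<le> real_of_rat q" for p q
      using elim(1) that by (auto simp: n_def l_def)
    have right: "(n \<longlongrightarrow> n t) (at_right t)" "(l \<longlongrightarrow> l t) (at_right t)" if "t \<ge> 0" for t
    proof -
      have "((\<lambda>t. (n t, l t)) \<longlongrightarrow> (n t, l t)) (at_right t)"
        using elim(3) that by (simp add: cadlag_def n_def l_def)
      from tendsto_fst[OF this] tendsto_snd[OF this]
      show "(n \<longlongrightarrow> n t) (at_right t)" "(l \<longlongrightarrow> l t) (at_right t)" by simp_all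
    qed
    have left: "\<exists>x. (n \<longlongrightarrow> x) (at_left t)" if "t > 0" for t
    proof -
      from elim(3) have "\<forall>t>0. \<exists>x. ((\<lambda>t. (n t, l t)) \<longlongrightarrow> x) (at_left t)"
        unfolding cadlag_def n_def l_def by (rule conjunct2)
      from this[rule_format, OF that] obtain x where "((\<lambda>t. (n t, l t)) \<longlongrightarrow> x) (at_left t)" ..
      from tendsto_fst[OF this] show ?thesis by auto
    qed
    have incr: "n t - n s \<in> \<nat> \<and> l s \<le> l t" if st: "0 \<le> s" "s < t" for s t
    proof -
      have "\<exists>q. s' < real_of_rat q \<and> real_of_rat q < min e (s' + 1 / Suc i)" if "s' < e" for s' e :: real and i :: nat
        by (rule of_rat_dense) (use that in auto)
      then obtain f where f: "\<And>s' e i. s' < e \<Longrightarrow> s' < real_of_rat (f s' e i) \<and> real_of_rat (f s' e i) < min e (s' + 1 / Suc i)"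
        by metis
      \<comment> \<open>Rational times tending to s and t from the right; p i stays below t and q i
        lies above it, so the pair is ordered.\<close>
      define p q where "p i = real_of_rat (f s t i)" and "q i = real_of_rat (f t (t + 1) i)" for i
      have lim: "filterlim (\<lambda>i. real_of_rat (f s' e i)) (at_right s') sequentially" if "s' < e" for s' e
      proof (rule tendsto_imp_filterlim_at_right)
        show "(\<lambda>i. real_of_rat (f s' e i)) \<longlonglongrightarrow> s'"
        proof (rule tendsto_sandwich[where f = "\<lambda>_. s'" and h = "\<lambda>i. s' + 1 / real (Suc i)"])
          have "(\<lambda>i. s' + inverse (real (Suc i))) \<longlonglongrightarrow> s' + 0"
            by (intro tendsto_add tendsto_const LIMSEQ_inverse_real_of_nat)
          then show "(\<lambda>i. s' + 1 / real (Suc i)) \<longlonglongrightarrow> s'" by (simp add: inverse_eq_divide)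
          show "\<forall>\<^sub>F i in sequentially. s' \<le> real_of_rat (f s' e i)"
            using f[OF that] by (intro always_eventually) (auto intro: less_imp_le)
          show "\<forall>\<^sub>F i in sequentially. real_of_rat (f s' e i) \<le> s' + 1 / real (Suc i)"
            using f[OF that] by (intro always_eventually) (auto intro: less_imp_le)
        qed simp
        show "\<forall>\<^sub>F i in sequentially. s' < real_of_rat (f s' e i)"
          using f[OF that] by (intro always_eventually) auto
      qed
      have pq: "0 \<le> p i" "p i \<le> q i" for i
      proof -
        have "s < p i" "p i < t" "t < q i"
          using f[OF st(2), of i] f[of t "t + 1" i] unfolding p_def q_def by auto
        then show "0 \<le> p i" "p i \<le> q i" using st by linarith+
      qed
      have p: "filterlim p (at_right s) sequentially" and q: "filterlim q (at_right t) sequentially"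
        using lim[OF st(2)] lim[of t "t + 1"] unfolding p_def q_def by auto
      have np: "(\<lambda>i. n (p i)) \<longlonglongrightarrow> n s" and lp: "(\<lambda>i. l (p i)) \<longlonglongrightarrow> l s"
        using right[of s] st p by (auto intro: filterlim_compose)
      have nq: "(\<lambda>i. n (q i)) \<longlonglongrightarrow> n t" and lq: "(\<lambda>i. l (q i)) \<longlonglongrightarrow> l t"
        using right[of t] st q by (auto intro: filterlim_compose)
      have "n (q i) - n (p i) \<in> \<nat>" "l (p i) \<le> l (q i)" for i
        using rat pq[of i] unfolding p_def q_def by blast+
      then show ?thesis
        using closed_sequentially[OF closed_Nats _ tendsto_diff[OF nq np]] LIMSEQ_le[OF lp lq] by auto
    qed
    have "good_path n l"
      unfolding good_path_def
    proof (intro conjI allI impI)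
      fix s t :: real assume "0 \<le> s" "s \<le> t"
      then show "n t - n s \<in> \<nat>" "l s \<le> l t" using incr[of s t] by (cases "s = t"; auto)+
    qed (use elim(2) right left in \<open>auto simp: n_def l_def zero_prod_def\<close>)
    then show ?case by (simp add: n_def[abs_def] l_def[abs_def])
  qed
qed

end

section \<open>Characteristic functions of the Riemann sums\<close>

text \<open>Fubini without product spaces in the statement: \<open>X\<close> is frozen and
  \<open>Y\<close> is averaged over a second sample point.\<close>

lemma (in prob_space) indep_var_integral:
  fixes f :: "'b \<times> 'b \<Rightarrow> complex"
  assumes indep: "indep_var S X T Y" and [measurable]: "f \<in> borel_measurable (S \<Otimes>\<^sub>M T)"
    and bound: "\<And>x. norm (f x) \<le> B"
  shows "(CLINT \<omega>|M. f (X \<omega>, Y \<omega>)) = (CLINT \<omega>|M. CLINT \<omega>'|M. f (X \<omega>, Y \<omega>'))"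
proof -
  have [measurable]: "X \<in> measurable M S" "Y \<in> measurable M T"
    using indep by (auto dest: indep_var_rv1 indep_var_rv2)
  interpret X: prob_space "distr M S X" by (rule prob_space_distr) simp
  interpret Y: prob_space "distr M T Y" by (rule prob_space_distr) simp
  interpret XY: pair_prob_space "distr M S X" "distr M T Y" ..
  have "(CLINT \<omega>|M. f (X \<omega>, Y \<omega>)) = (CLINT z|distr M (S \<Otimes>\<^sub>M T) (\<lambda>\<omega>. (X \<omega>, Y \<omega>)). f z)"
    by (subst integral_distr) auto
  also have "distr M (S \<Otimes>\<^sub>M T) (\<lambda>\<omega>. (X \<omega>, Y \<omega>)) = distr M S X \<Otimes>\<^sub>M distr M T Y"
    using indep unfolding indep_var_distribution_eq by simp
  also have "(CLINT z|distr M S X \<Otimes>\<^sub>M distr M T Y. f z) = (CLINT x|distr M S X. CLINT y|distr M T Y. f (x, y))"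
    by (intro XY.integral_fst'[symmetric] XY.P.integrable_const_bound[where B = B]) (auto simp: bound)
  also have "\<dots> = (CLINT \<omega>|M. CLINT y|distr M T Y. f (X \<omega>, y))"
    by (rule integral_distr) (auto intro!: Y.borel_measurable_lebesgue_integral)
  also have "\<dots> = (CLINT \<omega>|M. CLINT \<omega>'|M. f (X \<omega>, Y \<omega>'))"
  proof (intro Bochner_Integration.integral_cong refl)
    fix \<omega> assume "\<omega> \<in> space M"
    then have [measurable]: "X \<omega> \<in> space S" by (rule measurable_space[rotated]) simp
    show "(CLINT y|distr M T Y. f (X \<omega>, y)) = (CLINT \<omega>'|M. f (X \<omega>, Y \<omega>'))"
      by (rule integral_distr) measurable
  qed
  finally show ?thesis .
qed

locale weighted_cpp = cpp +
  fixes \<psi> :: "real \<Rightarrow> real" and b :: real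
  assumes cont: "continuous_on UNIV \<psi>" and nonneg: "\<And>x. 0 \<le> \<psi> x"
    and weight: "\<And>k. \<psi> (real k) = b ^ k" and b: "0 \<le> b" "b < 1"
begin

lemma psi_measurable [measurable]: "\<psi> \<in> borel_measurable borel"
  by (rule borel_measurable_continuous_onI[OF cont])

lemma psi_0: "\<psi> 0 = 1" using weight[of 0] by simp

lemma psi_add: "x \<in> \<nat> \<Longrightarrow> y \<in> \<nat> \<Longrightarrow> \<psi> (x + y) = \<psi> x * \<psi> y"
  using weight by (auto simp: Nats_def power_add simp flip: of_nat_add)

definition incr :: "real \<Rightarrow> nat \<Rightarrow> 'a \<Rightarrow> real \<times> real" where
  "incr h k \<omega> = (N (real (Suc k) * h) \<omega> - N (real k * h) \<omega>, L (real (Suc k) * h) \<omega> - L (real k * h) \<omega>)"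

text \<open>Counts are rebuilt from increments, although the sum telescopes on paths starting at 0.
  This makes the Riemann sum a function of the independent increments at every sample point.\<close>

definition count_sum :: "real \<Rightarrow> nat \<Rightarrow> 'a \<Rightarrow> real" where
  "count_sum h K \<omega> = (\<Sum>k<K. fst (incr h k \<omega>))"

definition weighted_sum :: "real \<Rightarrow> nat \<Rightarrow> 'a \<Rightarrow> real" where
  "weighted_sum h K \<omega> = (\<Sum>k<K. \<psi> (count_sum h k \<omega>) * snd (incr h k \<omega>))"

lemma fst_snd_measurable [measurable]:
  "fst \<in> borel_measurable (borel :: (real \<times> real) measure)"
  "snd \<in> borel_measurable (borel :: (real \<times> real) measure)"
  by (auto simp flip: borel_prod)

lemma incr_measurable: "h \<ge> 0 \<Longrightarrow> incr h k \<in> borel_measurable M"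
proof -
  assume "h \<ge> 0"
  then have [measurable]: "N (real (Suc k) * h) \<in> borel_measurable M" "N (real k * h) \<in> borel_measurable M"
    "L (real (Suc k) * h) \<in> borel_measurable M" "L (real k * h) \<in> borel_measurable M"
    by (auto intro!: NL_measurable mult_nonneg_nonneg)
  show ?thesis unfolding incr_def by (intro borel_measurable_Pair borel_measurable_diff) measurable
qed

lemma sums_measurable:
  assumes "h \<ge> 0"
  shows "count_sum h K \<in> borel_measurable M" "weighted_sum h K \<in> borel_measurable M"
proof -
  have [measurable]: "incr h k \<in> borel_measurable M" for k using incr_measurable assms .
  show *: "count_sum h K \<in> borel_measurable M" for K unfolding count_sum_def by measurable
  note [measurable] = this
  show "weighted_sum h K \<in> borel_measurable M" unfolding weighted_sum_def by measurable
qed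

lemma distr_incr: "h \<ge> 0 \<Longrightarrow> distr M borel (incr h k) = distr M borel (\<lambda>\<omega>. (N h \<omega>, L h \<omega>))"
  using distr_increment[of "real k * h" h] unfolding incr_def by (simp add: algebra_simps)

lemma indep_incr:
  assumes h: "h \<ge> 0"
  shows "indep_var borel (\<lambda>\<omega>. (weighted_sum h K \<omega>, count_sum h K \<omega>)) borel (incr h K)"
proof -
  define t where "t k = real k * h" for k
  have "mono t" using h by (auto simp: t_def mono_def intro!: mult_right_mono)
  then have "indep_vars (\<lambda>_. borel) (\<lambda>k \<omega>. (N (t (Suc k)) \<omega>, L (t (Suc k)) \<omega>) - (N (t k) \<omega>, L (t k) \<omega>)) {..<Suc K}"
  proof -
    have ind: "\<forall>n t. 0 \<le> t 0 \<and> mono t \<longrightarrow> indep_vars (\<lambda>_. borel)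
        (\<lambda>k \<omega>. (N (t (Suc k)) \<omega>, L (t (Suc k)) \<omega>) - (N (t k) \<omega>, L (t k) \<omega>)) {..<n}"
      using levy unfolding levy_process_def by (elim conjE)
    have "0 \<le> t 0" by (simp add: t_def)
    with \<open>mono t\<close> show ?thesis
      by (intro ind[THEN spec, of "Suc K", THEN spec, of t, THEN mp] conjI)
  qed
  then have "indep_vars (\<lambda>_. borel) (incr h) {..<Suc K}"
    by (simp add: t_def incr_def[abs_def])
  then have "indep_var (PiM {..<K} (\<lambda>_. borel)) (\<lambda>\<omega>. \<lambda>k\<in>{..<K}. incr h k \<omega>) (PiM {K} (\<lambda>_. borel)) (\<lambda>\<omega>. \<lambda>k\<in>{K}. incr h k \<omega>)"
    by (rule indep_var_restrict) auto
  \<comment> \<open>A measurable map that recovers the pair (weighted sum, count) from the first K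
    increments.\<close>
  moreover define f where "f x = (\<Sum>k<K. \<psi> (\<Sum>j<k. fst (x j)) * snd (x k), \<Sum>j<K. fst (x j))" for x :: "nat \<Rightarrow> real \<times> real"
  have "f \<in> measurable (PiM {..<K} (\<lambda>_. borel)) borel"
    unfolding f_def
  proof (intro borel_measurable_Pair borel_measurable_sum borel_measurable_times)
    have m: "(\<lambda>x. x j) \<in> measurable (PiM {..<K} (\<lambda>_. borel)) (borel :: (real \<times> real) measure)" if "j < K" for j
      using that by (intro measurable_component_singleton) simp
    show "(\<lambda>x. fst (x j :: real \<times> real)) \<in> borel_measurable (PiM {..<K} (\<lambda>_. borel))" if "j \<in> {..<K}" for j
      using measurable_compose[OF m fst_snd_measurable(1)] that by simp
    fix k assume k: "k \<in> {..<K}"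
    show "(\<lambda>x. snd (x k :: real \<times> real)) \<in> borel_measurable (PiM {..<K} (\<lambda>_. borel))"
      using measurable_compose[OF m fst_snd_measurable(2)] k by simp
    have "(\<lambda>x. \<Sum>j<k. fst (x j :: real \<times> real)) \<in> borel_measurable (PiM {..<K} (\<lambda>_. borel))"
      using k by (intro borel_measurable_sum measurable_compose[OF m fst_snd_measurable(1)]) auto
    then show "(\<lambda>x. \<psi> (\<Sum>j<k. fst (x j :: real \<times> real))) \<in> borel_measurable (PiM {..<K} (\<lambda>_. borel))"
      by (rule measurable_compose) simp
  qed
  moreover have "(\<lambda>x. x K) \<in> measurable (PiM {K} (\<lambda>_. borel)) (borel :: (real \<times> real) measure)"
    by (intro measurable_component_singleton) simp
  ultimately have "indep_var borel (f \<circ> (\<lambda>\<omega>. \<lambda>k\<in>{..<K}. incr h k \<omega>)) borel ((\<lambda>x. x K) \<circ> (\<lambda>\<omega>. \<lambda>k\<in>{K}. incr h k \<omega>))"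
    by (rule indep_var_compose)
  also have "f \<circ> (\<lambda>\<omega>. \<lambda>k\<in>{..<K}. incr h k \<omega>) = (\<lambda>\<omega>. (weighted_sum h K \<omega>, count_sum h K \<omega>))"
    by (auto simp: fun_eq_iff f_def weighted_sum_def count_sum_def intro!: sum.cong arg_cong2[where f = "(*)"] arg_cong[where f = \<psi>])
  also have "(\<lambda>x. x K) \<circ> (\<lambda>\<omega>. \<lambda>k\<in>{K}. incr h k \<omega>) = incr h K"
    by (auto simp: fun_eq_iff)
  finally show ?thesis .
qed

text \<open>This is the characteristic function of a Riemann sum with j cells, computed by
  conditioning on the first cell: what follows is an independent copy scaled by the weight of N h,
  which acts on the argument z.\<close>

primrec val :: "real \<Rightarrow> nat \<Rightarrow> real \<Rightarrow> complex" where
  "val h 0 = (\<lambda>z. 1)"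
| "val h (Suc j) = (\<lambda>z. CLINT \<omega>|M. iexp (z * L h \<omega>) * val h j (z * \<psi> (N h \<omega>)))"

lemma val_measurable: "h \<ge> 0 \<Longrightarrow> val h j \<in> borel_measurable borel"
proof (induction j)
  case (Suc j)
  have [measurable]: "N h \<in> borel_measurable M" "L h \<in> borel_measurable M" "val h j \<in> borel_measurable borel"
    using NL_measurable Suc by auto
  show ?case unfolding val.simps by measurable
qed simp

lemma norm_integral_le_1:
  fixes f :: "'a \<Rightarrow> complex"
  assumes "\<And>\<omega>. norm (f \<omega>) \<le> 1"
  shows "norm (CLINT \<omega>|M. f \<omega>) \<le> 1"
proof (cases "integrable M f")
  case True
  have "norm (CLINT \<omega>|M. f \<omega>) \<le> (LINT \<omega>|M. norm (f \<omega>))" by (rule integral_norm_bound)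
  also have "\<dots> \<le> (LINT \<omega>|M. 1)" using True assms by (intro integral_mono) auto
  finally show ?thesis by (simp add: prob_space)
qed (simp add: not_integrable_integral_eq)

lemma norm_val_le_1: "norm (val h j z) \<le> 1"
proof (induction j arbitrary: z)
  case (Suc j)
  then show ?case unfolding val.simps by (intro norm_integral_le_1) (simp add: norm_mult)
qed simp

lemma AE_incr_Nats: "h \<ge> 0 \<Longrightarrow> AE \<omega> in M. \<forall>k. fst (incr h k \<omega>) \<in> \<nat> \<and> snd (incr h k \<omega>) \<ge> 0"
  unfolding AE_all_countable
proof
  fix k assume "h \<ge> 0"
  then show "AE \<omega> in M. fst (incr h k \<omega>) \<in> \<nat> \<and> snd (incr h k \<omega>) \<ge> 0"
    using AE_increment[of "real k * h" h] by (simp add: incr_def algebra_simps)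
qed

text \<open>Here j counts the cells already averaged out. The induction moves the last of the K + 1
  observed cells into \<open>val\<close>, hence the arbitrary j; j = 0 gives the characteristic
  function itself.\<close>

lemma integral_weighted_sum_val:
  assumes h: "h \<ge> 0"
  shows "(CLINT \<omega>|M. iexp (z * weighted_sum h K \<omega>) * val h j (z * \<psi> (count_sum h K \<omega>))) = val h (K + j) z"
proof (induction K arbitrary: j)
  case 0
  then show ?case by (simp add: weighted_sum_def count_sum_def psi_0 prob_space)
next
  case (Suc K)
  \<comment> \<open>The arguments are grouped into past and last increment. Splitting the weight of
    the new count needs integer counts, so the rewriting holds almost everywhere only.\<close>
  define \<Phi> where "\<Phi> q = iexp (z * fst (fst q)) * (iexp (z * \<psi> (snd (fst q)) * snd (snd q)) *
      val h j (z * \<psi> (snd (fst q)) * \<psi> (fst (snd q))))" for q :: "(real \<times> real) \<times> (real \<times> real)"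
  have [measurable]: "val h j \<in> borel_measurable borel" using val_measurable h .
  have [measurable]: "N h \<in> borel_measurable M" "L h \<in> borel_measurable M" using NL_measurable h by auto
  have [measurable]: "incr h k \<in> borel_measurable M" for k using incr_measurable h .
  have [measurable]: "weighted_sum h k \<in> borel_measurable M" "count_sum h k \<in> borel_measurable M" for k
    using sums_measurable h by auto
  have \<Phi> [measurable]: "\<Phi> \<in> borel_measurable (borel \<Otimes>\<^sub>M borel)"
    unfolding \<Phi>_def by measurable
  have \<Phi>2: "(\<lambda>p. \<Phi> (q, p)) \<in> borel_measurable borel" for q
    unfolding \<Phi>_def fst_conv snd_conv by measurable
  have pair: "(\<lambda>\<omega>. (N h \<omega>, L h \<omega>)) \<in> borel_measurable M" by (auto intro!: borel_measurable_Pair)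
  have "(CLINT \<omega>|M. iexp (z * weighted_sum h (Suc K) \<omega>) * val h j (z * \<psi> (count_sum h (Suc K) \<omega>))) =
      (CLINT \<omega>|M. \<Phi> ((weighted_sum h K \<omega>, count_sum h K \<omega>), incr h K \<omega>))"
  proof (rule integral_cong_AE)
    show "(\<lambda>\<omega>. \<Phi> ((weighted_sum h K \<omega>, count_sum h K \<omega>), incr h K \<omega>)) \<in> borel_measurable M"
      by (intro measurable_compose[OF _ \<Phi>] measurable_Pair) (auto intro!: borel_measurable_Pair)
    show "AE \<omega> in M. iexp (z * weighted_sum h (Suc K) \<omega>) * val h j (z * \<psi> (count_sum h (Suc K) \<omega>)) =
        \<Phi> ((weighted_sum h K \<omega>, count_sum h K \<omega>), incr h K \<omega>)"
      using AE_incr_Nats[OF h]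
    proof eventually_elim
      case (elim \<omega>)
      have "count_sum h K \<omega> \<in> \<nat>" unfolding count_sum_def using elim by (induction K) (auto intro: Nats_add)
      moreover have "fst (incr h K \<omega>) \<in> \<nat>" using elim by auto
      ultimately have "\<psi> (count_sum h (Suc K) \<omega>) = \<psi> (count_sum h K \<omega>) * \<psi> (fst (incr h K \<omega>))"
        using psi_add by (simp add: count_sum_def)
      moreover have "weighted_sum h (Suc K) \<omega> = weighted_sum h K \<omega> + \<psi> (count_sum h K \<omega>) * snd (incr h K \<omega>)"
        by (simp add: weighted_sum_def)
      ultimately show ?case
        by (simp add: \<Phi>_def case_prod_beta exp_add algebra_simps)
    qed
  qed measurable
  also have "\<dots> = (CLINT \<omega>|M. CLINT \<omega>'|M. \<Phi> ((weighted_sum h K \<omega>, count_sum h K \<omega>), incr h K \<omega>'))"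
    by (rule indep_var_integral[OF indep_incr[OF h] \<Phi>, of 1])
      (auto simp: \<Phi>_def norm_mult norm_val_le_1)
  also have "\<dots> = (CLINT \<omega>|M. iexp (z * weighted_sum h K \<omega>) * val h (Suc j) (z * \<psi> (count_sum h K \<omega>)))"
  proof (intro Bochner_Integration.integral_cong refl)
    fix \<omega>
    let ?q = "(weighted_sum h K \<omega>, count_sum h K \<omega>)"
    have "(CLINT \<omega>'|M. \<Phi> (?q, incr h K \<omega>')) = (CLINT p|distr M borel (incr h K). \<Phi> (?q, p))"
      by (rule integral_distr[symmetric]) (auto intro: \<Phi>2)
    also have "\<dots> = (CLINT \<omega>'|M. \<Phi> (?q, (N h \<omega>', L h \<omega>')))"
      unfolding distr_incr[OF h] by (rule integral_distr) (auto intro: \<Phi>2 pair)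
    also have "\<dots> = iexp (z * weighted_sum h K \<omega>) * val h (Suc j) (z * \<psi> (count_sum h K \<omega>))"
      unfolding val.simps \<Phi>_def by (simp add: mult_ac)
    finally show "(CLINT \<omega>'|M. \<Phi> (?q, incr h K \<omega>')) = iexp (z * weighted_sum h K \<omega>) * val h (Suc j) (z * \<psi> (count_sum h K \<omega>))" .
  qed
  finally show ?case using Suc.IH[of "Suc j"] by simp
qed

lemma char_weighted_sum:
  assumes "h \<ge> 0"
  shows "(CLINT \<omega>|M. iexp (z * weighted_sum h K \<omega>)) = val h K z"
  using integral_weighted_sum_val[OF assms, of z K 0] by simp

text \<open>Up to the factor u + v + w, \<open>A\<close> and \<open>B\<close> are the two
  coefficients of the scaling equation. Over a short step h, the expectation of iexp (z * L h) on N
  h = 0 is about 1 - h A, and on N h = 1 about h B.\<close>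

definition A :: "real \<Rightarrow> complex" where "A z = u + v + w - v * iexp z"
definition B :: "real \<Rightarrow> complex" where "B z = u + w * iexp (a * z)"

text \<open>The two halves are the contributions of even and odd N h, compared with 1 - h A and h B;
  the last term covers N h >= 2.\<close>

definition step_error :: "real \<Rightarrow> real \<Rightarrow> real" where
  "step_error z h =
    norm ((exp (of_real h * (B z - A z)) + exp (of_real h * (- A z - B z))) / 2 - 1 + of_real h * A z) +
    norm ((exp (of_real h * (B z - A z)) - exp (of_real h * (- A z - B z))) / 2 - of_real h * B z) +
    3 * (h * (u + w))\<^sup>2"

text \<open>On the integers \<open>e\<^bsup>i\<pi>x\<^esup> = (-1)\<^bsup>x\<^esup>\<close> separates the values \<open>0\<close> and \<open>1\<close> of \<open>N h\<close>, so the joint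
  characteristic function yields the expectations restricted to these values up to \<open>O(h\<^sup>2)\<close>.\<close>

lemma norm_val_Suc_diff_le:
  assumes h: "h \<ge> 0"
  shows "norm (val h (Suc j) z - val h j z + of_real h * (A z * val h j z - B z * val h j (b * z))) \<le> step_error z h"
proof -
  have [measurable]: "val h j \<in> borel_measurable borel" using val_measurable h .
  have [measurable]: "N h \<in> borel_measurable M" "L h \<in> borel_measurable M" using NL_measurable h by auto
  define V0 V1 where "V0 = val h j z" and "V1 = val h j (b * z)"
  have V: "norm V0 \<le> 1" "norm V1 \<le> 1" unfolding V0_def V1_def by (rule norm_val_le_1)+
  define E0 E1 where "E0 = exp (of_real h * (B z - A z))" and "E1 = exp (of_real h * (- A z - B z))"
  have E0: "(CLINT \<omega>|M. iexp (z * L h \<omega>)) = E0"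
    using char_cpp[OF h, of 0 z] by (simp add: E0_def A_def B_def algebra_simps)
  have E1: "(CLINT \<omega>|M. iexp (pi * N h \<omega> + z * L h \<omega>)) = E1"
    using char_cpp[OF h, of pi z] by (simp add: E1_def A_def B_def algebra_simps exp_add)
  have int: "integrable M (\<lambda>\<omega>. iexp (z * L h \<omega>))" "integrable M (\<lambda>\<omega>. iexp (pi * N h \<omega> + z * L h \<omega>))"
    "integrable M (\<lambda>\<omega>. iexp (z * L h \<omega>) * val h j (z * \<psi> (N h \<omega>)))"
    by (rule integrable_const_bound[where B = 1]; simp add: norm_mult norm_val_le_1)+
  \<comment> \<open>The subtracted term is (V0 + V1)/2 + (-1)^N (V0 - V1)/2 times iexp (z * L h). It
    interpolates the values V0 at N = 0 and V1 at N = 1, so \<open>Q\<close> vanishes unless N >=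
    2.\<close>
  define Q where "Q \<omega> = iexp (z * L h \<omega>) * val h j (z * \<psi> (N h \<omega>)) -
    ((V0 + V1) / 2 * iexp (z * L h \<omega>) + (V0 - V1) / 2 * iexp (pi * N h \<omega> + z * L h \<omega>))" for \<omega>
  have eq: "(CLINT \<omega>|M. Q \<omega>) = val h (Suc j) z - ((V0 + V1) / 2 * E0 + (V0 - V1) / 2 * E1)"
  proof -
    let ?c = "\<lambda>\<omega>. (V0 + V1) / 2 * iexp (z * L h \<omega>) + (V0 - V1) / 2 * iexp (pi * N h \<omega> + z * L h \<omega>)"
    have c: "integrable M ?c"
      by (intro Bochner_Integration.integrable_add integrable_mult_right int)
    have "(CLINT \<omega>|M. ?c \<omega>) = (V0 + V1) / 2 * E0 + (V0 - V1) / 2 * E1"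
      unfolding E0[symmetric] E1[symmetric] integral_mult_right_zero[symmetric]
      by (intro Bochner_Integration.integral_add integrable_mult_right int)
    then show ?thesis
      unfolding Q_def val.simps by (subst Bochner_Integration.integral_diff[OF int(3) c]) simp
  qed
  have [measurable]: "Q \<in> borel_measurable M" unfolding Q_def by measurable
  \<comment> \<open>Three terms of norm at most 1 each; this is the 3 in
    \<open>step_error\<close>.\<close>
  have Q3: "norm (Q \<omega>) \<le> 3" for \<omega>
  proof -
    have "norm (V0 + V1) \<le> 2" "norm (V0 - V1) \<le> 2"
      using V norm_triangle_ineq[of V0 V1] norm_triangle_ineq4[of V0 V1] by auto
    then have "norm ((V0 + V1) / 2 * iexp (z * L h \<omega>)) \<le> 1" "norm ((V0 - V1) / 2 * iexp (pi * N h \<omega> + z * L h \<omega>)) \<le> 1"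
      unfolding norm_mult norm_exp_i_times by (auto simp: norm_divide)
    moreover have "norm (iexp (z * L h \<omega>) * val h j (z * \<psi> (N h \<omega>))) \<le> 1"
      by (simp add: norm_mult norm_val_le_1)
    ultimately show ?thesis
      unfolding Q_def by (intro order.trans[OF norm_triangle_ineq4] order.trans[OF add_mono[OF _ norm_triangle_ineq]]) auto
  qed
  have Q: "AE \<omega> in M. norm (Q \<omega>) \<le> 3 * indicator {2..} (N h \<omega>)"
  proof -
    have "AE x in distr M borel (N h). x \<in> \<nat>"
      unfolding distr_N[OF h] using h rate by (intro AE_poisson_law_Nats) simp
    then have "AE \<omega> in M. N h \<omega> \<in> \<nat>" by (subst (asm) AE_distr_iff) (auto simp: borel_closed)
    then show ?thesis
    proof eventually_elim
      case (elim \<omega>)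
      then obtain k where k: "N h \<omega> = real k" by (auto simp: Nats_def)
      consider "k = 0" | "k = 1" | "k \<ge> 2" by linarith
      then show ?case
      proof cases
        case 1
        then have "Q \<omega> = 0" using k by (simp add: Q_def psi_0 V0_def field_simps)
        then show ?thesis by simp
      next
        case 2
        then have "Q \<omega> = 0" using k weight[of 1]
          by (simp add: Q_def V1_def distrib_left exp_add mult.commute[of z b]) (simp add: field_simps)
        then show ?thesis by simp
      next
        case 3
        then show ?thesis using Q3[of \<omega>] k by simp
      qed
    qed
  qed
  have "norm (CLINT \<omega>|M. Q \<omega>) \<le> (LINT \<omega>|M. norm (Q \<omega>))" by (rule integral_norm_bound)
  also have "\<dots> \<le> (LINT \<omega>|M. 3 * indicator {2..} (N h \<omega>))"
    by (rule integral_mono_AE)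
      (use Q Q3 in \<open>auto intro!: integrable_const_bound[where B = 3] simp: indicator_def\<close>)
  also have "\<dots> = 3 * measure (distr M borel (N h)) {2..}"
  proof -
    have "(LINT \<omega>|M. indicator {2..} (N h \<omega>)) = (LINT x|distr M borel (N h). indicator {2..} x :: real)"
      by (rule integral_distr[symmetric]) auto
    then show ?thesis by simp
  qed
  also have "\<dots> \<le> 3 * (h * (u + w))\<^sup>2"
    unfolding distr_N[OF h] using h rate by (intro mult_left_mono measure_poisson_law_ge_2) auto
  finally have Qle: "norm (CLINT \<omega>|M. Q \<omega>) \<le> 3 * (h * (u + w))\<^sup>2" .
  have "val h (Suc j) z - V0 + of_real h * (A z * V0 - B z * V1) =
      (((E0 + E1) / 2 - 1 + of_real h * A z) * V0 + ((E0 - E1) / 2 - of_real h * B z) * V1) + (CLINT \<omega>|M. Q \<omega>)"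
    unfolding eq by (simp add: field_simps)
  also have "norm \<dots> \<le> (norm (((E0 + E1) / 2 - 1 + of_real h * A z) * V0) + norm (((E0 - E1) / 2 - of_real h * B z) * V1)) + norm (CLINT \<omega>|M. Q \<omega>)"
    by (intro order.trans[OF norm_triangle_ineq] add_mono norm_triangle_ineq order.refl)
  also have "\<dots> \<le> (norm ((E0 + E1) / 2 - 1 + of_real h * A z) + norm ((E0 - E1) / 2 - of_real h * B z)) + 3 * (h * (u + w))\<^sup>2"
    using V by (intro add_mono Qle) (auto simp: norm_mult intro!: mult_left_le)
  finally show ?thesis unfolding V0_def V1_def step_error_def E0_def E1_def .
qed

text \<open>A unit interval has 2^m cells, so the error per cell must be o(h). The first two terms
  are of this order because \<open>A\<close> and \<open>B\<close> give the first-order expansions of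
  the exponentials at 0.\<close>

lemma step_error_tendsto: "(\<lambda>m. 2 ^ m * step_error z (1 / 2 ^ m)) \<longlonglongrightarrow> 0"
proof -
  let ?h = "\<lambda>m. 1 / 2 ^ m :: real"
  have h0: "?h \<longlonglongrightarrow> 0"
    using LIMSEQ_realpow_zero[of "1 / 2 :: real"] by (simp add: power_one_over)
  have ex: "(\<lambda>m. (exp (of_real (?h m) * x) - 1) * 2 ^ m) \<longlonglongrightarrow> x" for x :: complex
  proof -
    have "((\<lambda>t. exp (t * x)) has_field_derivative exp (0 * x) * x) (at 0)"
      by (auto intro!: derivative_eq_intros)
    then have "((\<lambda>t. (exp (t * x) - 1) / t) \<longlongrightarrow> x) (at 0)"
      by (simp add: has_field_derivative_iff)
    moreover have "filterlim (\<lambda>m. complex_of_real (?h m)) (at 0) sequentially"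
      unfolding filterlim_at using tendsto_of_real[OF h0, where 'a = complex] by auto
    ultimately have "(\<lambda>m. (exp (of_real (?h m) * x) - 1) / of_real (?h m)) \<longlonglongrightarrow> x"
      by (rule filterlim_compose)
    then show ?thesis by (simp add: divide_inverse)
  qed
  let ?e0 = "\<lambda>m. (exp (of_real (?h m) * (B z - A z)) - 1) * 2 ^ m"
  let ?e1 = "\<lambda>m. (exp (of_real (?h m) * (- A z - B z)) - 1) * 2 ^ m"
  have "(\<lambda>m. norm ((?e0 m + ?e1 m) / 2 + A z) + norm ((?e0 m - ?e1 m) / 2 - B z) + 3 * (u + w)\<^sup>2 * ?h m) \<longlonglongrightarrow>
      norm (((B z - A z) + (- A z - B z)) / 2 + A z) + norm (((B z - A z) - (- A z - B z)) / 2 - B z) + 3 * (u + w)\<^sup>2 * 0"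
    by (intro tendsto_add tendsto_norm tendsto_diff tendsto_divide tendsto_mult tendsto_const ex h0) auto
  moreover have "2 ^ m * step_error z (?h m) =
      norm ((?e0 m + ?e1 m) / 2 + A z) + norm ((?e0 m - ?e1 m) / 2 - B z) + 3 * (u + w)\<^sup>2 * ?h m" for m
  proof -
    have sc: "2 ^ m * norm x = norm (2 ^ m * x)" for x :: complex
      by (simp add: norm_mult norm_power)
    have q: "2 ^ m * (3 * (?h m * (u + w))\<^sup>2) = 3 * (u + w)\<^sup>2 * ?h m"
    proof -
      have "x * (3 * (1 / x * y)\<^sup>2) = 3 * y\<^sup>2 * (1 / x)" if "x \<noteq> 0" for x y :: real
        using that by (simp add: power2_eq_square)
      then show ?thesis by simp
    qed
    have d: "x * (y + y' + y'') = x * y + x * y' + x * y''" for x y y' y'' :: real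
      by (simp add: distrib_left)
    show ?thesis
      unfolding step_error_def d sc q
      by (intro arg_cong2[where f = "(+)"] arg_cong[where f = norm] refl) (simp_all add: field_simps)
  qed
  ultimately show ?thesis by (simp add: algebra_simps)
qed

end

section \<open>From the Riemann sums to the limit law\<close>

lemma AE_summable_of_summable_integral:
  fixes f :: "nat \<Rightarrow> 'a \<Rightarrow> real"
  assumes int: "\<And>t. integrable M (f t)" and pos: "\<And>t. AE x in M. 0 \<le> f t x"
    and summable: "summable (\<lambda>t. LINT x|M. f t x)"
  shows "AE x in M. summable (\<lambda>t. f t x)"
proof -
  have [measurable]: "f t \<in> borel_measurable M" for t using int by auto
  have "(\<integral>\<^sup>+x. (\<Sum>t. ennreal (norm (f t x))) \<partial>M) = (\<Sum>t. \<integral>\<^sup>+x. ennreal (norm (f t x)) \<partial>M)"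
    by (rule nn_integral_suminf) auto
  also have "\<dots> = (\<Sum>t. ennreal (LINT x|M. f t x))"
  proof (rule suminf_cong)
    fix t
    have "(\<integral>\<^sup>+x. ennreal (norm (f t x)) \<partial>M) = (\<integral>\<^sup>+x. ennreal (f t x) \<partial>M)"
      using pos[of t] by (intro nn_integral_cong_AE) (auto elim!: eventually_mono)
    also have "\<dots> = ennreal (LINT x|M. f t x)"
      using int pos by (rule nn_integral_eq_integral)
    finally show "(\<integral>\<^sup>+x. ennreal (norm (f t x)) \<partial>M) = ennreal (LINT x|M. f t x)" .
  qed
  also have "\<dots> = ennreal (\<Sum>t. LINT x|M. f t x)"
    using pos by (intro suminf_ennreal2 summable integral_nonneg_AE)
  finally have "AE x in M. (\<Sum>t. ennreal (norm (f t x))) \<noteq> \<infinity>"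
    by (intro nn_integral_PInf_AE) auto
  then show ?thesis
  proof eventually_elim
    case (elim x)
    then have "summable (\<lambda>t. norm (f t x))" by (intro summable_suminf_not_top) auto
    then show ?case by (rule summable_norm_cancel)
  qed
qed

text \<open>Agreement almost everywhere with a measurable function makes \<open>f\<close> measurable
  for the completion, so that its \<open>distr\<close> is a genuine law.\<close>

lemma distr_completion_AE:
  fixes f g :: "'a \<Rightarrow> real"
  assumes g: "g \<in> borel_measurable M" and ae: "AE x in M. f x = g x"
  shows "distr (completion M) borel f = distr M borel g"
proof -
  have g': "g \<in> borel_measurable (completion M)" using g by (rule measurable_completion)
  have ae': "AE x in completion M. f x = g x" using ae by (rule AE_completion)
  have f: "f \<in> borel_measurable (completion M)"
  proof (rule measurableI)
    fix A :: "real set" assume A: "A \<in> sets borel"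
    show "f -` A \<inter> space (completion M) \<in> sets (completion M)"
    proof (rule completion.in_sets_AE)
      show "g -` A \<inter> space (completion M) \<in> sets (completion M)" using g' A by (rule measurable_sets)
      show "AE x in completion M. (x \<in> g -` A \<inter> space (completion M)) = (x \<in> f -` A \<inter> space (completion M))"
        using ae' by eventually_elim auto
    qed auto
  qed simp
  have "distr (completion M) borel f = distr (completion M) borel g"
    by (rule distr_cong_AE[OF refl refl ae' f g'])
  also have "\<dots> = distr M borel g" using g by (rule distr_completion)
  finally show ?thesis .
qed

context weighted_cpp
begin

lemma weighted_path:
  "good_path (\<lambda>t. N t \<omega>) (\<lambda>t. L t \<omega>) \<Longrightarrow> weighted_path (\<lambda>t. N t \<omega>) (\<lambda>t. L t \<omega>) \<psi> b"
  by (simp add: weighted_path_def cont nonneg weight b)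

lemma count_sum_eq: "good_path (\<lambda>t. N t \<omega>) (\<lambda>t. L t \<omega>) \<Longrightarrow> count_sum h K \<omega> = N (real K * h) \<omega>"
  using sum_lessThan_telescope[of "\<lambda>k. N (real k * h) \<omega>" K]
  by (simp add: count_sum_def incr_def good_path_def)

lemma weighted_sum_eq:
  "good_path (\<lambda>t. N t \<omega>) (\<lambda>t. L t \<omega>) \<Longrightarrow> weighted_sum h K \<omega> = grid_sum \<psi> (\<lambda>t. N t \<omega>) (\<lambda>t. L t \<omega>) h K"
  by (simp add: weighted_sum_def grid_sum_def count_sum_eq) (simp add: incr_def)

abbreviation X :: "real \<Rightarrow> 'a \<Rightarrow> real" where
  "X t \<omega> \<equiv> stieltjes_integral \<psi> (\<lambda>s. N s \<omega>) (\<lambda>s. L s \<omega>) t"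

text \<open>The expected weight at time t, the generating function of the Poisson variable N t at
  the point b.\<close>

definition decay :: "nat \<Rightarrow> real" where
  "decay t = exp (- (real t * (u + w) * (1 - b)))"

definition mean_L :: real where "mean_L = (LINT \<omega>|M. L 1 \<omega>)"

lemma decay_eq_power: "decay t = exp (- ((u + w) * (1 - b))) ^ t"
  by (simp add: decay_def exp_of_nat_mult[symmetric] mult_ac)

lemma decay_summable: "summable decay"
  unfolding decay_eq_power[abs_def] using rate b by (intro summable_geometric) simp

lemma psi_N:
  shows integrable_psi_N: "integrable M (\<lambda>\<omega>. \<psi> (N (real t) \<omega>))"
    and integral_psi_N: "(LINT \<omega>|M. \<psi> (N (real t) \<omega>)) = decay t"
proof -
  have [measurable]: "N (real t) \<in> borel_measurable M" using NL_measurable by simp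
  have "AE \<omega> in M. norm (\<psi> (N (real t) \<omega>)) \<le> 1"
    using AE_good_path
  proof eventually_elim
    case (elim \<omega>)
    interpret weighted_path "\<lambda>t. N t \<omega>" "\<lambda>t. L t \<omega>" \<psi> b by (rule weighted_path[OF elim])
    show ?case using weight_le_1[of "real t"] by (simp add: nonneg)
  qed
  then show "integrable M (\<lambda>\<omega>. \<psi> (N (real t) \<omega>))"
    by (rule integrable_const_bound) measurable
  have "(LINT \<omega>|M. \<psi> (N (real t) \<omega>)) = (LINT x|distr M borel (N (real t)). \<psi> x)"
    by (rule integral_distr[symmetric]) auto
  also have "\<dots> = decay t"
    using rate b by (simp add: distr_N integral_poisson_law_weight[OF _ psi_measurable weight] decay_def)
  finally show "(LINT \<omega>|M. \<psi> (N (real t) \<omega>)) = decay t" .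
qed

lemma integrable_L1: "integrable M (L 1)"
proof -
  have [measurable]: "L 1 \<in> borel_measurable M" using NL_measurable by simp
  have "integrable (distr M borel (L 1)) (\<lambda>x. x)"
    using uvw a by (subst distr_L) (auto intro!: integrable_jump_law)
  then show ?thesis by (subst (asm) integrable_distr_eq) auto
qed

lemma psi_N_L:
  shows integrable_psi_N_L: "integrable M (\<lambda>\<omega>. \<psi> (N (real t) \<omega>) * (L (real (Suc t)) \<omega> - L (real t) \<omega>))"
    and integral_psi_N_L: "(LINT \<omega>|M. \<psi> (N (real t) \<omega>) * (L (real (Suc t)) \<omega> - L (real t) \<omega>)) = decay t * mean_L"
proof -
  have [measurable]: "N (real t) \<in> borel_measurable M" "L (real (Suc t)) \<in> borel_measurable M" "L (real t) \<in> borel_measurable M"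
    "L (1 + real t) \<in> borel_measurable M" "L 1 \<in> borel_measurable M" using NL_measurable by auto
  \<comment> \<open>The grid of mesh 1 supplies the independence of the weight at time t and the
    increment of L over (t, t+1]; the count replaces N t, with which it agrees almost
    surely.\<close>
  let ?P = "\<lambda>\<omega>. \<psi> (count_sum 1 t \<omega>)" and ?Q = "\<lambda>\<omega>. L (real (Suc t)) \<omega> - L (real t) \<omega>"
  have [measurable]: "count_sum 1 t \<in> borel_measurable M" using sums_measurable[of 1 t] by simp
  have "indep_var borel ((\<lambda>x. \<psi> (snd x)) \<circ> (\<lambda>\<omega>. (weighted_sum 1 t \<omega>, count_sum 1 t \<omega>))) borel (snd \<circ> incr 1 t)"
    by (rule indep_var_compose[OF indep_incr]) auto
  then have indep: "indep_var borel ?P borel ?Q" by (simp add: comp_def incr_def)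
  have ae: "AE \<omega> in M. ?P \<omega> = \<psi> (N (real t) \<omega>)"
    using AE_good_path by eventually_elim (simp add: count_sum_eq)
  have P: "integrable M ?P"
    using integrable_psi_N[of t] ae by (subst integrable_cong_AE) auto
  have eqd: "distr M borel ?Q = distr M borel (L 1)"
    using distr_L_increment[of "real t" 1] by (simp add: add.commute)
  have Q: "integrable M ?Q"
  proof -
    have "integrable (distr M borel ?Q) (\<lambda>x. x)"
      unfolding eqd using integrable_L1 by (subst integrable_distr_eq) auto
    then show ?thesis by (subst (asm) integrable_distr_eq) auto
  qed
  have PQ: "integrable M (\<lambda>\<omega>. ?P \<omega> * ?Q \<omega>)" using indep P Q by (rule indep_var_integrable)
  have ae2: "AE \<omega> in M. ?P \<omega> * ?Q \<omega> = \<psi> (N (real t) \<omega>) * ?Q \<omega>" using ae by eventually_elim simp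
  show "integrable M (\<lambda>\<omega>. \<psi> (N (real t) \<omega>) * ?Q \<omega>)"
    using PQ by (rule integrable_cong_AE[THEN iffD1, rotated -1]) (use ae2 in auto)
  have "(LINT \<omega>|M. \<psi> (N (real t) \<omega>) * ?Q \<omega>) = (LINT \<omega>|M. ?P \<omega> * ?Q \<omega>)"
    using ae2 by (intro integral_cong_AE) (auto elim!: eventually_mono)
  also have "\<dots> = (LINT \<omega>|M. ?P \<omega>) * (LINT \<omega>|M. ?Q \<omega>)"
    using indep P Q by (rule indep_var_lebesgue_integral)
  also have "(LINT \<omega>|M. ?P \<omega>) = decay t"
    unfolding integral_psi_N[symmetric] using ae by (intro integral_cong_AE) auto
  also have "(LINT \<omega>|M. ?Q \<omega>) = mean_L"
  proof -
    have "(LINT \<omega>|M. ?Q \<omega>) = (LINT x|distr M borel ?Q. x)" by (rule integral_distr[symmetric]) auto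
    also have "\<dots> = mean_L" unfolding eqd mean_L_def by (rule integral_distr) auto
    finally show ?thesis .
  qed
  finally show "(LINT \<omega>|M. \<psi> (N (real t) \<omega>) * ?Q \<omega>) = decay t * mean_L" .
qed

lemma AE_X_converges:
  "AE \<omega> in M. (\<lambda>t::nat. X (real t) \<omega>) \<longlonglongrightarrow> Lim at_top (\<lambda>t. X t \<omega>) \<and> 0 \<le> Lim at_top (\<lambda>t. X t \<omega>)"
proof -
  have "AE \<omega> in M. summable (\<lambda>t. \<psi> (N (real t) \<omega>) * (L (real (Suc t)) \<omega> - L (real t) \<omega>))"
  proof (rule AE_summable_of_summable_integral)
    show "AE \<omega> in M. 0 \<le> \<psi> (N (real t) \<omega>) * (L (real (Suc t)) \<omega> - L (real t) \<omega>)" for t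
      using AE_good_path
    proof eventually_elim
      case (elim \<omega>)
      interpret weighted_path "\<lambda>t. N t \<omega>" "\<lambda>t. L t \<omega>" \<psi> b by (rule weighted_path[OF elim])
      show ?case using l_mono[of "real t" "real (Suc t)"] by (simp add: nonneg)
    qed
    show "summable (\<lambda>t. LINT \<omega>|M. \<psi> (N (real t) \<omega>) * (L (real (Suc t)) \<omega> - L (real t) \<omega>))"
      unfolding integral_psi_N_L using decay_summable by (rule summable_mult2)
  qed (rule integrable_psi_N_L)
  with AE_good_path show ?thesis
  proof eventually_elim
    case (elim \<omega>)
    interpret weighted_path "\<lambda>t. N t \<omega>" "\<lambda>t. L t \<omega>" \<psi> b by (rule weighted_path[OF elim(1)])
    show ?case using stieltjes_integral_converges elim(2) by simp
  qed
qed

text \<open>Inside the unit interval after t the Riemann sum grows by at most the weight at t times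
  the increment of L, whose mean decays exponentially. The bound does not depend on the
  mesh.\<close>

lemma norm_val_diff_le:
  assumes j: "j \<le> 2 ^ m"
  shows "norm (val (1 / 2 ^ m) (t * 2 ^ m + j) z - val (1 / 2 ^ m) (t * 2 ^ m) z) \<le> \<bar>z\<bar> * (decay t * mean_L)"
proof -
  define h :: real where "h = 1 / 2 ^ m"
  have h: "h \<ge> 0" unfolding h_def by simp
  let ?S = "weighted_sum h"
  have [measurable]: "?S k \<in> borel_measurable M" for k using sums_measurable h by auto
  have int: "integrable M (\<lambda>\<omega>. iexp (z * ?S k \<omega>))" for k
    by (rule integrable_const_bound[where B = 1]) auto
  have "norm (val h (t * 2 ^ m + j) z - val h (t * 2 ^ m) z) =
      norm (CLINT \<omega>|M. iexp (z * ?S (t * 2 ^ m + j) \<omega>) - iexp (z * ?S (t * 2 ^ m) \<omega>))"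
    unfolding char_weighted_sum[OF h, symmetric] by (subst Bochner_Integration.integral_diff[OF int int]) simp
  also have "\<dots> \<le> (LINT \<omega>|M. \<bar>z\<bar> * (\<psi> (N (real t) \<omega>) * (L (real (Suc t)) \<omega> - L (real t) \<omega>)))"
  proof (rule order.trans[OF integral_norm_bound integral_mono_AE])
    show "integrable M (\<lambda>\<omega>. norm (iexp (z * ?S (t * 2 ^ m + j) \<omega>) - iexp (z * ?S (t * 2 ^ m) \<omega>)))"
      by (intro integrable_norm Bochner_Integration.integrable_diff int)
    show "integrable M (\<lambda>\<omega>. \<bar>z\<bar> * (\<psi> (N (real t) \<omega>) * (L (real (Suc t)) \<omega> - L (real t) \<omega>)))"
      by (intro integrable_mult_right integrable_psi_N_L)
    show "AE \<omega> in M. norm (iexp (z * ?S (t * 2 ^ m + j) \<omega>) - iexp (z * ?S (t * 2 ^ m) \<omega>)) \<le>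
        \<bar>z\<bar> * (\<psi> (N (real t) \<omega>) * (L (real (Suc t)) \<omega> - L (real t) \<omega>))"
      using AE_good_path
    proof eventually_elim
      case (elim \<omega>)
      interpret weighted_path "\<lambda>t. N t \<omega>" "\<lambda>t. L t \<omega>" \<psi> b by (rule weighted_path[OF elim])
      let ?d = "?S (t * 2 ^ m + j) \<omega> - ?S (t * 2 ^ m) \<omega>"
      have th: "real (t * 2 ^ m) * h = real t" by (simp add: h_def)
      have "0 \<le> ?d" and d: "?d \<le> \<psi> (N (real t) \<omega>) * (L (real (t * 2 ^ m + j) * h) \<omega> - L (real t) \<omega>)"
        using grid_sum_diff_bounds[OF h, of "t * 2 ^ m" "t * 2 ^ m + j"]
        unfolding weighted_sum_eq[OF elim] th by auto
      have "real (t * 2 ^ m + j) \<le> real (Suc t * 2 ^ m)" using j by (simp only: of_nat_le_iff) simp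
      then have "real (t * 2 ^ m + j) * h \<le> real (Suc t * 2 ^ m) * h" using h by (rule mult_right_mono)
      also have "real (Suc t * 2 ^ m) * h = real (Suc t)" unfolding h_def by (simp only: of_nat_mult) simp
      finally have "L (real (t * 2 ^ m + j) * h) \<omega> \<le> L (real (Suc t)) \<omega>" using h by (intro l_mono) auto
      then have "?d \<le> \<psi> (N (real t) \<omega>) * (L (real (Suc t)) \<omega> - L (real t) \<omega>)"
        using nonneg by (intro order.trans[OF d] mult_left_mono) auto
      moreover have "norm (iexp (z * ?S (t * 2 ^ m + j) \<omega>) - iexp (z * ?S (t * 2 ^ m) \<omega>)) \<le> \<bar>z\<bar> * ?d"
        using norm_iexp_diff_le[of "z * ?S (t * 2 ^ m + j) \<omega>" "z * ?S (t * 2 ^ m) \<omega>"] \<open>0 \<le> ?d\<close>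
        by (simp add: right_diff_distrib[symmetric] abs_mult)
      ultimately show ?case by (meson abs_ge_zero mult_left_mono order.trans)
    qed
  qed
  also have "\<dots> = \<bar>z\<bar> * (decay t * mean_L)"
    by (subst integral_mult_right_zero) (simp only: integral_psi_N_L)
  finally show ?thesis unfolding h_def .
qed

text \<open>Summing the one-cell recursion over a unit interval gives a difference equation in t,
  with an error from the mesh and an error from the time horizon. No differential equation in t is
  needed, since the difference between consecutive times vanishes in the limit anyway.\<close>

lemma norm_val_grid_diff_le:
  defines "V \<equiv> \<lambda>m t z. val (1 / 2 ^ m) (t * 2 ^ m) z"
  shows "norm (V m (Suc t) z - V m t z + (A z * V m t z - B z * V m t (b * z))) \<le>
    2 ^ m * step_error z (1 / 2 ^ m) + (norm (A z) * \<bar>z\<bar> + norm (B z) * \<bar>b * z\<bar>) * (decay t * mean_L)"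
proof -
  define h :: real where "h = 1 / 2 ^ m"
  have h: "h \<ge> 0" and h1: "2 ^ m * h = 1" unfolding h_def by auto
  define c where "c j z = val h (t * 2 ^ m + j) z" for j z
  \<comment> \<open>\<open>D\<close> is the defect of the recursion in one cell, \<open>R\<close>
    the cost of freezing the coefficient terms at the left end of the unit interval. The prefactor h
    turns the sum of \<open>R\<close> over 2^m cells into an average.\<close>
  define D where "D j = c (Suc j) z - c j z + of_real h * (A z * c j z - B z * c j (b * z))" for j
  define R where "R j = A z * (c j z - c 0 z) - B z * (c j (b * z) - c 0 (b * z))" for j
  have tel: "(\<Sum>j<2 ^ m. c (Suc j) z - c j z) = c (2 ^ m) z - c 0 z"
    by (rule sum_lessThan_telescope)
  have "(\<Sum>j<2 ^ m. D j) = (c (2 ^ m) z - c 0 z) + of_real h * (\<Sum>j<2 ^ m. A z * c j z - B z * c j (b * z))"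
    unfolding D_def sum.distrib tel sum_distrib_left ..
  also have "(\<Sum>j<2 ^ m. A z * c j z - B z * c j (b * z)) = (\<Sum>j<2 ^ m. R j) + (\<Sum>j<(2::nat) ^ m. A z * c 0 z - B z * c 0 (b * z))"
    unfolding sum.distrib[symmetric] R_def by (intro sum.cong) (auto simp: algebra_simps)
  also have "(\<Sum>j<(2::nat) ^ m. A z * c 0 z - B z * c 0 (b * z)) = 2 ^ m * (A z * c 0 z - B z * c 0 (b * z))"
    by simp
  finally have "(\<Sum>j<2 ^ m. D j) = (c (2 ^ m) z - c 0 z) + of_real h * (\<Sum>j<2 ^ m. R j) + of_real (2 ^ m * h) * (A z * c 0 z - B z * c 0 (b * z))"
    by (simp add: algebra_simps)
  then have "c (2 ^ m) z - c 0 z + (A z * c 0 z - B z * c 0 (b * z)) = (\<Sum>j<2 ^ m. D j) - of_real h * (\<Sum>j<2 ^ m. R j)"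
    unfolding h1 by (simp add: algebra_simps)
  also have "norm \<dots> \<le> norm (\<Sum>j<2 ^ m. D j) + h * norm (\<Sum>j<2 ^ m. R j)"
    using h by (intro order.trans[OF norm_triangle_ineq4]) (simp add: norm_mult)
  also have "norm (\<Sum>j<2 ^ m. D j) \<le> 2 ^ m * step_error z h"
  proof -
    have "norm (\<Sum>j<2 ^ m. D j) \<le> real (card {..<(2::nat) ^ m}) * step_error z h"
      using norm_val_Suc_diff_le[OF h] by (intro sum_norm_bound) (simp add: D_def c_def)
    then show ?thesis by simp
  qed
  also have "norm (\<Sum>j<2 ^ m. R j) \<le> 2 ^ m * ((norm (A z) * \<bar>z\<bar> + norm (B z) * \<bar>b * z\<bar>) * (decay t * mean_L))"
  proof -
    have "norm (\<Sum>j<2 ^ m. R j) \<le> real (card {..<(2::nat) ^ m}) * ((norm (A z) * \<bar>z\<bar> + norm (B z) * \<bar>b * z\<bar>) * (decay t * mean_L))"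
    proof (rule sum_norm_bound)
      fix j :: nat assume "j \<in> {..<2 ^ m}"
      then have j: "j \<le> 2 ^ m" by simp
      have c: "norm (c j y - c 0 y) \<le> \<bar>y\<bar> * (decay t * mean_L)" for y
        using norm_val_diff_le[OF j] by (simp add: c_def h_def)
      have "norm (R j) \<le> norm (A z) * norm (c j z - c 0 z) + norm (B z) * norm (c j (b * z) - c 0 (b * z))"
        unfolding R_def norm_mult[symmetric] by (rule norm_triangle_ineq4)
      also have "\<dots> \<le> norm (A z) * (\<bar>z\<bar> * (decay t * mean_L)) + norm (B z) * (\<bar>b * z\<bar> * (decay t * mean_L))"
        by (intro add_mono mult_left_mono c) auto
      finally show "norm (R j) \<le> (norm (A z) * \<bar>z\<bar> + norm (B z) * \<bar>b * z\<bar>) * (decay t * mean_L)"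
        by (simp add: algebra_simps)
    qed
    then show ?thesis by simp
  qed
  finally have "norm (c (2 ^ m) z - c 0 z + (A z * c 0 z - B z * c 0 (b * z))) \<le>
      2 ^ m * step_error z h + h * (2 ^ m * ((norm (A z) * \<bar>z\<bar> + norm (B z) * \<bar>b * z\<bar>) * (decay t * mean_L)))"
    using h by (simp add: mult_left_mono)
  also have "h * (2 ^ m * ((norm (A z) * \<bar>z\<bar> + norm (B z) * \<bar>b * z\<bar>) * (decay t * mean_L))) =
      (2 ^ m * h) * ((norm (A z) * \<bar>z\<bar> + norm (B z) * \<bar>b * z\<bar>) * (decay t * mean_L))"
    by (simp only: mult_ac)
  finally show ?thesis
    unfolding h1 V_def c_def h_def by (simp add: add.commute)
qed

text \<open>The limit itself is measurable only with respect to the completion, so it is replaced by a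
  measurable version.\<close>

lemma limit_law:
  assumes G: "AE \<omega> in M. G \<omega> = Lim at_top (\<lambda>t. X t \<omega>)"
  defines "\<sigma> \<equiv> distr (completion M) borel G"
  shows "real_distribution \<sigma>" and "AE x in \<sigma>. x \<ge> 0" and "A z * char \<sigma> z = B z * char \<sigma> (b * z)"
proof -
  have [measurable]: "weighted_sum (1 / 2 ^ m) k \<in> borel_measurable M" for m k
    using sums_measurable by simp
  \<comment> \<open>Limits of measurable Riemann sums, measurable for the original space at every
    sample point and equal to the integral on good paths.\<close>
  define X' where "X' t \<omega> = lim (\<lambda>m. weighted_sum (1 / 2 ^ m) (t * 2 ^ m) \<omega>)" for t \<omega>
  have [measurable]: "X' t \<in> borel_measurable M" for t unfolding X'_def by measurable
  have X': "AE \<omega> in M. \<forall>t. (\<lambda>m. weighted_sum (1 / 2 ^ m) (t * 2 ^ m) \<omega>) \<longlonglongrightarrow> X' t \<omega> \<and> X' t \<omega> = X (real t) \<omega>"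
    using AE_good_path
  proof eventually_elim
    case (elim \<omega>)
    interpret weighted_path "\<lambda>t. N t \<omega>" "\<lambda>t. L t \<omega>" \<psi> b by (rule weighted_path[OF elim])
    show ?case
    proof
      fix t
      have "(\<lambda>m. weighted_sum (1 / 2 ^ m) (t * 2 ^ m) \<omega>) \<longlonglongrightarrow> X (real t) \<omega>"
        unfolding weighted_sum_eq[OF elim] by (rule tendsto_grid_sum)
      then show "(\<lambda>m. weighted_sum (1 / 2 ^ m) (t * 2 ^ m) \<omega>) \<longlonglongrightarrow> X' t \<omega> \<and> X' t \<omega> = X (real t) \<omega>"
        unfolding X'_def using limI by metis
    qed
  qed
  define Y where "Y \<omega> = lim (\<lambda>t. X' t \<omega>)" for \<omega>
  have [measurable]: "Y \<in> borel_measurable M" unfolding Y_def by measurable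
  have Y: "AE \<omega> in M. (\<lambda>t. X' t \<omega>) \<longlonglongrightarrow> Y \<omega> \<and> Y \<omega> = Lim at_top (\<lambda>t. X t \<omega>) \<and> 0 \<le> Y \<omega>"
    using X' AE_X_converges
  proof eventually_elim
    case (elim \<omega>)
    then have "(\<lambda>t. X' t \<omega>) \<longlonglongrightarrow> Lim at_top (\<lambda>t. X t \<omega>)" by simp
    then show ?case unfolding Y_def using elim limI by metis
  qed
  have "AE \<omega> in M. G \<omega> = Y \<omega>" using Y G by eventually_elim simp
  then have \<sigma>: "\<sigma> = distr M borel Y"
    unfolding \<sigma>_def by (intro distr_completion_AE) simp_all
  show "real_distribution \<sigma>"
    unfolding \<sigma> by (intro real_distribution_distr prob_space_axioms) simp
  show "AE x in \<sigma>. x \<ge> 0"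
    unfolding \<sigma> by (subst AE_distr_iff) (use Y in \<open>auto elim!: eventually_mono\<close>)
  define f where "f t z = (CLINT \<omega>|M. iexp (z * X' t \<omega>))" for t z
  have lim_m: "(\<lambda>m. val (1 / 2 ^ m) (t * 2 ^ m) z) \<longlonglongrightarrow> f t z" for t z
  proof -
    have "(\<lambda>m. CLINT \<omega>|M. iexp (z * weighted_sum (1 / 2 ^ m) (t * 2 ^ m) \<omega>)) \<longlonglongrightarrow> f t z"
      unfolding f_def
    proof (rule integral_dominated_convergence[where w = "\<lambda>_. 1"])
      show "AE \<omega> in M. (\<lambda>m. iexp (z * weighted_sum (1 / 2 ^ m) (t * 2 ^ m) \<omega>)) \<longlonglongrightarrow> iexp (z * X' t \<omega>)"
        using X' by eventually_elim (intro tendsto_exp tendsto_mult tendsto_const tendsto_of_real, blast)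
    qed auto
    moreover have "0 \<le> 1 / (2::real) ^ m" for m by simp
    ultimately show ?thesis by (simp only: char_weighted_sum)
  qed
  have lim_t: "(\<lambda>t. f t z) \<longlonglongrightarrow> char \<sigma> z" for z
  proof -
    have "(\<lambda>t. f t z) \<longlonglongrightarrow> (CLINT \<omega>|M. iexp (z * Y \<omega>))"
      unfolding f_def
    proof (rule integral_dominated_convergence[where w = "\<lambda>_. 1"])
      show "AE \<omega> in M. (\<lambda>t. iexp (z * X' t \<omega>)) \<longlonglongrightarrow> iexp (z * Y \<omega>)"
        using Y by eventually_elim (intro tendsto_exp tendsto_mult tendsto_const tendsto_of_real, blast)
    qed auto
    then show ?thesis unfolding \<sigma> char_def by (subst integral_distr) auto
  qed
  let ?C = "(norm (A z) * \<bar>z\<bar> + norm (B z) * \<bar>b * z\<bar>)"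
  \<comment> \<open>The mesh tends to 0 with the horizon t fixed, leaving only the exponentially
    decaying error.\<close>
  have bound: "norm (f (Suc t) z - f t z + (A z * f t z - B z * f t (b * z))) \<le> ?C * (decay t * mean_L)" for t
  proof (rule LIMSEQ_le)
    show "(\<lambda>m. norm (val (1 / 2 ^ m) (Suc t * 2 ^ m) z - val (1 / 2 ^ m) (t * 2 ^ m) z +
        (A z * val (1 / 2 ^ m) (t * 2 ^ m) z - B z * val (1 / 2 ^ m) (t * 2 ^ m) (b * z)))) \<longlonglongrightarrow>
        norm (f (Suc t) z - f t z + (A z * f t z - B z * f t (b * z)))"
      by (intro tendsto_norm tendsto_add tendsto_diff tendsto_mult tendsto_const lim_m)
    have "(\<lambda>m. 2 ^ m * step_error z (1 / 2 ^ m) + ?C * (decay t * mean_L)) \<longlonglongrightarrow> 0 + ?C * (decay t * mean_L)"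
      by (intro tendsto_add tendsto_const step_error_tendsto)
    then show "(\<lambda>m. 2 ^ m * step_error z (1 / 2 ^ m) + ?C * (decay t * mean_L)) \<longlonglongrightarrow> ?C * (decay t * mean_L)" by simp
  qed (use norm_val_grid_diff_le in blast)
  \<comment> \<open>As t grows, f (Suc t) and f t have the same limit, so their difference drops out
    and the scaling equation remains.\<close>
  have "norm (char \<sigma> z - char \<sigma> z + (A z * char \<sigma> z - B z * char \<sigma> (b * z))) \<le> ?C * (0 * mean_L)"
  proof (rule LIMSEQ_le)
    show "(\<lambda>t. norm (f (Suc t) z - f t z + (A z * f t z - B z * f t (b * z)))) \<longlonglongrightarrow>
        norm (char \<sigma> z - char \<sigma> z + (A z * char \<sigma> z - B z * char \<sigma> (b * z)))"
      by (intro tendsto_norm tendsto_add tendsto_diff tendsto_mult tendsto_const lim_t LIMSEQ_Suc)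
    show "(\<lambda>t. ?C * (decay t * mean_L)) \<longlonglongrightarrow> ?C * (0 * mean_L)"
      by (intro tendsto_mult tendsto_const summable_LIMSEQ_zero decay_summable)
  qed (use bound in blast)
  then show "A z * char \<sigma> z = B z * char \<sigma> (b * z)" by simp
qed

text \<open>For b = 0 the weight at integers is the indicator of 0. Its values at integer times have
  a summable mean, so almost surely they tend to 0, which forces N to leave 0.\<close>

lemma AE_jump: "b = 0 \<Longrightarrow> AE \<omega> in M. \<exists>t\<ge>0. N t \<omega> \<ge> 1"
proof -
  assume b0: "b = 0"
  have "AE \<omega> in M. summable (\<lambda>t. \<psi> (N (real t) \<omega>))"
    by (rule AE_summable_of_summable_integral)
      (auto simp: integral_psi_N nonneg decay_summable intro: integrable_psi_N)
  with AE_good_path show ?thesis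
  proof eventually_elim
    case (elim \<omega>)
    interpret weighted_path "\<lambda>t. N t \<omega>" "\<lambda>t. L t \<omega>" \<psi> b by (rule weighted_path[OF elim(1)])
    have "(\<lambda>t. \<psi> (N (real t) \<omega>)) \<longlonglongrightarrow> 0" using elim(2) by (rule summable_LIMSEQ_zero)
    then have "\<forall>\<^sub>F t in sequentially. \<psi> (N (real t) \<omega>) < 1" by (rule order_tendstoD) simp
    then obtain t where t: "\<psi> (N (real t) \<omega>) < 1" by (auto simp: eventually_sequentially)
    obtain k where k: "N (real t) \<omega> = real k" using n_Nats[of "real t"] by (auto simp: Nats_def)
    with t weight[of k] have "k \<noteq> 0" by (cases k) auto
    with k show ?case by (intro exI[of _ "real t"]) auto
  qed
qed

end

section \<open>Transfer to the given process\<close>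

lemma cpp_of_bivariate_cpp:
  assumes "bivariate_cpp c k u v w M N L" "c > 1" "u \<ge> 0" "v \<ge> 0" "w \<ge> 0" "u + w > 0"
  shows "cpp M N L u v w (c powi (- k))"
proof -
  have levy: "levy_process M (\<lambda>t \<omega>. (N t \<omega>, L t \<omega>))"
    using assms(1) unfolding bivariate_cpp_def by blast
  then interpret prob_space M unfolding levy_process_def by blast
  show ?thesis
  proof
    fix t z1 z2 :: real assume t: "t \<ge> 0"
    have "(\<lambda>x :: real \<times> real. iexp (z1 * fst x + z2 * snd x) - 1) \<in> borel_measurable borel"
      unfolding borel_prod[symmetric] by measurable
    from integral_jump_measure[OF assms(2-5) this] t assms(1)
    show "(CLINT \<omega>|M. iexp (z1 * N t \<omega> + z2 * L t \<omega>)) =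
        exp (of_real t * (u * (iexp z1 - 1) + v * (iexp z2 - 1) + w * (iexp (z1 + c powi (- k) * z2) - 1)))"
      unfolding bivariate_cpp_def by (simp add: mult.commute)
  qed (use assms levy in auto)
qed

lemma (in weighted_cpp) classification:
  fixes p q r :: real and G :: "'a \<Rightarrow> real"
  assumes G: "AE \<omega> in M. G \<omega> = Lim at_top (\<lambda>t. X t \<omega>)"
    and pqr: "p = u / (u + v + w)" "q = v / (u + v + w)" "r = w / (u + v + w)"
  defines "\<sigma> \<equiv> distr (completion M) borel G"
  shows "(p = 0 \<or> r = 0 \<longrightarrow> \<sigma> \<in> ID) \<and>
    (0 < r \<and> r < p \<longrightarrow> \<sigma> \<in> ID \<union> ID0 \<and> quasi_levy_measure_on_pos \<sigma>) \<and>
    (0 < p \<and> p < r \<longrightarrow> \<sigma> \<in> ID0) \<and>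
    (p = r \<and> r > 0 \<longrightarrow> \<sigma> \<in> ID00)"
proof -
  have s: "u + v + w > 0" using rate uvw by simp
  then have s': "complex_of_real (u + v + w) \<noteq> 0" by (simp only: of_real_eq_0_iff)
  have nonneg: "p \<ge> 0" "q \<ge> 0" "r \<ge> 0" using uvw s by (auto simp: pqr)
  have sum: "p + q + r = 1" using s by (simp add: pqr add_divide_distrib[symmetric])
  have pr: "p + r > 0" using s rate by (simp add: pqr add_divide_distrib[symmetric])
  have eq: "(1 - of_real q * iexp z) * char \<sigma> z = (of_real p + of_real r * iexp (a * z)) * char \<sigma> (b * z)" for z
  proof -
    have "1 - x / S * e = (S - x * e) / S" "y / S + x / S * e = (y + x * e) / S" if "S \<noteq> 0" for x y e S :: complex
      using that by (auto simp: diff_divide_distrib add_divide_distrib)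
    from this[OF s'] have "1 - of_real q * iexp z = A z / of_real (u + v + w)"
      "of_real p + of_real r * iexp (a * z) = B z / of_real (u + v + w)"
      unfolding pqr A_def B_def of_real_divide of_real_add by blast+
    then show ?thesis
      using limit_law(3)[OF G, of z] by (simp add: \<sigma>_def)
  qed
  note * = classification_of_scaling_equation[OF limit_law(1)[OF G] limit_law(2)[OF G] nonneg sum pr b a, folded \<sigma>_def, OF eq]
  show ?thesis using * by blast
qed

theorem theorem4p1:
  fixes c u v w p q r :: real
    and M :: "int \<Rightarrow> 'a measure"
    and N L :: "int \<Rightarrow> real \<Rightarrow> 'a \<Rightarrow> real"
    and \<rho> \<mu> :: "int \<Rightarrow> real measure"
  assumes "c > 1"
    and "p \<ge> 0" "q \<ge> 0" "r \<ge> 0" "p + q + r = 1" "p + r > 0" "q + r > 0"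
    and "u \<ge> 0" "v \<ge> 0" "w \<ge> 0"
    and "p = u / (u + v + w)" "q = v / (u + v + w)" "r = w / (u + v + w)"
    and "\<And>k. bivariate_cpp c k u v w (M k) (N k) (L k)"
    and "\<And>k. \<rho> k = rho_law (M k) (N k) (L k)"
    and "\<And>k. \<mu> k = mu_law c (M k) (N k) (L k)"
  shows "(p = 0 \<or> r = 0 \<longrightarrow> (\<forall>k. \<rho> k \<in> ID \<and> \<mu> k \<in> ID)) \<and>
    (0 < r \<and> r < p \<longrightarrow>
      (\<forall>k. \<rho> k \<in> ID \<union> ID0 \<and> \<mu> k \<in> ID \<union> ID0 \<and>
           quasi_levy_measure_on_pos (\<rho> k) \<and> quasi_levy_measure_on_pos (\<mu> k))) \<and>
    (0 < p \<and> p < r \<longrightarrow> (\<forall>k. \<rho> k \<in> ID0 \<and> \<mu> k \<in> ID0)) \<and>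
    (p = r \<and> r > 0 \<longrightarrow> (\<forall>k. \<rho> k \<in> ID00 \<and> \<mu> k \<in> ID00))"
proof -
  \<comment> \<open>This is p + r > 0; were u + v + w zero, division by zero would make p and r
    vanish.\<close>
  have rate: "u + w > 0"
  proof (rule ccontr)
    assume "\<not> u + w > 0"
    then have "u = 0" "w = 0" using assms by auto
    then show False using assms by simp
  qed
  have main: "(p = 0 \<or> r = 0 \<longrightarrow> \<sigma> \<in> ID) \<and>
    (0 < r \<and> r < p \<longrightarrow> \<sigma> \<in> ID \<union> ID0 \<and> quasi_levy_measure_on_pos \<sigma>) \<and>
    (0 < p \<and> p < r \<longrightarrow> \<sigma> \<in> ID0) \<and>
    (p = r \<and> r > 0 \<longrightarrow> \<sigma> \<in> ID00)"
    if \<sigma>: "\<sigma> = \<rho> k \<or> \<sigma> = \<mu> k" for \<sigma> k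
  proof -
    interpret cpp "M k" "N k" "L k" u v w "c powi (- k)"
      by (rule cpp_of_bivariate_cpp[OF assms(14) assms(1) assms(8-10) rate])
    from \<sigma> show ?thesis
    proof
      assume \<sigma>: "\<sigma> = \<mu> k"
      interpret weighted_cpp "M k" "N k" "L k" u v w "c powi (- k)" "\<lambda>x. c powr (- x)" "1 / c"
      proof
        show "continuous_on UNIV (\<lambda>x. c powr (- x))" using assms(1) by (intro continuous_intros) auto
        show "c powr (- real j) = (1 / c) ^ j" for j
          using assms(1) by (simp add: powr_minus powr_realpow power_one_over inverse_eq_divide)
      qed (use assms(1) in auto)
      have "exp_integral c (\<lambda>t. N k t \<omega>) (\<lambda>t. L k t \<omega>) = (\<lambda>t. X t \<omega>)" for \<omega>
        by (simp add: fun_eq_iff exp_integral_def stieltjes_integral_def)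
      then have "\<sigma> = distr (completion (M k)) borel (\<lambda>\<omega>. Lim at_top (\<lambda>t. X t \<omega>))"
        unfolding \<sigma> assms(16) mu_law_def by simp
      then show ?thesis
        using classification[of "\<lambda>\<omega>. Lim at_top (\<lambda>t. X t \<omega>)", OF _ assms(11-13)] by simp
    next
      assume \<sigma>: "\<sigma> = \<rho> k"
      interpret weighted_cpp "M k" "N k" "L k" u v w "c powi (- k)" "\<lambda>x. max 0 (1 - \<bar>x\<bar>)" 0
      proof
        show "continuous_on UNIV (\<lambda>x::real. max 0 (1 - \<bar>x\<bar>))" by (intro continuous_intros)
        show "max 0 (1 - \<bar>real j\<bar>) = 0 ^ j" for j by (cases j) auto
      qed auto
      have "AE \<omega> in M k. L k (first_jump_time (\<lambda>t. N k t \<omega>)) \<omega> = Lim at_top (\<lambda>t. X t \<omega>)"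
        using AE_good_path AE_jump[OF refl]
      proof eventually_elim
        case (elim \<omega>)
        then show ?case using stieltjes_integral_first_jump[OF elim(1)] by auto
      qed
      from classification[OF this assms(11-13)] show ?thesis
        unfolding \<sigma> assms(15) rho_law_def .
    qed
  qed
  from main[of "\<rho> _" _, OF disjI1[OF refl]] main[of "\<mu> _" _, OF disjI2[OF refl]]
  show ?thesis by blast
qed

end
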